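(* Let $0<\alpha<2$ and $0<H<1$, let $(Y(t),t\ge0)$ be the FBM-$H$-local time fractional symmetric $\alpha$-stable motion, and let $Z_n=Y(n+1)-Y(n)$, $n=0,1,2,\ldots$, be its increment process (the FBM-$H$-local time fractional S$\alpha$S noise). Then the stationary S$\alpha$S process $(Z_n,n\ge 0)$ is generated by a conservative null flow.
   Context: A fractional Brownian motion $(B_H(t),t\ge0)$ with exponent $0<H<1$ is the continuous zero-mean Gaussian process with covariance $\mathrm{Cov}(B_H(s),B_H(t))=\frac{\mathbf{E}'B_H(1)^2}{2}\left[t^{2H}+s^{2H}-|t-s|^{2H}\right]$, with $\mathbf{E}'B_H(1)^2>0$. It lives on a probability space $(\Omega',\mathcal{F}',\mathbf{P}')$ and has a local time process $l=l(x,t)(\omega')$, $x\in\mathbb{R}$, $t\ge0$, jointly continuous in $(x,t)$ (so $\int_0^t g(B_H(s))\,ds=\int_{\mathbb{R}}g(x)l(x,t)\,dx$ for all nonnegative measurable $g$). A symmetric $\alpha$-stable (S$\alpha$S) random measure $M$ on a measurable space $(E,\mathcal{E})$ with $\sigma$-finite control measure $m$ is an independently scattered random measure whose integrals $\int_E f\,dM$ are defined for $f\in L^\alpha(E,m)$, are linear in $f$, and satisfy $\mathbf{E}\exp\left(i\theta\int_E f\,dM\right)=\exp\left(-|\theta|^\alpha\int_E|f|^\alpha\,dm\right)$. The FBM-$H$-local time fractional symmetric $\alpha$-stable motion is $Y(t)=\int_{\Omega'}\int_{\mathbb{R}}l(x,t)(\omega')\,M(d\omega',dx)$, $t\ge0$,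 where $M$ is an S$\alpha$S random measure on $\Omega'\times\mathbb{R}$ with control measure $\mathbf{P}'\times\mathrm{Leb}$ (living on another probability space). It has stationary increments, so $(Z_n)$ is stationary. Flows. A stationary S$\alpha$S process $(Z_n,n\ge0)$ is generated by the flow $(\phi^n,n\in\mathbf{Z})$ if, in distribution, $Z_n=\int_E f_n\,dM_1$, $n\ge0$, where $M_1$ is an S$\alpha$S random measure on a measurable space $(E,\mathcal{E})$ with $\sigma$-finite control measure $m$, and $$f_n(x)=a_n(x)\left(\frac{dm\circ\phi^n}{dm}(x)\right)^{1/\alpha}f\circ\phi^n(x),\qquad x\in E,\ n=0,1,2,\ldots.$$ Here $\phi:E\to E$ is a nonsingular map (a bijection with $\phi$ and $\phi^{-1}$ measurable, mapping $m$ into an equivalent measure), $a_n(x)=\prod_{j=0}^{n-1}u\circ\phi^j(x)$ with $u:E\to\{-1,1\}$ measurable, $f\in L^\alpha(E,m)$, and the representation has full support, i.e. $\bigcup_{n\ge0}\{x:f_n(x)\ne0\}=E$ up to an $m$-null set. The flow is conservative if there is no measurable set $W\subset E$ with $m(W)>0$ such that the sets $\phi^n(W)$, $n\in\mathbf{Z}$, are pairwise disjoint (no wandering set of positive measure). It is null if there is no nonzero finite $\phi$-invariant measure on $(E,\mathcal{E})$ that is absolutely continuous with respect to $m$. It is a conservative null flow if it is both conservative and null. *)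

theory Defs
  imports "HOL-Probability.Probability"
begin

text \<open>The zero random variable counts as a (degenerate) centered normal variable.\<close>

definition centered_normal :: "'a measure \<Rightarrow> ('a \<Rightarrow> real) \<Rightarrow> bool" where
  "centered_normal P X \<longleftrightarrow> X \<in> borel_measurable P \<and>
     ((AE \<omega> in P. X \<omega> = 0) \<or>
      (\<exists>\<sigma>>0. distributed P lborel X (\<lambda>x. ennreal (normal_density 0 \<sigma> x))))"

text \<open>Time runs through \<open>t \<ge> 0\<close>; the values \<open>B t\<close> for \<open>t < 0\<close> are irrelevant. Since the process is
  centered, \<open>\<integral>\<omega>. B s \<omega> * B t \<omega> \<partial>P\<close> is the covariance of \<open>B s\<close> and \<open>B t\<close>.\<close>

locale fractional_brownian_motion = prob_space P
  for P :: "'a measure" and H :: real and B :: "real \<Rightarrow> 'a \<Rightarrow> real" +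
  assumes continuous_paths: "AE \<omega> in P. continuous_on {0..} (\<lambda>t. B t \<omega>)"
    and gaussian: "\<And>T c. finite T \<Longrightarrow> T \<subseteq> {0..} \<Longrightarrow> centered_normal P (\<lambda>\<omega>. \<Sum>t\<in>T. c t * B t \<omega>)"
    and variance_pos: "0 < (\<integral>\<omega>. (B 1 \<omega>)\<^sup>2 \<partial>P)"
    and covariance: "\<And>s t. 0 \<le> s \<Longrightarrow> 0 \<le> t \<Longrightarrow>
      (\<integral>\<omega>. B s \<omega> * B t \<omega> \<partial>P) =
        (\<integral>\<omega>. (B 1 \<omega>)\<^sup>2 \<partial>P) / 2 * (t powr (2 * H) + s powr (2 * H) - \<bar>t - s\<bar> powr (2 * H))"

text \<open>Nonnegativity is listed separately because \<open>ennreal\<close> truncates negative values, so that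
  the occupation formula alone would only see the positive part of \<open>l\<close>.\<close>

locale local_time = prob_space P
  for P :: "'a measure" and B :: "real \<Rightarrow> 'a \<Rightarrow> real" and l :: "real \<Rightarrow> real \<Rightarrow> 'a \<Rightarrow> real" +
  assumes measurable_local_time:
      "\<And>t. 0 \<le> t \<Longrightarrow> (\<lambda>(\<omega>, x). l x t \<omega>) \<in> borel_measurable (P \<Otimes>\<^sub>M lborel)"
    and local_time_nonneg: "AE \<omega> in P. \<forall>x. \<forall>t\<ge>0. 0 \<le> l x t \<omega>"
    and jointly_continuous: "AE \<omega> in P. continuous_on (UNIV \<times> {0..}) (\<lambda>(x, t). l x t \<omega>)"
    and occupation_formula:
      "AE \<omega> in P. \<forall>t\<ge>0. \<forall>g :: real \<Rightarrow> ennreal. g \<in> borel_measurable borel \<longrightarrow>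
         (\<integral>\<^sup>+s\<in>{0..t}. g (B s \<omega>) \<partial>lborel) = (\<integral>\<^sup>+x. g x * ennreal (l x t \<omega>) \<partial>lborel)"

definition L_alpha :: "real \<Rightarrow> 'e measure \<Rightarrow> ('e \<Rightarrow> real) set" where
  "L_alpha \<alpha> m = {f \<in> borel_measurable m. integrable m (\<lambda>x. \<bar>f x\<bar> powr \<alpha>)}"

text \<open>\<open>M A\<close> is the random measure of a set \<open>A\<close> with \<open>m A < \<infinity>\<close>, and \<open>I f\<close> is (a version of) the
  integral \<open>\<integral>f dM\<close>, \<open>f \<in> L\<^sup>\<alpha>(m)\<close>. Linearity together with the characteristic function forces
  \<open>I f\<close> to be the limit in probability of the integrals of simple functions converging to \<open>f\<close> in
  \<open>L\<^sup>\<alpha>\<close>, so \<open>I\<close> is determined by \<open>M\<close> up to null sets.\<close>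

locale sas_random_measure = prob_space P + control: sigma_finite_measure m
  for P :: "'w measure" and \<alpha> :: real and m :: "'e measure"
    and M :: "'e set \<Rightarrow> 'w \<Rightarrow> real" and I :: "('e \<Rightarrow> real) \<Rightarrow> 'w \<Rightarrow> real" +
  assumes independently_scattered:
      "\<And>A :: nat \<Rightarrow> 'e set. disjoint_family A \<Longrightarrow> (\<And>n. A n \<in> sets m) \<Longrightarrow>
        (\<And>n. emeasure m (A n) < \<infinity>) \<Longrightarrow> indep_vars (\<lambda>_. borel) (\<lambda>n. M (A n)) UNIV"
    and countably_additive:
      "\<And>A :: nat \<Rightarrow> 'e set. disjoint_family A \<Longrightarrow> (\<And>n. A n \<in> sets m) \<Longrightarrow>
        emeasure m (\<Union>n. A n) < \<infinity> \<Longrightarrow> AE \<omega> in P. (\<lambda>n. M (A n) \<omega>) sums M (\<Union>n. A n) \<omega>"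
    and integral_indicator:
      "\<And>A. A \<in> sets m \<Longrightarrow> emeasure m A < \<infinity> \<Longrightarrow> AE \<omega> in P. I (indicator A) \<omega> = M A \<omega>"
    and integral_measurable: "\<And>f. f \<in> L_alpha \<alpha> m \<Longrightarrow> I f \<in> borel_measurable P"
    and integral_linear:
      "\<And>f g a b. f \<in> L_alpha \<alpha> m \<Longrightarrow> g \<in> L_alpha \<alpha> m \<Longrightarrow>
        AE \<omega> in P. I (\<lambda>x. a * f x + b * g x) \<omega> = a * I f \<omega> + b * I g \<omega>"
    and integral_char:
      "\<And>f \<theta>. f \<in> L_alpha \<alpha> m \<Longrightarrow>
        char (distr P borel (I f)) \<theta> =
          complex_of_real (exp (- (\<bar>\<theta>\<bar> powr \<alpha> * (\<integral>x. \<bar>f x\<bar> powr \<alpha> \<partial>m))))"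

definition local_time_stable_motion ::
    "(('a \<times> real \<Rightarrow> real) \<Rightarrow> 'w \<Rightarrow> real) \<Rightarrow> (real \<Rightarrow> real \<Rightarrow> 'a \<Rightarrow> real) \<Rightarrow> real \<Rightarrow> 'w \<Rightarrow> real" where
  "local_time_stable_motion I l t = I (\<lambda>(\<omega>', x). l x t \<omega>')"

definition local_time_stable_noise ::
    "(('a \<times> real \<Rightarrow> real) \<Rightarrow> 'w \<Rightarrow> real) \<Rightarrow> (real \<Rightarrow> real \<Rightarrow> 'a \<Rightarrow> real) \<Rightarrow> nat \<Rightarrow> 'w \<Rightarrow> real" where
  "local_time_stable_noise I l n \<omega> =
     local_time_stable_motion I l (real n + 1) \<omega> - local_time_stable_motion I l (real n) \<omega>"

definition nonsingular_map :: "'e measure \<Rightarrow> ('e \<Rightarrow> 'e) \<Rightarrow> bool" where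
  "nonsingular_map m \<phi> \<longleftrightarrow>
     bij_betw \<phi> (space m) (space m) \<and>
     \<phi> \<in> measurable m m \<and> the_inv_into (space m) \<phi> \<in> measurable m m \<and>
     absolutely_continuous m (distr m m \<phi>) \<and> absolutely_continuous (distr m m \<phi>) m"

definition flow_iterate :: "'e measure \<Rightarrow> ('e \<Rightarrow> 'e) \<Rightarrow> int \<Rightarrow> 'e \<Rightarrow> 'e" where
  "flow_iterate m \<phi> n =
     (if 0 \<le> n then \<phi> ^^ nat n else the_inv_into (space m) \<phi> ^^ nat (- n))"

text \<open>The measure \<open>m \<circ> \<phi>\<^sup>n\<close>, that is \<open>A \<mapsto> m (\<phi>\<^sup>n(A))\<close>: the image of \<open>m\<close> under \<open>\<phi>\<^sup>-\<^sup>n\<close>.\<close>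

definition flow_measure :: "'e measure \<Rightarrow> ('e \<Rightarrow> 'e) \<Rightarrow> int \<Rightarrow> 'e measure" where
  "flow_measure m \<phi> n = distr m m (flow_iterate m \<phi> (- n))"

definition flow_kernel ::
    "real \<Rightarrow> 'e measure \<Rightarrow> ('e \<Rightarrow> 'e) \<Rightarrow> ('e \<Rightarrow> real) \<Rightarrow> ('e \<Rightarrow> real) \<Rightarrow> nat \<Rightarrow> 'e \<Rightarrow> real" where
  "flow_kernel \<alpha> m \<phi> u f n x =
     (\<Prod>j<n. u ((\<phi> ^^ j) x)) *
     enn2real (RN_deriv m (flow_measure m \<phi> (int n)) x) powr (1 / \<alpha>) *
     f ((\<phi> ^^ n) x)"

text \<open>Equality in distribution is equality of the laws on the sequence space. The probability
  space \<open>P\<^sub>1\<close> of the representing random measure is existentially quantified; as HOL does not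
  quantify over types, it is taken on the same type as \<open>P\<close>.\<close>

definition generated_by_flow ::
    "'w measure \<Rightarrow> (nat \<Rightarrow> 'w \<Rightarrow> real) \<Rightarrow> real \<Rightarrow> 'e measure \<Rightarrow> ('e \<Rightarrow> 'e) \<Rightarrow> bool" where
  "generated_by_flow P Z \<alpha> m \<phi> \<longleftrightarrow>
     nonsingular_map m \<phi> \<and>
     (\<exists>u f (P\<^sub>1 :: 'w measure) M\<^sub>1 I\<^sub>1.
        u \<in> borel_measurable m \<and> (\<forall>x\<in>space m. u x \<in> {-1, 1}) \<and>
        f \<in> L_alpha \<alpha> m \<and>
        (AE x in m. \<exists>n. flow_kernel \<alpha> m \<phi> u f n x \<noteq> 0) \<and>
        sas_random_measure P\<^sub>1 \<alpha> m M\<^sub>1 I\<^sub>1 \<and>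
        distr P (PiM UNIV (\<lambda>_. borel)) (\<lambda>\<omega> n. Z n \<omega>) =
        distr P\<^sub>1 (PiM UNIV (\<lambda>_. borel)) (\<lambda>\<omega> n. I\<^sub>1 (flow_kernel \<alpha> m \<phi> u f n) \<omega>))"

definition conservative_flow :: "'e measure \<Rightarrow> ('e \<Rightarrow> 'e) \<Rightarrow> bool" where
  "conservative_flow m \<phi> \<longleftrightarrow>
     \<not> (\<exists>W\<in>sets m. 0 < emeasure m W \<and> disjoint_family (\<lambda>n::int. flow_iterate m \<phi> n ` W))"

definition null_flow :: "'e measure \<Rightarrow> ('e \<Rightarrow> 'e) \<Rightarrow> bool" where
  "null_flow m \<phi> \<longleftrightarrow>
     \<not> (\<exists>\<nu>. sets \<nu> = sets m \<and> finite_measure \<nu> \<and> emeasure \<nu> (space \<nu>) \<noteq> 0 \<and>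
           absolutely_continuous m \<nu> \<and> distr \<nu> \<nu> \<phi> = \<nu>)"

end

theory Submission
  imports Defs
begin

text \<open>The kernel of the noise is \<open>D n (\<omega>, x) = l x (n + 1) \<omega> - l x n \<omega>\<close>, the local time that \<open>B\<close> spends at
  level \<open>x\<close> during \<open>[n, n + 1]\<close>. It is also the local time at level \<open>0\<close> during \<open>[0, 1]\<close> of the path
  \<open>t \<mapsto> B (t + n) \<omega> - x\<close>. So, for the functional \<open>path_local_time\<close> that assigns to a path its local
  time at \<open>0\<close> during \<open>[0, 1]\<close>, all kernels come from this one functional along the orbit of \<open>B - x\<close>
  under the unit time shift. If \<open>x\<close> is distributed by Lebesgue measure, then the \<open>\<sigma>\<close>-finite law of
  \<open>B - x\<close> is invariant under this shift: the shift replaces \<open>B\<close> by its increments after time \<open>1\<close>,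
  which have the law of \<open>B\<close>, and translates \<open>x\<close> by \<open>B 1\<close>.

  The shift on paths over \<open>[0, \<infinity>)\<close> is not invertible, so a flow requires two-sided time. The
  Kolmogorov extension theorem yields the law of a two-sided fractional Brownian motion with rational
  times; \<open>two_sided_copy\<close> realizes it by a process \<open>X\<close> on the original probability space, as a function of
  the normal variable \<open>B 1\<close>. Then \<open>(\<omega>, x) \<mapsto> X \<omega> - x\<close> maps \<open>P \<Otimes> Leb\<close> to a shift invariant measure on
  two-sided paths, and the given stable random measure can be pulled back along this map (\<open>pullback\<close>).
  The finite-dimensional laws of a stable process depend only on the \<open>L\<^sup>\<alpha>\<close>-norms of the linear
  combinations of its kernels, and those laws determine the law of the sequence
  (\<open>distr_PiM_eqI_char\<close>). The norms for \<open>B\<close> and for \<open>X\<close> agree (\<open>combination_law_transfer\<close>) because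
  \<open>path_local_time\<close> reads a path only at nonnegative rational times, where \<open>B\<close> and \<open>X\<close> have the same law.

  Conservativity and nullity use only that \<open>w n - w 0\<close> is normal with standard deviation of order
  \<open>n\<^sup>H\<close>, where \<open>w\<close> is a path and \<open>w 0\<close> is distributed by Lebesgue measure. If a set of paths with
  \<open>\<bar>w 0\<bar> \<le> K\<close> and positive measure were wandering, then each of its first \<open>N\<close> images would have at least
  half its mass in \<open>\<bar>w 0\<bar> \<le> K + R N\<^sup>H\<close> for a suitable constant \<open>R\<close>. The images are disjoint, so that total
  mass is of order \<open>N\<close>; but the strip has measure of order \<open>N\<^sup>H\<close> and \<open>H < 1\<close>. The flow is null
  because the measure of \<open>\<bar>w 0\<bar> \<le> J \<and> \<bar>w n\<bar> \<le> K\<close> tends to \<open>0\<close>, whereas a finite invariant measure gives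
  all events \<open>\<bar>w n\<bar> \<le> K\<close> the same mass.

  Full support is achieved by restriction to the invariant set of paths for which some kernel with
  index in \<open>\<int>\<close> is nonzero; by recurrence of conservative flows some kernel with index in \<open>\<nat>\<close> is then
  nonzero as well. Finally, \<open>local_time_L_alpha\<close> shows that the kernels belong to \<open>L\<^sup>\<alpha>\<close>: for \<open>\<alpha> < 1\<close> this
  needs decay of the local time at infinity, for \<open>\<alpha> > 1\<close> its second moment.\<close>

section \<open>Laws on products are determined by characteristic functions\<close>

lemma char_distr:
  assumes "X \<in> borel_measurable P"
  shows "char (distr P borel X) t = (CLINT \<omega>|P. iexp (t * X \<omega>))"
  unfolding char_def using assms by (subst integral_distr) auto

text \<open>After normalization by the common total mass the weights turn \<open>P\<close> and \<open>Q\<close> into probability measures,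
  and the one-dimensional uniqueness theorem for characteristic functions applies. The hypothesis is
  stated with a phase \<open>\<theta>\<close>, so that it covers the cosine and the sine part at once.\<close>

lemma weighted_distribution_eqI:
  fixes h X :: "'a \<Rightarrow> real" and g Y :: "'b \<Rightarrow> real"
  assumes "prob_space P" and "prob_space Q"
    and [measurable]: "h \<in> borel_measurable P" "X \<in> borel_measurable P"
      "g \<in> borel_measurable Q" "Y \<in> borel_measurable Q"
    and h: "\<And>\<omega>. 0 \<le> h \<omega>" "\<And>\<omega>. h \<omega> \<le> C" and g: "\<And>\<omega>. 0 \<le> g \<omega>" "\<And>\<omega>. g \<omega> \<le> C"
    and cos: "\<And>t \<theta>. (\<integral>\<omega>. h \<omega> * cos (\<theta> + t * X \<omega>) \<partial>P) = (\<integral>\<omega>. g \<omega> * cos (\<theta> + t * Y \<omega>) \<partial>Q)"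
    and A [measurable]: "A \<in> sets borel"
  shows "(\<integral>\<omega>. h \<omega> * indicator A (X \<omega>) \<partial>P) = (\<integral>\<omega>. g \<omega> * indicator A (Y \<omega>) \<partial>Q)"
proof -
  interpret P: prob_space P by fact
  interpret Q: prob_space Q by fact
  have ih: "integrable P h"
    by (rule P.integrable_const_bound[of _ C]) (use h in auto)
  have ig: "integrable Q g"
    by (rule Q.integrable_const_bound[of _ C]) (use g in auto)
  define c where "c = (\<integral>\<omega>. h \<omega> \<partial>P)"
  have cg: "c = (\<integral>\<omega>. g \<omega> \<partial>Q)"
    unfolding c_def using cos[of 0 0] by simp
  have trig: "(CLINT \<omega>|P'. h' \<omega> *\<^sub>R iexp (t * X' \<omega>)) =
      Complex (\<integral>\<omega>. h' \<omega> * cos (0 + t * X' \<omega>) \<partial>P') (\<integral>\<omega>. h' \<omega> * cos (- pi / 2 + t * X' \<omega>) \<partial>P')"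
    if [measurable]: "h' \<in> borel_measurable P'" "X' \<in> borel_measurable P'" and ih: "integrable P' h'"
    for P' :: "'c measure" and h' X' :: "'c \<Rightarrow> real" and t
  proof -
    have i: "integrable P' (\<lambda>\<omega>. h' \<omega> *\<^sub>R iexp (t * X' \<omega>))"
      by (rule Bochner_Integration.integrable_bound[OF ih]) auto
    have s: "cos (- pi / 2 + y) = sin y" for y
      using sin_cos_eq[of y] cos_minus[of "pi / 2 - y"] by simp
    show ?thesis
      unfolding s using integral_Re[OF i] integral_Im[OF i]
      by (simp add: complex_eq_iff Re_exp Im_exp)
  qed
  have char: "(CLINT \<omega>|P. h \<omega> *\<^sub>R iexp (t * X \<omega>)) = (CLINT \<omega>|Q. g \<omega> *\<^sub>R iexp (t * Y \<omega>))" for t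
    by (subst (1 2) trig) (simp_all only: cos ih ig assms)
  have c0: "0 \<le> c" unfolding c_def using h by simp
  show ?thesis
  proof (cases "c = 0")
    case True
    then have "AE \<omega> in P. h \<omega> = 0" "AE \<omega> in Q. g \<omega> = 0"
      using integral_nonneg_eq_0_iff_AE[OF ih] integral_nonneg_eq_0_iff_AE[OF ig] h g cg c_def by auto
    then have "AE \<omega> in P. h \<omega> * indicator A (X \<omega>) = 0" "AE \<omega> in Q. g \<omega> * indicator A (Y \<omega>) = 0"
      by auto
    then show ?thesis by (simp add: integral_eq_zero_AE)
  next
    case False
    with c0 have c: "0 < c" by simp
    define P2 where "P2 = density P (\<lambda>\<omega>. ennreal (h \<omega> / c))"
    define Q2 where "Q2 = density Q (\<lambda>\<omega>. ennreal (g \<omega> / c))"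
    have "prob_space P2"
      unfolding P2_def
      by (rule prob_spaceI) (use c h ih in \<open>simp add: emeasure_density nn_integral_eq_integral c_def[symmetric]\<close>)
    have "prob_space Q2"
      unfolding Q2_def
      by (rule prob_spaceI) (use c g ig in \<open>simp add: emeasure_density nn_integral_eq_integral cg[symmetric]\<close>)
    have X2 [measurable]: "X \<in> borel_measurable P2" "Y \<in> borel_measurable Q2"
      by (simp_all add: P2_def Q2_def)
    have rd: "real_distribution (distr P2 borel X)" "real_distribution (distr Q2 borel Y)"
      using \<open>prob_space P2\<close> \<open>prob_space Q2\<close>
      by (auto intro!: prob_space.prob_space_distr simp: real_distribution_def real_distribution_axioms_def)
    have "char (distr P2 borel X) = char (distr Q2 borel Y)"
    proof
      fix t
      have "char (distr P2 borel X) t = (CLINT \<omega>|P. (h \<omega> / c) *\<^sub>R iexp (t * X \<omega>))"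
        unfolding char_distr[OF X2(1)] unfolding P2_def using h c
        by (subst integral_density) auto
      also have "\<dots> = (1 / c) *\<^sub>R (CLINT \<omega>|P. h \<omega> *\<^sub>R iexp (t * X \<omega>))"
        by (subst integral_scaleR_right[symmetric]) (simp)
      also have "\<dots> = (1 / c) *\<^sub>R (CLINT \<omega>|Q. g \<omega> *\<^sub>R iexp (t * Y \<omega>))"
        by (simp only: char)
      also have "\<dots> = (CLINT \<omega>|Q. (g \<omega> / c) *\<^sub>R iexp (t * Y \<omega>))"
        by (subst integral_scaleR_right[symmetric]) (simp)
      also have "\<dots> = char (distr Q2 borel Y) t"
        unfolding char_distr[OF X2(2)] unfolding Q2_def using g c
        by (subst integral_density) auto
      finally show "char (distr P2 borel X) t = char (distr Q2 borel Y) t" .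
    qed
    from Levy_uniqueness[OF rd this]
    have "(\<integral>x. indicator A x \<partial>distr P2 borel X) = (\<integral>x. indicator A x \<partial>distr Q2 borel Y :: real)"
      by simp
    then have "(\<integral>\<omega>. indicator A (X \<omega>) \<partial>P2) = (\<integral>\<omega>. indicator A (Y \<omega>) \<partial>Q2 :: real)"
      by (subst (asm) (1 2) integral_distr) auto
    then have "(\<integral>\<omega>. (h \<omega> / c) * indicator A (X \<omega>) \<partial>P) = (\<integral>\<omega>. (g \<omega> / c) * indicator A (Y \<omega>) \<partial>Q)"
      unfolding P2_def Q2_def using h g c
      by (subst (asm) (1 2) integral_density) auto
    then show ?thesis using c by simp
  qed
qed

text \<open>The coordinates are converted from cosine factors to indicator factors one at a time. To convert
  coordinate \<open>k\<close>, the lemma above needs a nonnegative weight, and the cosine of the remaining linear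
  combination is not one. It is therefore applied to the weights \<open>h\<close> and \<open>h * (1 + cos S)\<close>, and the two
  results are subtracted; the product-to-sum formula reduces its hypothesis to the induction hypothesis.\<close>

lemma cylinder_integral_eqI:
  fixes X :: "'i \<Rightarrow> 'a \<Rightarrow> real" and Y :: "'i \<Rightarrow> 'b \<Rightarrow> real"
  assumes P: "prob_space P" and Q: "prob_space Q" and J: "finite J"
    and X: "\<And>j. j \<in> J \<Longrightarrow> X j \<in> borel_measurable P"
    and Y: "\<And>j. j \<in> J \<Longrightarrow> Y j \<in> borel_measurable Q"
    and cos: "\<And>c \<theta>. (\<integral>\<omega>. cos (\<theta> + (\<Sum>j\<in>J. c j * X j \<omega>)) \<partial>P) = (\<integral>\<omega>. cos (\<theta> + (\<Sum>j\<in>J. c j * Y j \<omega>)) \<partial>Q)"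
    and A: "\<And>j. j \<in> J \<Longrightarrow> A j \<in> sets borel"
    and "K \<subseteq> J"
  shows "(\<integral>\<omega>. (\<Prod>j\<in>K. indicator (A j) (X j \<omega>)) * cos (\<theta> + (\<Sum>j\<in>J - K. c j * X j \<omega>)) \<partial>P) =
    (\<integral>\<omega>. (\<Prod>j\<in>K. indicator (A j) (Y j \<omega>)) * cos (\<theta> + (\<Sum>j\<in>J - K. c j * Y j \<omega>)) \<partial>Q)"
  using finite_subset[OF \<open>K \<subseteq> J\<close> J] \<open>K \<subseteq> J\<close>
proof (induction K arbitrary: c \<theta> rule: finite_induct)
  case empty
  then show ?case using cos by simp
next
  case (insert k K)
  interpret P: prob_space P by fact
  interpret Q: prob_space Q by fact
  define h where "h \<omega> = (\<Prod>j\<in>K. indicat_real (A j) (X j \<omega>))" for \<omega>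
  define g where "g \<omega> = (\<Prod>j\<in>K. indicat_real (A j) (Y j \<omega>))" for \<omega>
  define S where "S \<omega> = \<theta> + (\<Sum>j\<in>J - insert k K. c j * X j \<omega>)" for \<omega>
  define T where "T \<omega> = \<theta> + (\<Sum>j\<in>J - insert k K. c j * Y j \<omega>)" for \<omega>
  have K: "K \<subseteq> J" "k \<in> J" "k \<notin> K" using insert by auto
  have [measurable]: "h \<in> borel_measurable P" "g \<in> borel_measurable Q"
      "S \<in> borel_measurable P" "T \<in> borel_measurable Q"
      "X k \<in> borel_measurable P" "Y k \<in> borel_measurable Q" "A k \<in> sets borel"
    unfolding h_def[abs_def] g_def[abs_def] S_def[abs_def] T_def[abs_def] using K X Y A
    by (auto intro!: borel_measurable_prod borel_measurable_sum borel_measurable_times borel_measurable_add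
        measurable_compose[OF _ borel_measurable_indicator] simp: subset_eq)
  have h: "0 \<le> h \<omega>" "h \<omega> \<le> 1" for \<omega>
    unfolding h_def by (auto intro!: prod_nonneg prod_le_1 simp: indicator_def)
  have g: "0 \<le> g \<omega>" "g \<omega> \<le> 1" for \<omega>
    unfolding g_def by (auto intro!: prod_nonneg prod_le_1 simp: indicator_def)
  have bd: "h \<omega> * (1 + cos (S \<omega>)) \<le> 2" "0 \<le> h \<omega> * (1 + cos (S \<omega>))" for \<omega>
    using mult_mono[of "h \<omega>" 1 "1 + cos (S \<omega>)" 2] h[of \<omega>] cos_ge_minus_one[of "S \<omega>"] cos_le_one[of "S \<omega>"] by (auto intro!: mult_nonneg_nonneg simp del: cos_ge_minus_one)
  have bd': "g \<omega> * (1 + cos (T \<omega>)) \<le> 2" "0 \<le> g \<omega> * (1 + cos (T \<omega>))" for \<omega>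
    using mult_mono[of "g \<omega>" 1 "1 + cos (T \<omega>)" 2] g[of \<omega>] cos_ge_minus_one[of "T \<omega>"] cos_le_one[of "T \<omega>"] by (auto intro!: mult_nonneg_nonneg simp del: cos_ge_minus_one)
  have JK: "J - K = insert k (J - insert k K)" using K by auto
  have shift: "(\<integral>\<omega>. h \<omega> * cos (\<theta>' + t * X k \<omega> + u * (S \<omega> - \<theta>)) \<partial>P) =
      (\<integral>\<omega>. g \<omega> * cos (\<theta>' + t * Y k \<omega> + u * (T \<omega> - \<theta>)) \<partial>Q)" for \<theta>' t u
    using insert.IH[OF K(1), of \<theta>' "\<lambda>j. if j = k then t else u * c j"] J K
    unfolding JK h_def[symmetric] g_def[symmetric] S_def T_def
    by (simp add: sum_distrib_left ac_simps cong: sum.cong_simp)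
  have intP: "integrable P (\<lambda>\<omega>. h \<omega> * cos (F \<omega>))" if [measurable]: "F \<in> borel_measurable P" for F
    by (rule P.integrable_const_bound[of _ 1]) (use h in \<open>auto simp: abs_mult intro!: mult_le_one AE_I2\<close>)
  have intQ: "integrable Q (\<lambda>\<omega>. g \<omega> * cos (F \<omega>))" if [measurable]: "F \<in> borel_measurable Q" for F
    by (rule Q.integrable_const_bound[of _ 1]) (use g in \<open>auto simp: abs_mult intro!: mult_le_one AE_I2\<close>)
  have product: "h' * (1 + cos s) * cos (\<phi> + x) = h' * cos (\<phi> + x) +
      (h' * cos (\<phi> + \<theta> + x + (s - \<theta>)) + h' * cos (\<phi> - \<theta> + x - (s - \<theta>))) / 2" for h' s x \<phi> :: real
    using cos_times_cos[of "\<phi> + x" s] by (simp add: algebra_simps)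
  have 1: "(\<integral>\<omega>. h \<omega> * indicator (A k) (X k \<omega>) \<partial>P) = (\<integral>\<omega>. g \<omega> * indicator (A k) (Y k \<omega>) \<partial>Q)"
  proof (rule weighted_distribution_eqI[OF P Q, where C = 1])
    show "(\<integral>\<omega>. h \<omega> * cos (\<theta>' + t * X k \<omega>) \<partial>P) = (\<integral>\<omega>. g \<omega> * cos (\<theta>' + t * Y k \<omega>) \<partial>Q)" for t \<theta>'
      using shift[of \<theta>' t 0] by simp
  qed (use h g in auto)
  have 2: "(\<integral>\<omega>. h \<omega> * (1 + cos (S \<omega>)) * indicator (A k) (X k \<omega>) \<partial>P) =
      (\<integral>\<omega>. g \<omega> * (1 + cos (T \<omega>)) * indicator (A k) (Y k \<omega>) \<partial>Q)"
  proof (rule weighted_distribution_eqI[OF P Q, where C = 2])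
    show "(\<integral>\<omega>. h \<omega> * (1 + cos (S \<omega>)) * cos (\<phi> + t * X k \<omega>) \<partial>P) =
        (\<integral>\<omega>. g \<omega> * (1 + cos (T \<omega>)) * cos (\<phi> + t * Y k \<omega>) \<partial>Q)" for t \<phi>
      unfolding product
      using shift[of \<phi> t 0] shift[of "\<phi> + \<theta>" t 1] shift[of "\<phi> - \<theta>" t "-1"]
      by (simp add: intP intQ)
  qed (use bd bd' in auto)
  have ind: "h' * (1 + y) * indicat_real B x - h' * indicat_real B x = indicat_real B x * h' * y" for h' y x B
    by (simp add: algebra_simps)
  have iP: "integrable P (\<lambda>\<omega>. h \<omega> * (1 + cos (S \<omega>)) * indicator (A k) (X k \<omega>))"
    "integrable P (\<lambda>\<omega>. h \<omega> * indicator (A k) (X k \<omega>))"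
    using bd h by (auto intro!: P.integrable_const_bound[of _ 2] AE_I2 simp: indicator_def) (smt (verit) h)
  have iQ: "integrable Q (\<lambda>\<omega>. g \<omega> * (1 + cos (T \<omega>)) * indicator (A k) (Y k \<omega>))"
    "integrable Q (\<lambda>\<omega>. g \<omega> * indicator (A k) (Y k \<omega>))"
    using bd' g by (auto intro!: Q.integrable_const_bound[of _ 2] AE_I2 simp: indicator_def) (smt (verit) g)
  have "(\<integral>\<omega>. indicator (A k) (X k \<omega>) * h \<omega> * cos (S \<omega>) \<partial>P) = (\<integral>\<omega>. indicator (A k) (Y k \<omega>) * g \<omega> * cos (T \<omega>) \<partial>Q)"
    using Bochner_Integration.integral_diff[OF iP] Bochner_Integration.integral_diff[OF iQ] 1 2
    unfolding ind by simp
  then show ?case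
    using insert.hyps unfolding S_def T_def h_def g_def by simp
qed

abbreviation product_law :: "'i set \<Rightarrow> 'a measure \<Rightarrow> ('i \<Rightarrow> 'a \<Rightarrow> real) \<Rightarrow> ('i \<Rightarrow> real) measure" where
  "product_law I P X \<equiv> distr P (PiM I (\<lambda>_. borel)) (\<lambda>\<omega>. \<lambda>i\<in>I. X i \<omega>)"

abbreviation combination_char :: "'a measure \<Rightarrow> ('i \<Rightarrow> 'a \<Rightarrow> real) \<Rightarrow> 'i set \<Rightarrow> ('i \<Rightarrow> real) \<Rightarrow> complex" where
  "combination_char P X J c \<equiv> char (distr P borel (\<lambda>\<omega>. \<Sum>j\<in>J. c j * X j \<omega>)) 1"

text \<open>The Cramer-Wold device, for processes with an arbitrary index set. Characteristic functions at \<open>1\<close>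
  suffice because the coefficients can be scaled.\<close>

lemma distr_PiM_eqI_char:
  fixes X :: "'i \<Rightarrow> 'a \<Rightarrow> real" and Y :: "'i \<Rightarrow> 'b \<Rightarrow> real"
  assumes P: "prob_space P" and Q: "prob_space Q"
    and X: "\<And>i. i \<in> I \<Longrightarrow> X i \<in> borel_measurable P"
    and Y: "\<And>i. i \<in> I \<Longrightarrow> Y i \<in> borel_measurable Q"
    and char: "\<And>J c. finite J \<Longrightarrow> J \<subseteq> I \<Longrightarrow>
      combination_char P X J c = combination_char Q Y J c"
  shows "product_law I P X = product_law I Q Y"
proof (rule measure_eqI_PiM_infinite)
  interpret P: prob_space P by fact
  interpret Q: prob_space Q by fact
  have m [measurable]: "(\<lambda>\<omega>. \<lambda>i\<in>I. X i \<omega>) \<in> measurable P (PiM I (\<lambda>_. borel))"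
     "(\<lambda>\<omega>. \<lambda>i\<in>I. Y i \<omega>) \<in> measurable Q (PiM I (\<lambda>_. borel))"
    using X Y by (auto intro!: measurable_restrict)
  show "finite_measure (product_law I P X)"
    by (intro P.finite_measure_distr m)
  fix A J assume J: "finite J" "J \<subseteq> I" and A: "\<And>i. i \<in> J \<Longrightarrow> A i \<in> sets (borel :: real measure)"
  have XJ [measurable]: "\<And>j. j \<in> J \<Longrightarrow> X j \<in> borel_measurable P" "\<And>j. j \<in> J \<Longrightarrow> Y j \<in> borel_measurable Q"
    using X Y J by auto
  have cos: "(\<integral>\<omega>. cos (\<theta> + (\<Sum>j\<in>J. c j * X j \<omega>)) \<partial>P) = (\<integral>\<omega>. cos (\<theta> + (\<Sum>j\<in>J. c j * Y j \<omega>)) \<partial>Q)" for c \<theta>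
  proof -
    have "(\<integral>\<omega>. cos (\<theta> + V \<omega>) \<partial>R) = Re (iexp \<theta> * char (distr R borel V) 1)"
      if "prob_space R" and [measurable]: "V \<in> borel_measurable R" for R :: "'c measure" and V
    proof -
      interpret R: prob_space R by fact
      have i: "integrable R (\<lambda>\<omega>. iexp (\<theta> + V \<omega>))"
        by (rule R.integrable_const_bound[of _ 1]) auto
      have "iexp \<theta> * char (distr R borel V) 1 = (CLINT \<omega>|R. iexp (\<theta> + V \<omega>))"
        by (subst char_distr) (auto simp: exp_add ring_distribs integral_mult_right_zero[symmetric] simp del: integral_mult_right_zero)
      then show ?thesis using integral_Re[OF i] by (simp add: Re_exp)
    qed
    note * = this
    show ?thesis
      using XJ by (subst (1 2) *) (auto simp: P Q char[OF J] intro!: borel_measurable_sum borel_measurable_times)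
  qed
  have "(\<integral>\<omega>. (\<Prod>j\<in>J. indicator (A j) (X j \<omega>)) \<partial>P) = (\<integral>\<omega>. (\<Prod>j\<in>J. indicat_real (A j) (Y j \<omega>)) \<partial>Q)"
    using cylinder_integral_eqI[where \<theta> = 0, OF P Q J(1) XJ cos A order_refl] by simp
  moreover have cyl: "emeasure (product_law I R V) (prod_emb I (\<lambda>_. borel) J (Pi\<^sub>E J A)) =
      ennreal (\<integral>\<omega>. (\<Prod>j\<in>J. indicator (A j) (V j \<omega>)) \<partial>R)"
    if "prob_space R" and V: "\<And>i. i \<in> I \<Longrightarrow> V i \<in> borel_measurable R" for R :: "'c measure" and V
  proof -
    interpret R: prob_space R by fact
    have [measurable]: "(\<lambda>\<omega>. \<lambda>i\<in>I. V i \<omega>) \<in> measurable R (PiM I (\<lambda>_. borel))"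
      using V by (auto intro!: measurable_restrict)
    have S: "prod_emb I (\<lambda>_. borel) J (Pi\<^sub>E J A) \<in> sets (PiM I (\<lambda>_. borel :: real measure))"
      using J A by (intro sets_PiM_I) auto
    have "(\<Prod>j\<in>J. indicat_real (A j) (V j \<omega>)) =
        indicator ((\<lambda>\<omega>. \<lambda>i\<in>I. V i \<omega>) -` (prod_emb I (\<lambda>_. borel) J (Pi\<^sub>E J A)) \<inter> space R) \<omega>"
      if "\<omega> \<in> space R" for \<omega>
      using J that by (auto simp: prod_emb_def PiE_iff indicator_def prod_zero_iff subset_eq)
    then have "(\<integral>\<omega>. (\<Prod>j\<in>J. indicator (A j) (V j \<omega>)) \<partial>R) = measure R ((\<lambda>\<omega>. \<lambda>i\<in>I. V i \<omega>) -` (prod_emb I (\<lambda>_. borel) J (Pi\<^sub>E J A)) \<inter> space R)"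
      by (subst Bochner_Integration.integral_cong[OF refl]) auto
    then show ?thesis
      using S by (simp add: emeasure_distr R.emeasure_eq_measure)
  qed
  ultimately show "emeasure (product_law I P X) (prod_emb I (\<lambda>_. borel) J (Pi\<^sub>E J A)) =
      emeasure (product_law I Q Y) (prod_emb I (\<lambda>_. borel) J (Pi\<^sub>E J A))"
    by (simp add: cyl[OF P X] cyl[OF Q Y])
qed simp_all

section \<open>Realizing a law on a countable product over an atomless space\<close>

text \<open>The digit of \<open>y\<close> at position \<open>n\<close> is \<open>1\<close> iff \<open>ternary_remainder n y \<ge> 1 / 3\<close>. In base three with
  digits \<open>0\<close> and \<open>1\<close> all later digits contribute at most \<open>1 / 6\<close> to the remainder, so that digits can
  be read off by comparison and no sequence of digits has two codes.\<close>

primrec ternary_remainder :: "nat \<Rightarrow> real \<Rightarrow> real" where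
  "ternary_remainder 0 y = y"
| "ternary_remainder (Suc n) y =
     3 * ternary_remainder n y - (if ternary_remainder n y \<ge> 1 / 3 then 1 else 0)"

definition ternary_code :: "(nat \<Rightarrow> bool) \<Rightarrow> real" where
  "ternary_code b = (\<Sum>n. of_bool (b n) / 3 ^ Suc n)"

lemma summable_ternary_code: "summable (\<lambda>n. of_bool (b n) / 3 ^ Suc n :: real)"
proof (rule summable_comparison_test')
  show "summable (\<lambda>n. (1 / 3) ^ Suc n :: real)"
    by (simp add: summable_geometric)
  show "norm (of_bool (b n) / 3 ^ Suc n :: real) \<le> (1 / 3) ^ Suc n" if "n \<ge> 0" for n
    by (auto simp: power_divide)
qed

lemma ternary_code_bounds: "0 \<le> ternary_code b" "ternary_code b \<le> 1 / 2"
proof -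
  show "0 \<le> ternary_code b"
    unfolding ternary_code_def by (intro suminf_nonneg summable_ternary_code) auto
  have s: "(\<lambda>n. 1 / 3 ^ Suc n :: real) sums (1 / 2)"
    using sums_mult[OF geometric_sums[of "1 / 3 :: real"], of "1 / 3"] by (simp add: power_divide)
  show "ternary_code b \<le> 1 / 2"
    unfolding ternary_code_def sums_unique[OF s]
    by (intro suminf_le summable_ternary_code sums_summable[OF s]) (auto simp: divide_right_mono)
qed

lemma ternary_code_Suc: "ternary_code b = of_bool (b 0) / 3 + ternary_code (\<lambda>n. b (Suc n)) / 3"
  unfolding ternary_code_def
  using suminf_split_head[OF summable_ternary_code[of b]]
    suminf_divide[OF summable_ternary_code[of "\<lambda>n. b (Suc n)"], of 3]
  by (simp add: field_simps)

lemma ternary_remainder_code: "ternary_remainder n (ternary_code b) = ternary_code (\<lambda>k. b (n + k))"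
proof (induction n)
  case (Suc n)
  have "ternary_code (\<lambda>k. b (n + k)) = of_bool (b n) / 3 + ternary_code (\<lambda>k. b (Suc n + k)) / 3"
    using ternary_code_Suc[of "\<lambda>k. b (n + k)"] by simp
  then show ?case
    using Suc ternary_code_bounds[of "\<lambda>k. b (Suc n + k)"] by (auto simp: field_simps)
qed simp

lemma ternary_digit_code: "ternary_remainder n (ternary_code b) \<ge> 1 / 3 \<longleftrightarrow> b n"
  using ternary_code_Suc[of "\<lambda>k. b (n + k)"] ternary_code_bounds[of "\<lambda>k. b (n + Suc k)"]
  by (auto simp: ternary_remainder_code)

lemma measurable_ternary_remainder [measurable]: "ternary_remainder n \<in> borel_measurable borel"
  by (induction n) (simp_all add: ternary_remainder.simps[abs_def])

lemma INF_Rats_above: "(INF q\<in>\<rat>. if y \<le> q then ereal q else \<infinity>) = ereal y"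
proof (rule antisym)
  show "(INF q\<in>\<rat>. if y \<le> q then ereal q else \<infinity>) \<le> ereal y"
  proof (rule ereal_le_epsilon2)
    fix e :: real assume "0 < e"
    then obtain r where r: "r \<in> \<rat>" "y < r" "r < y + e"
      using Rats_dense_in_real[of y "y + e"] by auto
    then show "(INF q\<in>\<rat>. if y \<le> q then ereal q else \<infinity>) \<le> ereal y + ereal e"
      by (intro INF_lower2[OF r(1)]) auto
  qed
  show "ereal y \<le> (INF q\<in>\<rat>. if y \<le> q then ereal q else \<infinity>)"
    by (rule INF_greatest) simp
qed

text \<open>A point \<open>p\<close> is determined by the countably many bits \<open>p i \<le> q\<close> with \<open>q\<close> rational, and these bits
  become the ternary digits of one real number.\<close>

lemma countable_product_borel_code:
  fixes I :: "'i set"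
  assumes I: "countable I" "I \<noteq> {}"
  obtains e :: "('i \<Rightarrow> real) \<Rightarrow> real" and d :: "'i \<Rightarrow> real \<Rightarrow> real"
  where "e \<in> borel_measurable (PiM I (\<lambda>_. borel))" "\<And>i. d i \<in> borel_measurable borel"
    "\<And>p i. i \<in> I \<Longrightarrow> d i (e p) = p i"
proof -
  define S where "S = I \<times> (\<rat> :: real set)"
  have S: "countable S" "S \<noteq> {}"
    using I by (auto simp: S_def countable_rat)
  define b where "b p n = (case from_nat_into S n of (i, q) \<Rightarrow> p i \<le> q)" for p :: "'i \<Rightarrow> real" and n
  define e where "e p = ternary_code (b p)" for p
  define d where "d i y = real_of_ereal (INF q\<in>\<rat>. if ternary_remainder (to_nat_on S (i, q)) y \<ge> 1 / 3 then ereal q else \<infinity>)"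
    for i y
  show ?thesis
  proof
    have [measurable]: "(\<lambda>p. b p n) \<in> measurable (PiM I (\<lambda>_. borel)) (count_space UNIV)" for n
    proof -
      obtain i q where iq: "from_nat_into S n = (i, q)" by force
      then have "i \<in> I" using from_nat_into[OF S(2), of n] by (auto simp: S_def)
      then show ?thesis unfolding b_def iq by simp measurable
    qed
    show "e \<in> borel_measurable (PiM I (\<lambda>_. borel))"
      unfolding e_def[abs_def] ternary_code_def by measurable
    show "d i \<in> borel_measurable borel" for i
      unfolding d_def[abs_def] using countable_rat
      by (intro borel_measurable_real_of_ereal borel_measurable_INF) auto
    show "d i (e p) = p i" if "i \<in> I" for p i
    proof -
      have "ternary_remainder (to_nat_on S (i, q)) (e p) \<ge> 1 / 3 \<longleftrightarrow> p i \<le> q" if "q \<in> \<rat>" for q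
        using that \<open>i \<in> I\<close> S unfolding e_def ternary_digit_code b_def
        by (subst from_nat_into_to_nat_on) (auto simp: S_def)
      then show ?thesis
        unfolding d_def using INF_Rats_above[of "p i"] by (simp cong: INF_cong_simp)
    qed
  qed
qed

text \<open>The quantile transform represents \<open>Z\<close> by a uniform variable \<open>u\<close>, and for a continuous distribution
  function the quantile \<open>I u\<close> satisfies \<open>F (I u) = u\<close>.\<close>

lemma uniform_of_atomless:
  fixes Z :: "'a \<Rightarrow> real"
  assumes P: "prob_space P" and Z [measurable]: "Z \<in> borel_measurable P"
    and atomless: "\<And>x. measure (distr P borel Z) {x} = 0"
  defines "F \<equiv> cdf (distr P borel Z)"
  shows "F \<in> borel_measurable borel" and
    "distr P borel (\<lambda>\<omega>. F (Z \<omega>)) = distr (restrict_space lborel {0<..<1}) borel (\<lambda>u. u)"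
proof -
  interpret P: prob_space P by fact
  interpret cdf_distribution "distr P borel Z"
    unfolding cdf_distribution_def real_distribution_def real_distribution_axioms_def
    using P.prob_space_distr[OF Z] by simp
  show F [measurable]: "F \<in> borel_measurable borel"
    unfolding F_def by simp
  have FI: "F (I u) = u" if u: "u \<in> {0<..<1}" for u
  proof (rule antisym)
    show "u \<le> F (I u)"
      using pseudoinverse' u unfolding F_def by blast
    have "F x < u" if "x < I u" for x
      using pseudoinverse'[rule_format, OF u, of x] that unfolding F_def by auto
    then have "\<forall>\<^sub>F x in at_left (I u). F x \<le> u"
      by (auto simp: eventually_at_left_field intro!: exI[of _ "I u - 1"] less_imp_le)
    moreover have "isCont F (I u)"
      unfolding F_def isCont_cdf by (rule atomless)
    then have "(F \<longlongrightarrow> F (I u)) (at_left (I u))"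
      by (simp only: isCont_def filterlim_at_split)
    ultimately show "F (I u) \<le> u"
      by (intro tendsto_upperbound) auto
  qed
  have "distr P borel (\<lambda>\<omega>. F (Z \<omega>)) = distr (distr P borel Z) borel F"
    by (simp add: distr_distr comp_def)
  also have "\<dots> = distr (distr (restrict_space lborel {0<..<1}) borel I) borel F"
    by (simp add: distr_I_eq_M)
  also have "\<dots> = distr (restrict_space lborel {0<..<1}) borel (\<lambda>u. F (I u))"
    by (subst distr_distr) (auto simp: comp_def)
  also have "\<dots> = distr (restrict_space lborel {0<..<1}) borel (\<lambda>u. u)"
    by (rule distr_cong) (auto simp: FI space_restrict_space)
  finally show "distr P borel (\<lambda>\<omega>. F (Z \<omega>)) = distr (restrict_space lborel {0<..<1}) borel (\<lambda>u. u)" .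
qed

text \<open>The code turns \<open>Q\<close> into a law on the real line, which is the law of its quantile function at a uniform
  variable.\<close>

lemma realize_law_on_atomless_space:
  fixes Z :: "'a \<Rightarrow> real" and Q :: "('i \<Rightarrow> real) measure"
  assumes P: "prob_space P" and Z [measurable]: "Z \<in> borel_measurable P"
    and atomless: "\<And>x. measure (distr P borel Z) {x} = 0"
    and I: "countable I" "I \<noteq> {}"
    and Q: "prob_space Q" and sets: "sets Q = sets (PiM I (\<lambda>_. borel))"
  obtains X :: "'i \<Rightarrow> 'a \<Rightarrow> real" where "\<And>i. X i \<in> borel_measurable P"
    "product_law I P X = Q"
proof -
  obtain e :: "('i \<Rightarrow> real) \<Rightarrow> real" and d where e [measurable]: "e \<in> borel_measurable (PiM I (\<lambda>_. borel))"
    and d [measurable]: "\<And>i. d i \<in> borel_measurable borel" and de: "\<And>p i. i \<in> I \<Longrightarrow> d i (e p) = p i"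
    using countable_product_borel_code[OF I] by metis
  have eQ [measurable]: "e \<in> borel_measurable Q"
    unfolding measurable_cong_sets[OF sets refl] by (rule e)
  interpret Q: prob_space Q by fact
  interpret cdf_distribution "distr Q borel e"
    unfolding cdf_distribution_def real_distribution_def real_distribution_axioms_def
    using Q.prob_space_distr[OF eQ] by simp
  define F where "F = cdf (distr P borel Z)"
  note U = uniform_of_atomless[OF P Z atomless, folded F_def]
  have [measurable]: "F \<in> borel_measurable borel" by (rule U)
  have F01: "AE \<omega> in P. F (Z \<omega>) \<in> {0<..<1}"
  proof -
    have "AE u in distr P borel (\<lambda>\<omega>. F (Z \<omega>)). u \<in> {0<..<1}"
      unfolding U(2) by (subst AE_distr_iff) (auto intro!: AE_I2 simp: space_restrict_space measurable_restrict_space1)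
    then show ?thesis by (subst (asm) AE_distr_iff) auto
  qed
  \<comment> \<open>The quantile function is measurable on \<open>{0<..<1}\<close>, where \<open>F (Z \<omega>)\<close> lies almost surely.\<close>
  define I' where "I' u = (if u \<in> {0<..<1} then local.I u else 0)" for u
  have [measurable]: "I' \<in> borel_measurable borel"
  proof -
    have "{u :: real. 0 < u \<and> u < 1} = {0<..<1}" by auto
    then show ?thesis
      using measurable_CI unfolding I'_def[abs_def]
      by (subst measurable_If_restrict_space_iff) auto
  qed
  define X where "X i \<omega> = d i (I' (F (Z \<omega>)))" for i \<omega>
  show ?thesis
  proof
    show X [measurable]: "X i \<in> borel_measurable P" for i
      unfolding X_def[abs_def] by measurable
    define D where "D y = (\<lambda>i\<in>I. d i y)" for y
    have [measurable]: "D \<in> measurable borel (PiM I (\<lambda>_. borel))"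
      unfolding D_def[abs_def] by measurable
    have "distr P borel (\<lambda>\<omega>. I' (F (Z \<omega>))) = distr (distr P borel (\<lambda>\<omega>. F (Z \<omega>))) borel I'"
      by (simp add: distr_distr comp_def)
    also have "\<dots> = distr (restrict_space lborel {0<..<1}) borel I'"
      unfolding U(2) by (subst distr_distr) (auto simp: comp_def measurable_restrict_space1)
    also have "\<dots> = distr (restrict_space lborel {0<..<1}) borel local.I"
      by (rule distr_cong) (auto simp: I'_def space_restrict_space)
    also have "\<dots> = distr Q borel e"
      by (rule distr_I_eq_M)
    finally have I'e: "distr P borel (\<lambda>\<omega>. I' (F (Z \<omega>))) = distr Q borel e" .
    have "product_law I P X = distr (distr P borel (\<lambda>\<omega>. I' (F (Z \<omega>)))) (PiM I (\<lambda>_. borel)) D"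
      by (simp add: distr_distr comp_def X_def D_def)
    also have "\<dots> = distr Q (PiM I (\<lambda>_. borel)) (\<lambda>p. D (e p))"
      unfolding I'e by (simp add: distr_distr comp_def)
    also have "\<dots> = distr Q Q (\<lambda>p. p)"
    proof (rule distr_cong)
      fix p assume "p \<in> space Q"
      then have "p \<in> space (PiM I (\<lambda>_. borel :: real measure))"
        using sets_eq_imp_space_eq[OF sets] by simp
      then show "D (e p) = p"
        by (auto simp: D_def de space_PiM PiE_iff extensional_def fun_eq_iff)
    qed (simp_all add: sets)
    finally show "product_law I P X = Q"
      by simp
  qed
qed

section \<open>Fractional Brownian motion and its two-sided copy\<close>

abbreviation normal_with_sd :: "'a measure \<Rightarrow> real \<Rightarrow> ('a \<Rightarrow> real) \<Rightarrow> bool" where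
  "normal_with_sd P \<sigma> X \<equiv> distributed P lborel X (\<lambda>x. ennreal (normal_density 0 \<sigma> x))"

lemma distr_normal_char:
  assumes P: "prob_space P" and \<sigma>: "0 < \<sigma>" and D: "normal_with_sd P \<sigma> X"
  shows "char (distr P borel X) t = exp (- (t * \<sigma>)\<^sup>2 / 2)"
proof -
  interpret prob_space P by fact
  have X [measurable]: "X \<in> borel_measurable P"
    using distributed_measurable[OF D] by simp
  have S: "distributed P lborel (\<lambda>\<omega>. X \<omega> / \<sigma>) (\<lambda>x. ennreal (std_normal_density x))"
    using D \<sigma> normal_standard_normal_convert[of \<sigma> X 0] by simp
  have "char (distr P borel X) t = char (distr P borel (\<lambda>\<omega>. X \<omega> / \<sigma>)) (t * \<sigma>)"
    using \<sigma> by (simp add: char_distr)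
  also have "distr P borel (\<lambda>\<omega>. X \<omega> / \<sigma>) = std_normal_distribution"
    using distributed_distr_eq_density[OF S] by (simp cong: distr_cong)
  finally show ?thesis
    by (simp add: char_std_normal_distribution)
qed

lemma centered_normal_char:
  assumes P: "prob_space P" and N: "centered_normal P X"
  shows "integrable P (\<lambda>\<omega>. (X \<omega>)\<^sup>2)"
    and "char (distr P borel X) t = exp (- (t\<^sup>2 * (\<integral>\<omega>. (X \<omega>)\<^sup>2 \<partial>P)) / 2)"
proof -
  interpret prob_space P by fact
  have X [measurable]: "X \<in> borel_measurable P"
    using N by (simp add: centered_normal_def)
  consider (zero) "AE \<omega> in P. X \<omega> = 0"
    | (normal) \<sigma> where "\<sigma> > 0" "normal_with_sd P \<sigma> X"
    using N by (auto simp: centered_normal_def)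
  then have "integrable P (\<lambda>\<omega>. (X \<omega>)\<^sup>2) \<and> char (distr P borel X) t = exp (- (t\<^sup>2 * (\<integral>\<omega>. (X \<omega>)\<^sup>2 \<partial>P)) / 2)"
  proof cases
    case zero
    then have AE: "AE \<omega> in P. (X \<omega>)\<^sup>2 = 0" "AE \<omega> in P. iexp (t * X \<omega>) = 1"
      by auto
    have "integrable P (\<lambda>\<omega>. (X \<omega>)\<^sup>2)"
      by (subst integrable_cong_AE[OF _ _ AE(1)]) auto
    moreover have "(\<integral>\<omega>. (X \<omega>)\<^sup>2 \<partial>P) = 0"
      using AE(1) by (rule integral_eq_zero_AE)
    moreover have "(CLINT \<omega>|P. iexp (t * X \<omega>)) = (CLINT \<omega>|P. 1)"
      by (rule integral_cong_AE) (use AE(2) in auto)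
    ultimately show ?thesis
      by (simp add: char_distr prob_space)
  next
    case normal
    note D = normal(2)
    have i: "integrable lborel (\<lambda>x. normal_density 0 \<sigma> x * x\<^sup>2)"
      using integrable_normal_moment[OF normal(1), of 0 2] by simp
    have "integrable P (\<lambda>\<omega>. (X \<omega>)\<^sup>2)"
      using distributed_integrable[OF D, of "\<lambda>x. x\<^sup>2"] i by simp
    moreover have "(\<integral>\<omega>. (X \<omega>)\<^sup>2 \<partial>P) = \<sigma>\<^sup>2"
    proof -
      have "(\<integral>\<omega>. (X \<omega>)\<^sup>2 \<partial>P) = (\<integral>x. normal_density 0 \<sigma> x * x\<^sup>2 \<partial>lborel)"
        using distributed_integral[OF D, of "\<lambda>x. x\<^sup>2"] by simp
      then show ?thesis
        using integral_normal_moment_even[OF normal(1), of 0 1] by simp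
    qed
    ultimately show ?thesis
      by (simp add: distr_normal_char[OF P normal(1) D] power_mult_distrib)
  qed
  then show "integrable P (\<lambda>\<omega>. (X \<omega>)\<^sup>2)"
    and "char (distr P borel X) t = exp (- (t\<^sup>2 * (\<integral>\<omega>. (X \<omega>)\<^sup>2 \<partial>P)) / 2)" by auto
qed

text \<open>The covariance of a two-sided fractional Brownian motion with variance \<open>v\<close> at time \<open>1\<close>.\<close>

definition fbm_cov :: "real \<Rightarrow> real \<Rightarrow> real \<Rightarrow> real \<Rightarrow> real" where
  "fbm_cov v H s t = v / 2 * (\<bar>s\<bar> powr (2 * H) + \<bar>t\<bar> powr (2 * H) - \<bar>s - t\<bar> powr (2 * H))"

text \<open>The property is expressed through characteristic functions of linear combinations, because this is the form
  in which laws are compared and in which it passes to increments by pure algebra.\<close>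

definition fbm_on :: "'a measure \<Rightarrow> real \<Rightarrow> real \<Rightarrow> real set \<Rightarrow> (real \<Rightarrow> 'a \<Rightarrow> real) \<Rightarrow> bool" where
  "fbm_on P v H I X \<longleftrightarrow> (\<forall>t\<in>I. X t \<in> borel_measurable P) \<and>
     (\<forall>J c. finite J \<longrightarrow> J \<subseteq> I \<longrightarrow>
        combination_char P X J c =
          complex_of_real (exp (- (\<Sum>s\<in>J. \<Sum>t\<in>J. c s * c t * fbm_cov v H s t) / 2)))"

lemma fbm_on_subset: "fbm_on P v H I X \<Longrightarrow> J \<subseteq> I \<Longrightarrow> fbm_on P v H J X"
  unfolding fbm_on_def by (meson subset_iff order_trans)

lemma fbm_on_distr_eq:
  assumes "prob_space P" "prob_space Q" "fbm_on P v H I X" "fbm_on Q v H I Y"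
  shows "product_law I P X = product_law I Q Y"
  using assms by (intro distr_PiM_eqI_char) (auto simp: fbm_on_def)

lemma increment_sum_reindex:
  fixes \<phi> c :: "real \<Rightarrow> real"
  assumes "finite J"
  shows "(\<Sum>u\<in>insert a ((\<lambda>t. t + a) ` J). ((if u - a \<in> J then c (u - a) else 0) - (if u = a then \<Sum>t\<in>J. c t else 0)) * \<phi> u)
    = (\<Sum>t\<in>J. c t * (\<phi> (t + a) - \<phi> a))"
proof -
  let ?T = "insert a ((\<lambda>t. t + a) ` J)"
  have fin: "finite ?T" using assms by simp
  have img: "u \<in> (\<lambda>t. t + a) ` J \<longleftrightarrow> u - a \<in> J" for u
    by (auto intro: image_eqI[of _ _ "u - a"])
  have "(\<Sum>u\<in>?T. (if u - a \<in> J then c (u - a) else 0) * \<phi> u) = (\<Sum>u\<in>(\<lambda>t. t + a) ` J. c (u - a) * \<phi> u)"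
    by (rule sum.mono_neutral_cong_right) (use assms in \<open>auto simp: img\<close>)
  also have "\<dots> = (\<Sum>t\<in>J. c t * \<phi> (t + a))"
    by (subst sum.reindex) (auto simp: inj_on_def)
  finally have 1: "(\<Sum>u\<in>?T. (if u - a \<in> J then c (u - a) else 0) * \<phi> u) = (\<Sum>t\<in>J. c t * \<phi> (t + a))" .
  have "(\<Sum>u\<in>?T. (if u = a then \<Sum>t\<in>J. c t else 0) * \<phi> u) = (\<Sum>u\<in>?T. if a = u then (\<Sum>t\<in>J. c t) * \<phi> u else 0)"
    by (rule sum.cong) auto
  also have "\<dots> = (\<Sum>t\<in>J. c t) * \<phi> a"
    using fin by (simp del: sum.insert)
  finally show ?thesis
    using 1 by (simp add: left_diff_distrib right_diff_distrib sum_subtractf sum_distrib_right del: sum.insert)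
qed

text \<open>Stationarity of the increments. A linear combination of increments is a linear combination of the
  values of \<open>X\<close>, and the covariance form is invariant under this substitution.\<close>

lemma fbm_on_increments:
  assumes X: "fbm_on P v H I X" and a: "a \<in> I" and K: "\<And>t. t \<in> K \<Longrightarrow> t + a \<in> I"
  shows "fbm_on P v H K (\<lambda>t \<omega>. X (t + a) \<omega> - X a \<omega>)"
  unfolding fbm_on_def
proof (intro conjI ballI allI impI)
  show "(\<lambda>\<omega>. X (t + a) \<omega> - X a \<omega>) \<in> borel_measurable P" if "t \<in> K" for t
    using X[unfolded fbm_on_def, THEN conjunct1] a K[OF that] by (intro borel_measurable_diff) blast+
  fix J :: "real set" and c :: "real \<Rightarrow> real" assume J: "finite J" "J \<subseteq> K"
  define T where "T = insert a ((\<lambda>t. t + a) ` J)"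
  define c' where "c' u = (if u - a \<in> J then c (u - a) else 0) - (if u = a then \<Sum>t\<in>J. c t else 0)" for u
  have T: "finite T" "T \<subseteq> I"
    using J K a by (auto simp: T_def)
  have reindex: "(\<Sum>u\<in>T. c' u * \<phi> u) = (\<Sum>t\<in>J. c t * (\<phi> (t + a) - \<phi> a))" for \<phi> :: "real \<Rightarrow> real"
    unfolding T_def c'_def by (rule increment_sum_reindex[OF J(1)])
  have cov: "(fbm_cov v H (s + a) (t + a) - fbm_cov v H (s + a) a) - (fbm_cov v H a (t + a) - fbm_cov v H a a) =
      fbm_cov v H s t" for s t
    by (simp add: fbm_cov_def right_diff_distrib distrib_left)
  \<comment> \<open>The reindexing is applied in each of the two arguments of the covariance form.\<close>
  have "(\<Sum>s\<in>T. \<Sum>t\<in>T. c' s * c' t * fbm_cov v H s t) = (\<Sum>s\<in>T. c' s * (\<Sum>t\<in>T. c' t * fbm_cov v H s t))"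
    by (simp add: sum_distrib_left mult.assoc)
  also have "\<dots> = (\<Sum>s\<in>J. \<Sum>t\<in>J. c s * c t *
      ((fbm_cov v H (s + a) (t + a) - fbm_cov v H (s + a) a) - (fbm_cov v H a (t + a) - fbm_cov v H a a)))"
    unfolding reindex
    by (simp add: sum_subtractf sum_distrib_left right_diff_distrib mult.assoc)
  also have "\<dots> = (\<Sum>s\<in>J. \<Sum>t\<in>J. c s * c t * fbm_cov v H s t)"
    by (simp only: cov)
  finally have form: "(\<Sum>s\<in>T. \<Sum>t\<in>T. c' s * c' t * fbm_cov v H s t) = (\<Sum>s\<in>J. \<Sum>t\<in>J. c s * c t * fbm_cov v H s t)" .
  have "(\<Sum>t\<in>J. c t * (X (t + a) \<omega> - X a \<omega>)) = (\<Sum>u\<in>T. c' u * X u \<omega>)" for \<omega>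
    using reindex[of "\<lambda>u. X u \<omega>"] by simp
  moreover have "char (distr P borel (\<lambda>\<omega>. \<Sum>u\<in>T. c' u * X u \<omega>)) 1 =
      complex_of_real (exp (- (\<Sum>s\<in>T. \<Sum>t\<in>T. c' s * c' t * fbm_cov v H s t) / 2))"
    by (rule X[unfolded fbm_on_def, THEN conjunct2, rule_format, OF T])
  ultimately show "char (distr P borel (\<lambda>\<omega>. \<Sum>t\<in>J. c t * (X (t + a) \<omega> - X a \<omega>))) 1 =
      complex_of_real (exp (- (\<Sum>s\<in>J. \<Sum>t\<in>J. c s * c t * fbm_cov v H s t) / 2))"
    by (simp only: form)
qed

lemma fbm_on_normal:
  assumes P: "prob_space P" and X: "fbm_on P v H I X" and t: "t \<in> I" "t \<noteq> 0" and v: "0 < v"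
  shows "normal_with_sd P (sqrt v * \<bar>t\<bar> powr H) (X t)"
proof -
  interpret prob_space P by fact
  define \<sigma> where "\<sigma> = sqrt v * \<bar>t\<bar> powr H"
  have \<sigma>: "0 < \<sigma>" using t v by (simp add: \<sigma>_def)
  have \<sigma>2: "\<sigma>\<^sup>2 = fbm_cov v H t t"
  proof -
    have "(\<bar>t\<bar> powr H)\<^sup>2 = \<bar>t\<bar> powr (2 * H)"
      unfolding power2_eq_square mult_2 by (rule powr_add[symmetric])
    then show ?thesis
      using v by (simp add: \<sigma>_def fbm_cov_def power_mult_distrib)
  qed
  have [measurable]: "X t \<in> borel_measurable P"
    using X[unfolded fbm_on_def, THEN conjunct1] t by blast
  define N where "N = density lborel (\<lambda>x. ennreal (normal_density 0 \<sigma> x))"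
  have pN: "prob_space N"
    unfolding N_def by (rule prob_space_normal_density[OF \<sigma>])
  have dN: "normal_with_sd N \<sigma> (\<lambda>x. x)"
    by (auto simp: distributed_def N_def distr_id2)
  have rd: "real_distribution (distr P borel (X t))" "real_distribution N"
    using pN by (auto simp: real_distribution_def real_distribution_axioms_def N_def intro!: prob_space_distr)
  have "char (distr P borel (X t)) = char N"
  proof
    fix \<theta>
    have "char (distr P borel (\<lambda>\<omega>. \<Sum>s\<in>{t}. \<theta> * X s \<omega>)) 1 =
        complex_of_real (exp (- (\<Sum>s\<in>{t}. \<Sum>u\<in>{t}. \<theta> * \<theta> * fbm_cov v H s u) / 2))"
      using X[unfolded fbm_on_def, THEN conjunct2, rule_format, of "{t}" "\<lambda>_. \<theta>"] t by simp
    then have "char (distr P borel (X t)) \<theta> = exp (- (\<theta> * \<sigma>)\<^sup>2 / 2)"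
      by (simp add: char_distr power_mult_distrib \<sigma>2) (simp add: power2_eq_square)
    also have "\<dots> = char (distr N borel (\<lambda>x. x)) \<theta>"
      by (rule distr_normal_char[OF pN \<sigma> dN, symmetric])
    also have "distr N borel (\<lambda>x. x) = N"
      by (rule distr_id2) (simp add: N_def)
    finally show "char (distr P borel (X t)) \<theta> = char N \<theta>" .
  qed
  from Levy_uniqueness[OF rd this] have "distr P lborel (X t) = N"
    by (simp cong: distr_cong)
  then show ?thesis
    unfolding \<sigma>_def[symmetric] by (auto simp: distributed_def N_def)
qed

context fractional_brownian_motion
begin

lemma measurable_B: "0 \<le> t \<Longrightarrow> B t \<in> borel_measurable P"
  using gaussian[of "{t}" "\<lambda>_. 1"] by (simp add: centered_normal_def)

definition unit_var where "unit_var = (\<integral>\<omega>. (B 1 \<omega>)\<^sup>2 \<partial>P)"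

lemma unit_var_pos: "0 < unit_var"
  using variance_pos by (simp add: unit_var_def)

lemma fbm_on_nonneg_times: "fbm_on P unit_var H {0..} B"
  unfolding fbm_on_def
proof (intro conjI ballI allI impI)
  show "B t \<in> borel_measurable P" if "t \<in> {0..}" for t
    using measurable_B that by simp
  fix J :: "real set" and c :: "real \<Rightarrow> real" assume J: "finite J" "J \<subseteq> {0..}"
  have [measurable]: "t \<in> J \<Longrightarrow> B t \<in> borel_measurable P" for t
    using measurable_B J by auto
  have sq: "integrable P (\<lambda>\<omega>. (B t \<omega>)\<^sup>2)" if "t \<in> J" for t
    using centered_normal_char(1)[OF prob_space_axioms gaussian[of "{t}" "\<lambda>_. 1"]] that J by auto
  have prod: "integrable P (\<lambda>\<omega>. B s \<omega> * B t \<omega>)" if "s \<in> J" "t \<in> J" for s t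
  proof (rule Bochner_Integration.integrable_bound)
    show "integrable P (\<lambda>\<omega>. (B s \<omega>)\<^sup>2 + (B t \<omega>)\<^sup>2)"
      using sq that by auto
    show "AE \<omega> in P. norm (B s \<omega> * B t \<omega>) \<le> norm ((B s \<omega>)\<^sup>2 + (B t \<omega>)\<^sup>2)"
    proof (rule AE_I2)
      fix \<omega>
      have "2 * (\<bar>B s \<omega>\<bar> * \<bar>B t \<omega>\<bar>) \<le> (B s \<omega>)\<^sup>2 + (B t \<omega>)\<^sup>2"
        using sum_squares_bound[of "\<bar>B s \<omega>\<bar>" "\<bar>B t \<omega>\<bar>"] by (simp add: mult.assoc)
      then show "norm (B s \<omega> * B t \<omega>) \<le> norm ((B s \<omega>)\<^sup>2 + (B t \<omega>)\<^sup>2)"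
        using mult_nonneg_nonneg[OF abs_ge_zero[of "B s \<omega>"] abs_ge_zero[of "B t \<omega>"]]
        unfolding real_norm_def abs_mult by linarith
    qed
  qed (use that in measurable)
  have "(\<integral>\<omega>. (\<Sum>t\<in>J. c t * B t \<omega>)\<^sup>2 \<partial>P) = (\<integral>\<omega>. (\<Sum>s\<in>J. \<Sum>t\<in>J. (c s * c t) * (B s \<omega> * B t \<omega>)) \<partial>P)"
    by (simp add: power2_eq_square sum_product ac_simps)
  also have "\<dots> = (\<Sum>s\<in>J. \<Sum>t\<in>J. (c s * c t) * (\<integral>\<omega>. B s \<omega> * B t \<omega> \<partial>P))"
    using prod by (simp add: Bochner_Integration.integral_sum Bochner_Integration.integrable_sum)
  also have "\<dots> = (\<Sum>s\<in>J. \<Sum>t\<in>J. c s * c t * fbm_cov unit_var H s t)"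
  proof (intro sum.cong refl arg_cong2[of _ _ _ _ "(*)"])
    fix s t assume "s \<in> J" "t \<in> J"
    then have "0 \<le> s" "0 \<le> t" using J by auto
    then show "(\<integral>\<omega>. B s \<omega> * B t \<omega> \<partial>P) = fbm_cov unit_var H s t"
      by (simp add: covariance fbm_cov_def unit_var_def abs_minus_commute)
  qed
  finally show "combination_char P B J c =
      complex_of_real (exp (- (\<Sum>s\<in>J. \<Sum>t\<in>J. c s * c t * fbm_cov unit_var H s t) / 2))"
    using centered_normal_char(2)[OF prob_space_axioms gaussian[OF J], of c 1] by simp
qed

text \<open>The law of \<open>X\<close> at times \<open>J\<close> is that of the increments of \<open>B\<close> after any time \<open>a\<close> with \<open>- a \<le> t\<close> for
  \<open>t \<in> J\<close>. Stationarity makes these laws independent of \<open>a\<close>, hence projective. Rational times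
  keep the index set countable, as is needed to realize the limit law on the given probability space.\<close>

lemma two_sided_copy:
  obtains X where "\<And>t. X t \<in> borel_measurable P" "fbm_on P unit_var H \<rat> X"
proof -
  \<comment> \<open>A starting time that moves all of \<open>J\<close> to nonnegative times.\<close>
  define a where "a J = (\<Sum>t\<in>J. \<bar>t\<bar>)" for J :: "real set"
  have a0: "0 \<le> a J" for J by (simp add: a_def sum_nonneg)
  have ta: "0 \<le> t + a J" if "t \<in> J" "finite J" for t J
    using member_le_sum[of t J abs] that by (auto simp: a_def)
  have inc: "fbm_on P unit_var H J (\<lambda>t \<omega>. B (t + a K) \<omega> - B (a K) \<omega>)" if "J \<subseteq> K" "finite K" for J K
    using a0 ta[OF _ that(2)] that(1) by (intro fbm_on_increments[OF fbm_on_nonneg_times]) auto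
  define R where "R J = distr P (PiM J (\<lambda>_. borel)) (\<lambda>\<omega>. \<lambda>t\<in>J. B (t + a J) \<omega> - B (a J) \<omega>)" for J
  have meas: "(\<lambda>\<omega>. \<lambda>t\<in>J. B (t + a J) \<omega> - B (a J) \<omega>) \<in> measurable P (PiM J (\<lambda>_. borel))" if "finite J" for J
    using inc[OF order_refl that] by (intro measurable_restrict) (simp add: fbm_on_def)
  have "projective_family (\<rat> :: real set) R (\<lambda>_. borel)"
  proof (rule projective_family.intro)
    show "prob_space (R J)" if "finite J" for J
      unfolding R_def by (rule prob_space_distr[OF meas[OF that]])
    show "R J = distr (R K) (PiM J (\<lambda>_. borel)) (\<lambda>f. restrict f J)" if "J \<subseteq> K" "finite K" for J K
    proof -
      have "distr (R K) (PiM J (\<lambda>_. borel)) (\<lambda>f. restrict f J) =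
          distr P (PiM J (\<lambda>_. borel)) (\<lambda>\<omega>. \<lambda>t\<in>J. B (t + a K) \<omega> - B (a K) \<omega>)"
        unfolding R_def using that
        by (subst distr_distr[OF measurable_restrict_subset[OF that(1)] meas[OF that(2)]])
           (auto simp: comp_def fun_eq_iff restrict_def intro!: arg_cong[where f = "distr P (PiM J (\<lambda>_. borel))"])
      also have "\<dots> = R J"
        unfolding R_def using finite_subset[OF that]
        by (intro fbm_on_distr_eq[OF prob_space_axioms prob_space_axioms inc[OF that] inc[OF order_refl]])
      finally show ?thesis ..
    qed
  qed
  then interpret K: polish_projective "\<rat> :: real set" R
    by (rule polish_projective.intro)
  have atomless: "measure (distr P borel (B 1)) {x} = 0" for x
  proof -
    have "normal_with_sd P (sqrt unit_var * \<bar>1\<bar> powr H) (B 1)"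
      by (rule fbm_on_normal[OF prob_space_axioms fbm_on_nonneg_times]) (use unit_var_pos in auto)
    from distributed_distr_eq_density[OF this]
    have "distr P borel (B 1) = density lborel (\<lambda>x. ennreal (normal_density 0 (sqrt unit_var * \<bar>1\<bar> powr H) x))"
      by (simp cong: distr_cong)
    then show ?thesis
      by (simp add: measure_def emeasure_density nn_integral_null_delta nn_integral_null_set null_sets_def)
  qed
  have sets: "sets K.lim = sets (PiM \<rat> (\<lambda>_. borel :: real measure))"
    by simp
  obtain X where X [measurable]: "\<And>t. X t \<in> borel_measurable P"
    and lim: "product_law \<rat> P X = K.lim"
    using realize_law_on_atomless_space[OF prob_space_axioms measurable_B atomless countable_rat _ K.P.prob_space_axioms sets]
    by (metis Rats_0 empty_iff zero_le_one)
  have "fbm_on P unit_var H \<rat> X"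
    unfolding fbm_on_def
  proof (intro conjI ballI allI impI X)
    fix J :: "real set" and c :: "real \<Rightarrow> real" assume J: "finite J" "J \<subseteq> \<rat>"
    have "product_law J P X = distr K.lim (PiM J (\<lambda>_. borel)) (\<lambda>f. restrict f J)"
      unfolding lim[symmetric] using J
      by (subst distr_distr[OF measurable_restrict_subset[OF J(2)] measurable_restrict[OF X]])
         (auto simp: comp_def fun_eq_iff restrict_def intro!: arg_cong[where f = "distr P (PiM J (\<lambda>_. borel))"])
    also have "\<dots> = R J"
    proof (rule measure_eqI)
      fix A assume "A \<in> sets (distr K.lim (PiM J (\<lambda>_. borel)) (\<lambda>f. restrict f J))"
      then have A: "A \<in> sets (PiM J (\<lambda>_. borel))" by simp
      have "emeasure (distr K.lim (PiM J (\<lambda>_. borel)) (\<lambda>f. restrict f J)) A = emeasure K.lim (K.emb \<rat> J A)"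
        using A measurable_restrict_subset[OF J(2), of "\<lambda>_. borel :: real measure"]
        by (subst emeasure_distr) (simp_all add: prod_emb_def space_PiM measurable_cong_sets[OF sets refl])
      then show "emeasure (distr K.lim (PiM J (\<lambda>_. borel)) (\<lambda>f. restrict f J)) A = emeasure (R J) A"
        by (simp add: K.emeasure_lim_emb[OF J(2,1) A])
    qed (simp add: R_def)
    finally have "distr (product_law J P X) borel (\<lambda>p. \<Sum>t\<in>J. c t * p t) =
        distr (R J) borel (\<lambda>p. \<Sum>t\<in>J. c t * p t)" by simp
    then have "distr P borel (\<lambda>\<omega>. \<Sum>t\<in>J. c t * X t \<omega>) = distr P borel (\<lambda>\<omega>. \<Sum>t\<in>J. c t * (B (t + a J) \<omega> - B (a J) \<omega>))"
      unfolding R_def using meas[OF J(1)]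
      by (subst (asm) (1 2) distr_distr) (auto simp: comp_def cong: sum.cong_simp)
    then show "combination_char P X J c =
        complex_of_real (exp (- (\<Sum>s\<in>J. \<Sum>t\<in>J. c s * c t * fbm_cov unit_var H s t) / 2))"
      using inc[OF order_refl J(1)] J by (simp add: fbm_on_def)
  qed
  with X that show ?thesis by blast
qed

end

section \<open>Local time as a functional of the path\<close>

text \<open>Approximate identities at \<open>0\<close> with integral \<open>1\<close> and support of radius \<open>1 / Suc k\<close>; continuity in \<open>y\<close>
  lets them be evaluated along the discretized path.\<close>

definition tent :: "nat \<Rightarrow> real \<Rightarrow> real" where
  "tent k y = real (Suc k) * max 0 (1 - real (Suc k) * \<bar>y\<bar>)"

lemma tent_nonneg: "0 \<le> tent k y"
  by (simp add: tent_def)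

lemma tent_le: "tent k y \<le> real (Suc k)"
proof -
  have "max 0 (1 - real (Suc k) * \<bar>y\<bar>) \<le> 1" by simp
  from mult_left_mono[OF this, of "real (Suc k)"] show ?thesis by (simp add: tent_def)
qed

lemma tent_minus: "tent k (- y) = tent k y"
  by (simp add: tent_def)

lemma tent_eq_0: "1 / real (Suc k) \<le> \<bar>y\<bar> \<Longrightarrow> tent k y = 0"
  by (simp add: tent_def field_simps)

lemma isCont_tent: "isCont (tent k) y"
  unfolding tent_def by (intro continuous_intros)

lemma continuous_on_tent: "continuous_on A f \<Longrightarrow> continuous_on A (\<lambda>x. tent k (f x))"
  unfolding tent_def by (intro continuous_intros)

lemma measurable_tent [measurable]: "tent k \<in> borel_measurable borel"
  unfolding tent_def[abs_def] by measurable

lemma nn_integral_tent: "(\<integral>\<^sup>+y. ennreal (tent k (y - x)) \<partial>lborel) = 1"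
proof -
  define K where "K = real (Suc k)"
  have K: "0 < K" by (simp add: K_def)
  have tent: "tent k y = K * max 0 (1 - K * \<bar>y\<bar>)" for y by (simp only: tent_def K_def)
  have half: "((\<lambda>y. K * (1 - K * y)) has_integral 1 / 2) {0..1 / K}"
  proof -
    have "((\<lambda>y. K * (1 - K * y)) has_integral (K * (1 / K) - K\<^sup>2 * (1 / K)\<^sup>2 / 2) - (K * 0 - K\<^sup>2 * 0\<^sup>2 / 2)) {0..1 / K}"
      using K by (intro fundamental_theorem_of_calculus)
        (auto intro!: derivative_eq_intros simp: has_real_derivative_iff_has_vector_derivative[symmetric] power2_eq_square algebra_simps)
    then show ?thesis using K by (simp add: power2_eq_square)
  qed
  have pos: "(\<integral>\<^sup>+y. ennreal (tent k y) * indicator {0..} y \<partial>lborel) = ennreal (1 / 2)"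
  proof -
    have "(\<integral>\<^sup>+y. ennreal (tent k y) * indicator {0..} y \<partial>lborel) =
        (\<integral>\<^sup>+y. ennreal (K * (1 - K * y) * indicator {0..1 / K} y) \<partial>lborel)"
      using K by (intro nn_integral_cong) (auto simp: tent indicator_def field_simps max_def)
    also have "\<dots> = ennreal (1 / 2)"
    proof (rule nn_integral_has_integral_lborel)
      have "(\<lambda>y. K * (1 - K * y) * indicator {0..1 / K} y) = (\<lambda>y. if y \<in> {0..1 / K} then K * (1 - K * y) else 0)"
        by auto
      then show "((\<lambda>y. K * (1 - K * y) * indicator {0..1 / K} y) has_integral 1 / 2) UNIV"
        using half by (simp only: has_integral_restrict_UNIV)
    qed (use K in \<open>auto simp: indicator_def field_simps\<close>)
    finally show ?thesis .
  qed
  have neg: "(\<integral>\<^sup>+y. ennreal (tent k y) * indicator {..<0} y \<partial>lborel) = ennreal (1 / 2)"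
  proof -
    have "(\<integral>\<^sup>+y. ennreal (tent k y) * indicator {..<0} y \<partial>lborel) =
        (\<integral>\<^sup>+y. ennreal (tent k y) * indicator {0<..} y \<partial>lborel)"
      using nn_integral_real_affine[of "\<lambda>y. ennreal (tent k y) * indicator {..<0} y" "-1" 0]
      by (simp add: tent_minus indicator_def)
    also have "\<dots> = (\<integral>\<^sup>+y. ennreal (tent k y) * indicator {0..} y \<partial>lborel)"
      using AE_lborel_singleton[of 0] by (intro nn_integral_cong_AE) (auto elim!: eventually_mono simp: indicator_def)
    finally show ?thesis using pos by simp
  qed
  have "(\<integral>\<^sup>+y. ennreal (tent k (y - x)) \<partial>lborel) = (\<integral>\<^sup>+y. ennreal (tent k y) \<partial>lborel)"
    using nn_integral_real_affine[of "\<lambda>y. ennreal (tent k (y - x))" 1 x] by simp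
  also have "\<dots> = (\<integral>\<^sup>+y. ennreal (tent k y) * indicator {0..} y + ennreal (tent k y) * indicator {..<0} y \<partial>lborel)"
    by (intro nn_integral_cong) (auto simp: indicator_def)
  also have "\<dots> = ennreal (1 / 2) + ennreal (1 / 2)"
    by (subst nn_integral_add) (auto simp: pos neg)
  also have "\<dots> = ennreal (1 / 2 + 1 / 2)"
    by (rule ennreal_plus[symmetric]) auto
  also have "\<dots> = 1" by simp
  finally show ?thesis .
qed

lemma tent_approximate_identity:
  fixes f :: "real \<Rightarrow> real"
  assumes [measurable]: "f \<in> borel_measurable borel" and f: "\<And>y. 0 \<le> f y" and cont: "isCont f x"
  shows "(\<lambda>k. enn2real (\<integral>\<^sup>+y. ennreal (tent k (y - x)) * ennreal (f y) \<partial>lborel)) \<longlonglongrightarrow> f x"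
proof (rule LIMSEQ_I)
  fix e :: real assume e: "0 < e"
  then obtain d where d: "0 < d" "\<And>y. \<bar>y - x\<bar> < d \<Longrightarrow> \<bar>f y - f x\<bar> < e / 2"
    using cont[unfolded isCont_def, THEN LIM_D, of "e / 2"] by (force simp: abs_minus_commute)
  obtain N where N: "1 / real (Suc N) < d"
    using nat_approx_posE[OF d(1)] by auto
  show "\<exists>no. \<forall>k\<ge>no. norm (enn2real (\<integral>\<^sup>+y. ennreal (tent k (y - x)) * ennreal (f y) \<partial>lborel) - f x) < e"
  proof (intro exI allI impI)
    fix k assume "N \<le> k"
    then have "1 / real (Suc k) \<le> 1 / real (Suc N)" by (simp add: frac_le)
    with N have k: "tent k (y - x) \<noteq> 0 \<Longrightarrow> \<bar>f y - f x\<bar> < e / 2" for y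
      using tent_eq_0[of k "y - x"] d(2)[of y] by force
    have k1: "f y \<le> f x + e / 2" and k2: "f x - e / 2 \<le> f y" if "tent k (y - x) \<noteq> 0" for y
      using k[OF that] by linarith+
    let ?I = "\<integral>\<^sup>+y. ennreal (tent k (y - x)) * ennreal (f y) \<partial>lborel"
    have const: "(\<integral>\<^sup>+y. ennreal (tent k (y - x)) * ennreal c \<partial>lborel) = ennreal c" for c
      by (simp add: nn_integral_multc nn_integral_tent)
    have "?I \<le> (\<integral>\<^sup>+y. ennreal (tent k (y - x)) * ennreal (f x + e / 2) \<partial>lborel)"
    proof (rule nn_integral_mono)
      fix y
      show "ennreal (tent k (y - x)) * ennreal (f y) \<le> ennreal (tent k (y - x)) * ennreal (f x + e / 2)"
        using k1[of y] by (cases "tent k (y - x) = 0") (auto intro!: mult_left_mono ennreal_leI)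
    qed
    then have up: "?I \<le> ennreal (f x + e / 2)" by (simp only: const)
    have "(\<integral>\<^sup>+y. ennreal (tent k (y - x)) * ennreal (f x - e / 2) \<partial>lborel) \<le> ?I"
    proof (rule nn_integral_mono)
      fix y
      show "ennreal (tent k (y - x)) * ennreal (f x - e / 2) \<le> ennreal (tent k (y - x)) * ennreal (f y)"
        using k2[of y] by (cases "tent k (y - x) = 0") (auto intro!: mult_left_mono ennreal_leI)
    qed
    then have lo: "ennreal (f x - e / 2) \<le> ?I" by (simp only: const)
    have fin: "?I < \<top>" using up by (rule le_less_trans) simp
    have "enn2real ?I \<le> f x + e / 2"
      using enn2real_mono[OF up] f[of x] e by (simp del: ennreal_plus)
    moreover have "f x - e / 2 \<le> enn2real ?I"
    proof (cases "0 \<le> f x - e / 2")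
      case True
      then show ?thesis using enn2real_mono[OF lo fin] by simp
    next
      case False
      then show ?thesis using enn2real_nonneg[of ?I] by linarith
    qed
    ultimately show "norm (enn2real ?I - f x) < e" using e by (simp add: abs_le_iff abs_less_iff)
  qed
qed

text \<open>The last point of the grid of width \<open>1 / j\<close> that does not exceed the time \<open>s \<ge> 0\<close>.\<close>

definition grid :: "nat \<Rightarrow> real \<Rightarrow> real" where
  "grid j s = real (nat \<lfloor>real j * s\<rfloor>) / real j"

lemma grid_nonneg: "0 \<le> grid j s"
  by (simp add: grid_def)

lemma grid_Rats: "grid j s \<in> \<rat>"
  by (simp add: grid_def)

lemma grid_tendsto:
  assumes "0 \<le> s"
  shows "(\<lambda>j. grid j s) \<longlonglongrightarrow> s"
proof (rule real_tendsto_sandwich)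
  show "\<forall>\<^sub>F j in sequentially. s - 1 / real j \<le> grid j s"
  proof (rule eventually_sequentiallyI[of 1])
    fix j :: nat assume j: "1 \<le> j"
    have "real j * s - 1 \<le> real (nat \<lfloor>real j * s\<rfloor>)"
      using assms by (simp add: of_nat_nat)
    from divide_right_mono[OF this, of "real j"] show "s - 1 / real j \<le> grid j s"
      using j by (simp add: grid_def diff_divide_distrib)
  qed
  show "\<forall>\<^sub>F j in sequentially. grid j s \<le> s"
  proof (rule eventually_sequentiallyI[of 1])
    fix j :: nat assume j: "1 \<le> j"
    have "real (nat \<lfloor>real j * s\<rfloor>) \<le> real j * s"
      using assms by (simp add: of_nat_nat)
    then show "grid j s \<le> s"
      using j by (simp add: grid_def field_simps)
  qed
  show "(\<lambda>j. s - 1 / real j) \<longlonglongrightarrow> s"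
    using tendsto_diff[OF tendsto_const lim_1_over_n, of s] by simp
qed simp

lemma measurable_grid_process:
  assumes X: "\<And>q. q \<in> \<rat> \<Longrightarrow> 0 \<le> q \<Longrightarrow> X q \<in> borel_measurable M"
  shows "(\<lambda>(\<omega>, s). X (grid j s) \<omega>) \<in> borel_measurable (M \<Otimes>\<^sub>M lborel)"
proof -
  have [measurable]: "X (real i / real j) \<in> borel_measurable M" for i
    by (rule X) auto
  have "(\<lambda>z. (\<lambda>i z. X (real i / real j) (fst z)) (nat \<lfloor>real j * snd z\<rfloor>) z) \<in> borel_measurable (M \<Otimes>\<^sub>M lborel)"
    by (rule measurable_compose_countable) measurable
  then show ?thesis by (simp add: grid_def case_prod_beta)
qed

text \<open>The density at \<open>0\<close> of the occupation measure of \<open>w\<close> during \<open>[0, 1]\<close>. Only the values of \<open>w\<close> at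
  nonnegative rational times enter, so that the functional is measurable for the product
  \<open>\<sigma>\<close>-algebra and its law is determined by the law of the path at these times.\<close>

definition path_local_time :: "(real \<Rightarrow> real) \<Rightarrow> real" where
  "path_local_time w = lim (\<lambda>k. lim (\<lambda>j. \<integral>s. indicator {0..1} s * tent k (w (grid j s)) \<partial>lborel))"

lemma path_local_time_cong:
  assumes "\<And>q. q \<in> \<rat> \<Longrightarrow> 0 \<le> q \<Longrightarrow> w q = w' q"
  shows "path_local_time w = path_local_time w'"
  using assms by (simp add: path_local_time_def grid_Rats grid_nonneg)

lemma measurable_path_local_time:
  assumes X: "\<And>q. q \<in> \<rat> \<Longrightarrow> 0 \<le> q \<Longrightarrow> X q \<in> borel_measurable M"
  shows "(\<lambda>\<omega>. path_local_time (\<lambda>t. X t \<omega>)) \<in> borel_measurable M"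
proof -
  have [measurable]: "(\<lambda>(\<omega>, s). X (grid j s) \<omega>) \<in> borel_measurable (M \<Otimes>\<^sub>M lborel)" for j
    by (rule measurable_grid_process) (rule X)
  show ?thesis
    unfolding path_local_time_def
    by (intro borel_measurable_lim_metric lborel.borel_measurable_lebesgue_integral) measurable
qed

locale fbm_local_time = fractional_brownian_motion P H B + local_time P B l
  for P :: "'a measure" and H B l +
  assumes H_pos: "0 < H" and H_less_1: "H < 1"
begin

definition regular :: "'a \<Rightarrow> bool" where
  "regular \<omega> \<longleftrightarrow> continuous_on {0..} (\<lambda>t. B t \<omega>) \<and> (\<forall>x. \<forall>t\<ge>0. 0 \<le> l x t \<omega>) \<and>
     continuous_on (UNIV \<times> {0..}) (\<lambda>(x, t). l x t \<omega>) \<and>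
     (\<forall>t\<ge>0. \<forall>g :: real \<Rightarrow> ennreal. g \<in> borel_measurable borel \<longrightarrow>
         (\<integral>\<^sup>+s\<in>{0..t}. g (B s \<omega>) \<partial>lborel) = (\<integral>\<^sup>+x. g x * ennreal (l x t \<omega>) \<partial>lborel))"

lemma AE_regular: "AE \<omega> in P. regular \<omega>"
  using continuous_paths local_time_nonneg jointly_continuous occupation_formula
  by eventually_elim (auto simp: regular_def)

lemma regular_continuous_space:
  assumes "regular \<omega>" "0 \<le> t"
  shows "continuous_on UNIV (\<lambda>x. l x t \<omega>)"
proof -
  have "continuous_on (UNIV \<times> {0..}) (\<lambda>(x, t). l x t \<omega>)"
    using assms by (simp add: regular_def)
  then have "continuous_on UNIV ((\<lambda>(x, t). l x t \<omega>) \<circ> (\<lambda>x. (x, t)))"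
    using assms(2)
    by (intro continuous_on_compose continuous_intros) (auto intro: continuous_on_subset)
  then show ?thesis by (simp add: comp_def)
qed

lemma local_time_as_limit:
  assumes "regular \<omega>" "0 \<le> t"
  shows "(\<lambda>k. enn2real (\<integral>\<^sup>+s\<in>{0..t}. ennreal (tent k (B s \<omega> - x)) \<partial>lborel)) \<longlonglongrightarrow> l x t \<omega>"
proof -
  have occ: "(\<integral>\<^sup>+s\<in>{0..t}. ennreal (tent k (B s \<omega> - x)) \<partial>lborel) =
      (\<integral>\<^sup>+y. ennreal (tent k (y - x)) * ennreal (l y t \<omega>) \<partial>lborel)" for k
  proof -
    have "(\<integral>\<^sup>+s\<in>{0..t}. g (B s \<omega>) \<partial>lborel) = (\<integral>\<^sup>+x. g x * ennreal (l x t \<omega>) \<partial>lborel)"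
      if "g \<in> borel_measurable borel" for g :: "real \<Rightarrow> ennreal"
      using assms that by (simp add: regular_def)
    from this[of "\<lambda>y. ennreal (tent k (y - x))"] show ?thesis by simp
  qed
  have cont: "continuous_on UNIV (\<lambda>x. l x t \<omega>)"
    by (rule regular_continuous_space[OF assms])
  show ?thesis
    unfolding occ
  proof (rule tent_approximate_identity)
    show "(\<lambda>y. l y t \<omega>) \<in> borel_measurable borel"
      using cont by (rule borel_measurable_continuous_onI)
    show "isCont (\<lambda>y. l y t \<omega>) x"
      using cont by (simp add: continuous_on_eq_continuous_at)
    show "0 \<le> l y t \<omega>" for y using assms by (simp add: regular_def)
  qed
qed

lemma regular_measurable_tent:
  assumes "regular \<omega>"
  shows "(\<lambda>s. indicator {0..t} s * tent k (B s \<omega> - x)) \<in> borel_measurable borel"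
proof -
  have "continuous_on {0..t} (\<lambda>s. tent k (B s \<omega> - x))"
    using assms by (intro continuous_on_tent continuous_intros) (auto simp: regular_def intro: continuous_on_subset)
  from borel_measurable_continuous_on_indicator[OF _ this] show ?thesis
    by (simp add: scaleR_conv_of_real)
qed

lemma integrable_tent_path:
  assumes "regular \<omega>"
  shows "integrable lborel (\<lambda>s. indicator {0..t} s * tent k (B s \<omega> - x))"
proof (rule Bochner_Integration.integrable_bound)
  show "integrable lborel (\<lambda>s. real (Suc k) * indicator {0..t} s)"
    by (intro integrable_mult_right integrable_real_indicator) (simp_all add: emeasure_lborel_Icc_eq)
  show "AE s in lborel. norm (indicator {0..t} s * tent k (B s \<omega> - x)) \<le> norm (real (Suc k) * indicator {0..t} s)"
    using tent_le tent_nonneg by (intro AE_I2) (auto simp: indicator_def)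
qed (use regular_measurable_tent[OF assms] in simp)

text \<open>For a continuous path the integrals over the discretized path converge to those over the path itself,
  by dominated convergence. By the occupation formula these are averages of the local time increment
  near \<open>x\<close>, and they converge by continuity of the local time in space.\<close>

lemma path_local_time_increment:
  assumes reg: "regular \<omega>"
  shows "path_local_time (\<lambda>t. B (t + real n) \<omega> - x) = l x (real n + 1) \<omega> - l x (real n) \<omega>"
proof -
  let ?f = "\<lambda>k s r. indicator {0..1} s * tent k (B (r + real n) \<omega> - x)"
  define A where "A k t = (\<integral>s. indicator {0..t} s * tent k (B s \<omega> - x) \<partial>lborel)" for k t
  have A: "A k t = enn2real (\<integral>\<^sup>+s\<in>{0..t}. ennreal (tent k (B s \<omega> - x)) \<partial>lborel)" for k t
    unfolding A_def using regular_measurable_tent[OF reg, of t k x]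
    by (subst integral_eq_nn_integral)
       (auto simp: tent_nonneg indicator_def intro!: arg_cong[where f = enn2real] nn_integral_cong)
  have cont: "continuous_on {0..} (\<lambda>t. B t \<omega>)"
    using reg by (simp add: regular_def)
  have shifted: "?f k s s =
      indicator {real n..real n + 1} (s + real n) * tent k (B (s + real n) \<omega> - x)" for s k
    by (auto simp: indicator_def)
  have meas: "(\<lambda>s. ?f k s s) \<in> borel_measurable borel" for k
  proof -
    have "continuous_on {0..1} (\<lambda>s. tent k (B (s + real n) \<omega> - x))"
      by (intro continuous_on_tent continuous_intros continuous_on_compose2[OF cont]) auto
    from borel_measurable_continuous_on_indicator[OF _ this] show ?thesis
      by (simp add: scaleR_conv_of_real)
  qed
  have inner: "lim (\<lambda>j. \<integral>s. ?f k s (grid j s) \<partial>lborel) =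
      A k (real n + 1) - A k (real n)" for k
  proof -
    have "(\<lambda>j. \<integral>s. ?f k s (grid j s) \<partial>lborel) \<longlonglongrightarrow>
        (\<integral>s. ?f k s s \<partial>lborel)"
    proof (rule integral_dominated_convergence[where w = "\<lambda>s. real (Suc k) * indicator {0..1} s"])
      show "(\<lambda>s. ?f k s s) \<in> borel_measurable lborel"
        using meas by simp
      show "(\<lambda>s. ?f k s (grid j s)) \<in> borel_measurable lborel" for j
      proof -
        have "(\<lambda>s. (\<lambda>i s. B (real i / real j + real n) \<omega>) (nat \<lfloor>real j * s\<rfloor>) s) \<in> borel_measurable lborel"
          by (rule measurable_compose_countable) measurable
        then have [measurable]: "(\<lambda>s. B (grid j s + real n) \<omega>) \<in> borel_measurable lborel"
          by (simp add: grid_def)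
        show ?thesis by measurable
      qed
      show "AE s in lborel. (\<lambda>j. ?f k s (grid j s)) \<longlonglongrightarrow>
          ?f k s s"
      proof (rule AE_I2)
        fix s :: real
        show "(\<lambda>j. ?f k s (grid j s)) \<longlonglongrightarrow>
          ?f k s s"
        proof (cases "s \<in> {0..1}")
          case True
          then have "0 \<le> s" by simp
          have "(\<lambda>j. B (grid j s + real n) \<omega>) \<longlonglongrightarrow> B (s + real n) \<omega>"
            using grid_nonneg \<open>0 \<le> s\<close>
            by (intro continuous_on_tendsto_compose[OF cont] tendsto_add grid_tendsto tendsto_const) (auto intro!: always_eventually)
          then show ?thesis
            by (intro tendsto_mult tendsto_const isCont_tendsto_compose[OF isCont_tent] tendsto_diff)
        qed simp
      qed
      show "AE s in lborel. norm (?f k s (grid j s)) \<le>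
          real (Suc k) * indicator {0..1} s" for j
        using tent_le tent_nonneg by (intro AE_I2) (auto simp: indicator_def)
    qed simp
    moreover have "(\<integral>s. ?f k s s \<partial>lborel) = A k (real n + 1) - A k (real n)"
    proof -
      have "(\<integral>s. ?f k s s \<partial>lborel) =
          (\<integral>s. indicator {real n..real n + 1} s * tent k (B s \<omega> - x) \<partial>lborel)"
        unfolding shifted
        using lborel_integral_real_affine[of 1 "\<lambda>s. indicator {real n..real n + 1} s * tent k (B s \<omega> - x)" "real n"]
        by (simp add: add.commute)
      also have "\<dots> = (\<integral>s. indicator {0..real n + 1} s * tent k (B s \<omega> - x) - indicator {0..real n} s * tent k (B s \<omega> - x) \<partial>lborel)"
      proof (rule integral_cong_AE)
        show "AE s in lborel. indicator {real n..real n + 1} s * tent k (B s \<omega> - x) =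
            indicator {0..real n + 1} s * tent k (B s \<omega> - x) - indicator {0..real n} s * tent k (B s \<omega> - x)"
          using AE_lborel_singleton[of "real n"] by eventually_elim (auto simp: indicator_def)
        have "(\<lambda>s. indicator {real n..real n + 1} s * (indicator {0..real n + 1} s * tent k (B s \<omega> - x))) \<in> borel_measurable lborel"
          by (rule borel_measurable_times)
             (simp_all only: regular_measurable_tent[OF reg] measurable_lborel2 borel_measurable_indicator sets_lborel atLeastAtMost_borel)
        then show "(\<lambda>s. indicator {real n..real n + 1} s * tent k (B s \<omega> - x)) \<in> borel_measurable lborel"
          by (rule measurable_cong[THEN iffD1, rotated]) (auto simp: indicator_def)
        show "(\<lambda>s. indicator {0..real n + 1} s * tent k (B s \<omega> - x) - indicator {0..real n} s * tent k (B s \<omega> - x))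
            \<in> borel_measurable lborel"
          by (intro borel_measurable_diff) (simp_all only: regular_measurable_tent[OF reg] measurable_lborel2)
      qed
      also have "\<dots> = A k (real n + 1) - A k (real n)"
        unfolding A_def by (intro Bochner_Integration.integral_diff integrable_tent_path reg)
      finally show ?thesis .
    qed
    ultimately show ?thesis by (simp add: limI)
  qed
  have "(\<lambda>k. A k (real n + 1) - A k (real n)) \<longlonglongrightarrow> l x (real n + 1) \<omega> - l x (real n) \<omega>"
    unfolding A by (intro tendsto_diff local_time_as_limit reg) auto
  then show ?thesis
    unfolding path_local_time_def inner by (rule limI)
qed

end

section \<open>Integrability of the local time\<close>

lemma normal_density_le:
  assumes "0 < \<sigma>"
  shows "normal_density \<mu> \<sigma> x \<le> 1 / (2 * \<sigma>)"
proof -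
  have "2 * \<sigma> \<le> sqrt (2 * pi * \<sigma>\<^sup>2)"
  proof (rule real_le_rsqrt)
    have "4 * \<sigma>\<^sup>2 \<le> 2 * pi * \<sigma>\<^sup>2"
      using pi_ge_two by (intro mult_right_mono) auto
    then show "(2 * \<sigma>)\<^sup>2 \<le> 2 * pi * \<sigma>\<^sup>2" by (simp add: power_mult_distrib)
  qed
  then have "1 / sqrt (2 * pi * \<sigma>\<^sup>2) \<le> 1 / (2 * \<sigma>)"
    using assms by (intro divide_left_mono) auto
  moreover have "normal_density \<mu> \<sigma> x \<le> 1 / sqrt (2 * pi * \<sigma>\<^sup>2) * 1"
    unfolding normal_density_def using assms by (intro mult_left_mono) auto
  ultimately show ?thesis by simp
qed

lemma normal_small_ball:
  assumes \<sigma>: "0 < \<sigma>" and D: "normal_with_sd P \<sigma> Y" and r: "0 \<le> r"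
  shows "emeasure P {\<omega> \<in> space P. \<bar>Y \<omega>\<bar> \<le> r} \<le> ennreal (r / \<sigma>)"
proof -
  have "{\<omega> \<in> space P. \<bar>Y \<omega>\<bar> \<le> r} = Y -` {-r..r} \<inter> space P" by auto
  then have "emeasure P {\<omega> \<in> space P. \<bar>Y \<omega>\<bar> \<le> r} = (\<integral>\<^sup>+x. ennreal (normal_density 0 \<sigma> x) * indicator {-r..r} x \<partial>lborel)"
    using distributed_emeasure[OF D, of "{-r..r}"] by simp
  also have "\<dots> \<le> (\<integral>\<^sup>+x. ennreal (1 / (2 * \<sigma>)) * indicator {-r..r} x \<partial>lborel)"
    using normal_density_le[OF \<sigma>] by (intro nn_integral_mono mult_right_mono ennreal_leI) auto
  also have "\<dots> = ennreal (1 / (2 * \<sigma>)) * ennreal (2 * r)"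
    using r by (subst nn_integral_cmult_indicator) (auto simp: emeasure_lborel_Icc_eq)
  also have "\<dots> = ennreal (r / \<sigma>)"
    using \<sigma> r by (simp add: ennreal_mult'[symmetric])
  finally show ?thesis .
qed

lemma normal_exp_moment:
  assumes \<sigma>: "0 < \<sigma>" and D: "normal_with_sd P \<sigma> Y"
  shows "(\<integral>\<^sup>+\<omega>. ennreal (exp \<bar>Y \<omega>\<bar>) \<partial>P) \<le> ennreal (2 * exp (\<sigma>\<^sup>2 / 2))"
proof -
  have tilt: "normal_density 0 \<sigma> x * exp (a * x) = exp (a\<^sup>2 * \<sigma>\<^sup>2 / 2) * normal_density (a * \<sigma>\<^sup>2) \<sigma> x" for a x
  proof -
    have "- x\<^sup>2 / (2 * \<sigma>\<^sup>2) + a * x = a\<^sup>2 * \<sigma>\<^sup>2 / 2 - (x - a * \<sigma>\<^sup>2)\<^sup>2 / (2 * \<sigma>\<^sup>2)"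
      using \<sigma> by (simp add: field_simps power2_eq_square)
    then have "exp (- x\<^sup>2 / (2 * \<sigma>\<^sup>2)) * exp (a * x) = exp (a\<^sup>2 * \<sigma>\<^sup>2 / 2) * exp (- (x - a * \<sigma>\<^sup>2)\<^sup>2 / (2 * \<sigma>\<^sup>2))"
      by (simp add: exp_add[symmetric])
    then show ?thesis by (simp add: normal_density_def)
  qed
  have total: "(\<integral>\<^sup>+x. ennreal (normal_density \<mu> \<sigma> x) \<partial>lborel) = 1" for \<mu>
    using \<sigma> by (subst nn_integral_eq_integral) auto
  have int: "(\<integral>\<^sup>+x. ennreal (normal_density 0 \<sigma> x * exp (a * x)) \<partial>lborel) = ennreal (exp (a\<^sup>2 * \<sigma>\<^sup>2 / 2))" for a
    unfolding tilt by (simp add: ennreal_mult nn_integral_cmult total)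
  have "(\<integral>\<^sup>+\<omega>. ennreal (exp \<bar>Y \<omega>\<bar>) \<partial>P) = (\<integral>\<^sup>+x. ennreal (normal_density 0 \<sigma> x) * ennreal (exp \<bar>x\<bar>) \<partial>lborel)"
    by (rule distributed_nn_integral[OF D, symmetric]) simp
  also have "\<dots> \<le> (\<integral>\<^sup>+x. ennreal (normal_density 0 \<sigma> x * exp (1 * x)) + ennreal (normal_density 0 \<sigma> x * exp (-1 * x)) \<partial>lborel)"
  proof (rule nn_integral_mono)
    fix x :: real
    have "exp \<bar>x\<bar> \<le> exp (1 * x) + exp (-1 * x)" by (cases "0 \<le> x") auto
    then have "normal_density 0 \<sigma> x * exp \<bar>x\<bar> \<le> normal_density 0 \<sigma> x * (exp (1 * x) + exp (-1 * x))"
      by (rule mult_left_mono) simp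
    then show "ennreal (normal_density 0 \<sigma> x) * ennreal (exp \<bar>x\<bar>) \<le>
        ennreal (normal_density 0 \<sigma> x * exp (1 * x)) + ennreal (normal_density 0 \<sigma> x * exp (-1 * x))"
      by (simp add: ennreal_mult[symmetric] ennreal_plus[symmetric] distrib_left ennreal_leI del: ennreal_plus)
  qed
  also have "\<dots> = ennreal (exp (\<sigma>\<^sup>2 / 2)) + ennreal (exp (\<sigma>\<^sup>2 / 2))"
    by (subst nn_integral_add) (use int[of 1] int[of "-1"] in auto)
  also have "\<dots> = ennreal (2 * exp (\<sigma>\<^sup>2 / 2))"
    by (subst ennreal_plus[symmetric]) auto
  finally show ?thesis .
qed

text \<open>This is the bound that makes one argument work for all \<open>\<alpha> \<in> (0, 2)\<close>. If \<open>\<alpha> \<ge> 1\<close> then \<open>y\<^sup>\<alpha>\<close> lies below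
  \<open>y\<close> or \<open>y\<^sup>2\<close>. If \<open>\<alpha> < 1\<close> then values \<open>y \<le> exp (- \<bar>x\<bar>)\<close> contribute an integrable amount,
  and for larger values \<open>y\<^sup>\<alpha> = y * y\<^sup>\<alpha>\<^sup>-\<^sup>1\<close> is at most \<open>y * exp \<bar>x\<bar>\<close>.\<close>

lemma powr_bound_by_weights:
  fixes y x \<alpha> :: real
  assumes \<alpha>: "0 < \<alpha>" "\<alpha> < 2" and y: "0 \<le> y"
  shows "y powr \<alpha> \<le> exp \<bar>x\<bar> * y + exp (- (\<alpha> * \<bar>x\<bar>)) + y\<^sup>2"
proof -
  consider "y = 0" | "0 < y" "1 \<le> \<alpha>" "1 \<le> y" | "0 < y" "1 \<le> \<alpha>" "y < 1"
    | "0 < y" "\<alpha> < 1" "y \<le> exp (- \<bar>x\<bar>)" | "0 < y" "\<alpha> < 1" "exp (- \<bar>x\<bar>) < y"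
    using y by linarith
  then show ?thesis
  proof cases
    case 1 then show ?thesis using \<alpha> by simp
  next
    case 2
    have "y powr \<alpha> \<le> y powr 2" using 2 \<alpha> by (intro powr_mono) auto
    also have "\<dots> = y\<^sup>2" using 2 by simp
    finally show ?thesis using y by (simp add: add_increasing)
  next
    case 3
    have "y powr \<alpha> \<le> y powr 1" using 3 by (intro powr_mono') auto
    also have "\<dots> \<le> exp \<bar>x\<bar> * y" using 3 by simp
    finally show ?thesis by (simp add: add_increasing2)
  next
    case 4
    have "y powr \<alpha> \<le> exp (- \<bar>x\<bar>) powr \<alpha>" using 4 \<alpha> by (intro powr_mono2) auto
    also have "\<dots> = exp (- (\<alpha> * \<bar>x\<bar>))" by (simp add: powr_def)
    finally have "y powr \<alpha> \<le> exp (- (\<alpha> * \<bar>x\<bar>))" .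
    moreover have "0 \<le> exp \<bar>x\<bar> * y" using y by simp
    moreover have "0 \<le> y\<^sup>2" by simp
    ultimately show ?thesis by linarith
  next
    case 5
    have "y powr \<alpha> = y * y powr (\<alpha> - 1)"
      using 5 by (simp add: powr_diff)
    also have "\<dots> \<le> y * exp (- \<bar>x\<bar>) powr (\<alpha> - 1)"
      using 5 by (intro mult_left_mono powr_mono2') auto
    also have "\<dots> = y * exp ((1 - \<alpha>) * \<bar>x\<bar>)" by (simp add: powr_def algebra_simps)
    also have "\<dots> \<le> y * exp \<bar>x\<bar>"
    proof -
      have "(1 - \<alpha>) * \<bar>x\<bar> \<le> 1 * \<bar>x\<bar>" using \<alpha> by (intro mult_right_mono) auto
      then show ?thesis using y by (intro mult_left_mono) auto
    qed
    finally show ?thesis by (simp add: add_increasing2 mult.commute)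
  qed
qed

lemma nn_integral_exp_neg_abs:
  assumes "0 < \<alpha>"
  shows "(\<integral>\<^sup>+x. ennreal (exp (- (\<alpha> * \<bar>x\<bar>))) \<partial>lborel) < \<infinity>"
proof -
  have one: "(\<integral>\<^sup>+x. ennreal (exponential_density \<alpha> x) \<partial>lborel) = 1"
    using prob_space.emeasure_space_1[OF prob_space_exponential_density[OF assms]]
    by (simp add: emeasure_density)
  have refl: "(\<integral>\<^sup>+x. ennreal (exponential_density \<alpha> (- x)) \<partial>lborel) = 1"
    using nn_integral_real_affine[of "\<lambda>x. ennreal (exponential_density \<alpha> x)" "-1" 0] one by simp
  have "(\<integral>\<^sup>+x. ennreal (exp (- (\<alpha> * \<bar>x\<bar>))) \<partial>lborel) \<le>
      (\<integral>\<^sup>+x. ennreal (1 / \<alpha>) * (ennreal (exponential_density \<alpha> x) + ennreal (exponential_density \<alpha> (- x))) \<partial>lborel)"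
  proof (rule nn_integral_mono)
    fix x :: real
    have "exp (- (\<alpha> * \<bar>x\<bar>)) \<le> 1 / \<alpha> * (exponential_density \<alpha> x + exponential_density \<alpha> (- x))"
      using assms by (auto simp: exponential_density_def mult.commute)
    then have "ennreal (exp (- (\<alpha> * \<bar>x\<bar>))) \<le> ennreal (1 / \<alpha> * (exponential_density \<alpha> x + exponential_density \<alpha> (- x)))"
      by (rule ennreal_leI)
    also have "\<dots> = ennreal (1 / \<alpha>) * (ennreal (exponential_density \<alpha> x) + ennreal (exponential_density \<alpha> (- x)))"
      using assms by (subst ennreal_mult) (auto simp: exponential_density_nonneg ennreal_plus)
    finally show "ennreal (exp (- (\<alpha> * \<bar>x\<bar>))) \<le> \<dots>" .
  qed
  also have "\<dots> = ennreal (1 / \<alpha>) * (1 + 1)"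
    by (subst nn_integral_cmult, simp, subst nn_integral_add) (auto simp: one refl)
  also have "\<dots> < \<infinity>" by (simp add: ennreal_mult_less_top)
  finally show ?thesis .
qed

lemma nn_integral_abs_powr_interval:
  assumes H: "H < 1" and s: "s \<in> {0..t}"
  shows "(\<integral>\<^sup>+u. ennreal (\<bar>s - u\<bar> powr - H) * indicator {0..t} u \<partial>lborel) \<le> ennreal (2 * (t powr (1 - H) / (1 - H)))"
proof -
  have t: "0 \<le> t" using s by simp
  have half: "(\<integral>\<^sup>+r. ennreal (\<bar>r\<bar> powr - H) * indicator {0..t} r \<partial>lborel) = ennreal (t powr (1 - H) / (1 - H))"
  proof -
    have "(\<integral>\<^sup>+r. ennreal (\<bar>r\<bar> powr - H) * indicator {0..t} r \<partial>lborel) =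
        (\<integral>\<^sup>+r. ennreal (if r \<in> {0..t} then r powr - H else 0) \<partial>lborel)"
      by (intro nn_integral_cong) (auto simp: indicator_def)
    also have "\<dots> = ennreal (t powr (1 - H) / (1 - H))"
    proof (rule nn_integral_has_integral_lborel)
      show "((\<lambda>r. if r \<in> {0..t} then r powr - H else 0) has_integral t powr (1 - H) / (1 - H)) UNIV"
        using has_integral_powr_from_0[of "- H" t] H t by (simp only: has_integral_restrict_UNIV) simp
    qed auto
    finally show ?thesis .
  qed
  have "(\<integral>\<^sup>+u. ennreal (\<bar>s - u\<bar> powr - H) * indicator {0..t} u \<partial>lborel) =
      (\<integral>\<^sup>+r. ennreal (\<bar>r\<bar> powr - H) * indicator {0..t} (s + r) \<partial>lborel)"
    using nn_integral_real_affine[of "\<lambda>u. ennreal (\<bar>s - u\<bar> powr - H) * indicator {0..t} u" 1 s] by simp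
  also have "\<dots> \<le> (\<integral>\<^sup>+r. ennreal (\<bar>r\<bar> powr - H) * indicator {0..t} r + ennreal (\<bar>- r\<bar> powr - H) * indicator {0..t} (- r) \<partial>lborel)"
    using s by (intro nn_integral_mono) (auto simp: indicator_def)
  also have "\<dots> = ennreal (t powr (1 - H) / (1 - H)) + ennreal (t powr (1 - H) / (1 - H))"
    using half nn_integral_real_affine[of "\<lambda>r. ennreal (\<bar>r\<bar> powr - H) * indicator {0..t} r" "-1" 0]
    by (subst nn_integral_add) auto
  also have "\<dots> = ennreal (2 * (t powr (1 - H) / (1 - H)))"
    using H by (subst ennreal_plus[symmetric]) auto
  finally show ?thesis .
qed

lemma nn_integral_tent_tent:
  "(\<integral>\<^sup>+x. ennreal (tent k (a - x)) * ennreal (tent k (b - x)) \<partial>lborel) \<le>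
    ennreal (real (Suc k)) * indicator {y. \<bar>y\<bar> \<le> 2 / real (Suc k)} (a - b)"
proof (cases "\<bar>a - b\<bar> \<le> 2 / real (Suc k)")
  case True
  have "(\<integral>\<^sup>+x. ennreal (tent k (a - x)) * ennreal (tent k (b - x)) \<partial>lborel) \<le>
      (\<integral>\<^sup>+x. ennreal (tent k (x - a)) * ennreal (real (Suc k)) \<partial>lborel)"
    using tent_le[of k] tent_minus[of k "x - a" for x]
    by (intro nn_integral_mono mult_mono ennreal_leI) auto
  also have "\<dots> = ennreal (real (Suc k))"
    by (simp add: nn_integral_multc nn_integral_tent)
  finally show ?thesis using True by simp
next
  case False
  have zero: "ennreal (tent k (a - x)) * ennreal (tent k (b - x)) = 0" for x
  proof (rule ccontr)
    assume "ennreal (tent k (a - x)) * ennreal (tent k (b - x)) \<noteq> 0"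
    then have "tent k (a - x) \<noteq> 0" "tent k (b - x) \<noteq> 0" by auto
    then have "\<bar>a - x\<bar> < 1 / real (Suc k)" "\<bar>b - x\<bar> < 1 / real (Suc k)"
      using tent_eq_0 by (force simp: not_le[symmetric])+
    then have "\<bar>a - b\<bar> < 2 * (1 / real (Suc k))" by linarith
    with False show False by simp
  qed
  show ?thesis unfolding zero by simp
qed

context fbm_local_time
begin

text \<open>A version of \<open>B\<close> that is jointly measurable in time and \<open>\<omega>\<close>, as Fubini's theorem requires. It agrees
  with \<open>B\<close> along continuous paths.\<close>

definition joint_B :: "real \<Rightarrow> 'a \<Rightarrow> real" where
  "joint_B s \<omega> = lim (\<lambda>j. B (grid j s) \<omega>)"

lemma measurable_joint_B_pair: "(\<lambda>(\<omega>, s). joint_B s \<omega>) \<in> borel_measurable (P \<Otimes>\<^sub>M lborel)"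
proof -
  have "(\<lambda>z. lim (\<lambda>j. case z of (\<omega>, s) \<Rightarrow> B (grid j s) \<omega>)) \<in> borel_measurable (P \<Otimes>\<^sub>M lborel)"
    by (intro borel_measurable_lim_metric measurable_grid_process measurable_B)
  then show ?thesis by (simp add: joint_B_def case_prod_beta')
qed

lemma measurable_joint_B [measurable (raw)]:
  assumes "f \<in> measurable M P" "g \<in> borel_measurable M"
  shows "(\<lambda>x. joint_B (g x) (f x)) \<in> borel_measurable M"
  using measurable_compose[OF measurable_Pair[OF assms(1), of g lborel] measurable_joint_B_pair] assms by simp

lemma joint_B_eq:
  assumes "regular \<omega>" "0 \<le> s"
  shows "joint_B s \<omega> = B s \<omega>"
  unfolding joint_B_def
proof (rule limI)
  have "continuous_on {0..} (\<lambda>t. B t \<omega>)" using assms by (simp add: regular_def)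
  then show "(\<lambda>j. B (grid j s) \<omega>) \<longlonglongrightarrow> B s \<omega>"
    using assms grid_nonneg by (intro continuous_on_tendsto_compose[of "{0..}" "\<lambda>t. B t \<omega>"] grid_tendsto) (auto intro!: always_eventually)
qed

lemma B_normal:
  assumes "0 < s"
  shows "normal_with_sd P (sqrt unit_var * s powr H) (B s)"
  using fbm_on_normal[OF prob_space_axioms fbm_on_nonneg_times, of s] assms unit_var_pos by simp

lemma B_increment_small_ball:
  assumes "0 \<le> s" "0 \<le> u" "s \<noteq> u" "0 \<le> r"
  shows "emeasure P {\<omega> \<in> space P. \<bar>B s \<omega> - B u \<omega>\<bar> \<le> r} \<le> ennreal (r / (sqrt unit_var * \<bar>s - u\<bar> powr H))"
  using assms
proof (induction s u rule: linorder_wlog)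
  case (le s u)
  have "fbm_on P unit_var H {0..} (\<lambda>t \<omega>. B (t + s) \<omega> - B s \<omega>)"
    using le by (intro fbm_on_increments[OF fbm_on_nonneg_times]) auto
  from fbm_on_normal[OF prob_space_axioms this, of "u - s"]
  have "normal_with_sd P (sqrt unit_var * \<bar>s - u\<bar> powr H) (\<lambda>\<omega>. B u \<omega> - B s \<omega>)"
    using le unit_var_pos by (simp add: abs_minus_commute)
  from normal_small_ball[OF _ this, of r] show ?case
    using le unit_var_pos by (simp add: abs_minus_commute)
next
  case (sym s u)
  then show ?case by (simp add: abs_minus_commute)
qed

text \<open>By the occupation formula this is the integral over \<open>s \<in> [0, t]\<close> of the expectation of
  \<open>exp \<bar>B s\<bar>\<close>, which is bounded for bounded \<open>s\<close>.\<close>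

lemma nn_integral_exp_weighted_local_time:
  assumes t: "0 \<le> t"
  shows "(\<integral>\<^sup>+\<omega>. (\<integral>\<^sup>+x. ennreal (exp \<bar>x\<bar>) * ennreal (l x t \<omega>) \<partial>lborel) \<partial>P) < \<infinity>"
proof -
  let ?e = "\<lambda>\<omega>. \<integral>\<^sup>+x. ennreal (exp \<bar>x\<bar>) * ennreal (l x t \<omega>) \<partial>lborel"
    and ?b = "\<lambda>\<omega>. \<integral>\<^sup>+s. ennreal (exp \<bar>joint_B s \<omega>\<bar>) * indicator {0..t} s \<partial>lborel"
  interpret PL: pair_sigma_finite P lborel ..
  let ?C = "ennreal (2 * exp ((sqrt unit_var * t powr H)\<^sup>2 / 2))"
  have "(\<integral>\<^sup>+\<omega>. ?e \<omega> \<partial>P) =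
      (\<integral>\<^sup>+\<omega>. ?b \<omega> \<partial>P)"
  proof (rule nn_integral_cong_AE)
    show "AE \<omega> in P. ?e \<omega> =
        ?b \<omega>"
      using AE_regular
    proof eventually_elim
      case (elim \<omega>)
      have "(\<integral>\<^sup>+s\<in>{0..t}. g (B s \<omega>) \<partial>lborel) = (\<integral>\<^sup>+x. g x * ennreal (l x t \<omega>) \<partial>lborel)"
        if "g \<in> borel_measurable borel" for g :: "real \<Rightarrow> ennreal"
        using elim t that by (simp add: regular_def)
      from this[of "\<lambda>y. ennreal (exp \<bar>y\<bar>)"]
      have "?e \<omega> =
          (\<integral>\<^sup>+s. ennreal (exp \<bar>B s \<omega>\<bar>) * indicator {0..t} s \<partial>lborel)" by simp
      also have "\<dots> = ?b \<omega>"
        using joint_B_eq[OF elim] by (intro nn_integral_cong) (auto simp: indicator_def)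
      finally show ?case .
    qed
  qed
  also have "\<dots> = (\<integral>\<^sup>+s. (\<integral>\<^sup>+\<omega>. ennreal (exp \<bar>joint_B s \<omega>\<bar>) * indicator {0..t} s \<partial>P) \<partial>lborel)"
    by (rule PL.Fubini'[symmetric]) measurable
  also have "\<dots> \<le> (\<integral>\<^sup>+s. ?C * indicator {0..t} s \<partial>lborel)"
  proof (rule nn_integral_mono_AE)
    show "AE s in lborel. (\<integral>\<^sup>+\<omega>. ennreal (exp \<bar>joint_B s \<omega>\<bar>) * indicator {0..t} s \<partial>P) \<le> ?C * indicator {0..t} s"
      using AE_lborel_singleton[of 0]
    proof eventually_elim
      case (elim s)
      show ?case
      proof (cases "s \<in> {0..t}")
        case True
        with elim have s: "0 < s" "s \<le> t" by auto
        have "(\<integral>\<^sup>+\<omega>. ennreal (exp \<bar>joint_B s \<omega>\<bar>) \<partial>P) = (\<integral>\<^sup>+\<omega>. ennreal (exp \<bar>B s \<omega>\<bar>) \<partial>P)"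
          using AE_regular s by (intro nn_integral_cong_AE) (auto simp: joint_B_eq elim!: eventually_mono)
        also have "\<dots> \<le> ennreal (2 * exp ((sqrt unit_var * s powr H)\<^sup>2 / 2))"
          using unit_var_pos s by (intro normal_exp_moment B_normal) auto
        also have "\<dots> \<le> ?C"
          using s unit_var_pos H_pos
          by (intro ennreal_leI mult_left_mono exp_le_cancel_iff[THEN iffD2] divide_right_mono power_mono powr_mono2) auto
        finally show ?thesis using True by simp
      qed simp
    qed
  qed
  also have "\<dots> = ?C * ennreal t"
    using t by (subst nn_integral_cmult_indicator) (auto simp: emeasure_lborel_Icc_eq)
  also have "\<dots> < \<infinity>" by (simp add: ennreal_mult_less_top)
  finally show ?thesis .
qed

text \<open>The square is a double time integral over \<open>s\<close> and \<open>u\<close>. Integration over \<open>x\<close> leaves only pairs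
  with \<open>\<bar>B s - B u\<bar> \<le> 2 / Suc k\<close>, weighted by \<open>Suc k\<close>. As \<open>B s - B u\<close> has a density of order
  \<open>\<bar>s - u\<bar>\<^sup>-\<^sup>H\<close>, the expectation is bounded uniformly in \<open>k\<close>, and the singularity is integrable since
  \<open>H < 1\<close>.\<close>

lemma smoothed_local_time_second_moment:
  assumes t: "0 \<le> t"
  shows "(\<integral>\<^sup>+\<omega>. (\<integral>\<^sup>+x. (\<integral>\<^sup>+s. ennreal (tent k (joint_B s \<omega> - x)) * indicator {0..t} s \<partial>lborel)\<^sup>2 \<partial>lborel) \<partial>P)
    \<le> ennreal (2 / sqrt unit_var * (2 * (t powr (1 - H) / (1 - H)))) * ennreal t"
proof -
  interpret PL: pair_sigma_finite P lborel ..
  let ?K = "real (Suc k)"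
  let ?W = "\<lambda>\<omega> s u. (ennreal ?K * indicator {y. \<bar>y\<bar> \<le> 2 / ?K} (joint_B s \<omega> - joint_B u \<omega>)) *
    (indicator {0..t} s * indicator {0..t} u)"
  let ?C = "ennreal (2 / sqrt unit_var * (2 * (t powr (1 - H) / (1 - H))))"
  let ?T = "\<lambda>\<omega> x s. ennreal (tent k (joint_B s \<omega> - x)) * indicator {0..t} s"
  have "(\<integral>\<^sup>+\<omega>. (\<integral>\<^sup>+x. (\<integral>\<^sup>+s. ?T \<omega> x s \<partial>lborel)\<^sup>2 \<partial>lborel) \<partial>P) \<le>
      (\<integral>\<^sup>+\<omega>. (\<integral>\<^sup>+s. (\<integral>\<^sup>+u. ?W \<omega> s u \<partial>lborel) \<partial>lborel) \<partial>P)"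
  proof (rule nn_integral_mono)
    fix \<omega> assume [measurable]: "\<omega> \<in> space P"
    have "(\<integral>\<^sup>+x. (\<integral>\<^sup>+s. ?T \<omega> x s \<partial>lborel)\<^sup>2 \<partial>lborel) = (\<integral>\<^sup>+x. (\<integral>\<^sup>+s. (\<integral>\<^sup>+u. ?T \<omega> x s * ?T \<omega> x u \<partial>lborel) \<partial>lborel) \<partial>lborel)"
    proof (rule nn_integral_cong)
      fix x
      have "(\<integral>\<^sup>+s. (\<integral>\<^sup>+u. ?T \<omega> x s * ?T \<omega> x u \<partial>lborel) \<partial>lborel) = (\<integral>\<^sup>+s. ?T \<omega> x s * (\<integral>\<^sup>+u. ?T \<omega> x u \<partial>lborel) \<partial>lborel)"
        by (intro nn_integral_cong nn_integral_cmult) measurable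
      also have "\<dots> = (\<integral>\<^sup>+s. ?T \<omega> x s \<partial>lborel) * (\<integral>\<^sup>+u. ?T \<omega> x u \<partial>lborel)"
        by (rule nn_integral_multc) measurable
      finally show "(\<integral>\<^sup>+s. ?T \<omega> x s \<partial>lborel)\<^sup>2 = (\<integral>\<^sup>+s. (\<integral>\<^sup>+u. ?T \<omega> x s * ?T \<omega> x u \<partial>lborel) \<partial>lborel)"
        by (simp add: power2_eq_square)
    qed
    also have "\<dots> = (\<integral>\<^sup>+s. (\<integral>\<^sup>+x. (\<integral>\<^sup>+u. ?T \<omega> x s * ?T \<omega> x u \<partial>lborel) \<partial>lborel) \<partial>lborel)"
      by (rule lborel_pair.Fubini') measurable
    also have "\<dots> = (\<integral>\<^sup>+s. (\<integral>\<^sup>+u. (\<integral>\<^sup>+x. ?T \<omega> x s * ?T \<omega> x u \<partial>lborel) \<partial>lborel) \<partial>lborel)"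
      by (intro nn_integral_cong lborel_pair.Fubini') measurable
    also have "\<dots> \<le> (\<integral>\<^sup>+s. (\<integral>\<^sup>+u. ?W \<omega> s u \<partial>lborel) \<partial>lborel)"
    proof (intro nn_integral_mono)
      fix s u
      have "(\<integral>\<^sup>+x. ?T \<omega> x s * ?T \<omega> x u \<partial>lborel) =
          (\<integral>\<^sup>+x. (ennreal (tent k (joint_B s \<omega> - x)) * ennreal (tent k (joint_B u \<omega> - x))) * (indicator {0..t} s * indicator {0..t} u) \<partial>lborel)"
        by (intro nn_integral_cong) (simp add: ac_simps)
      also have "\<dots> = (\<integral>\<^sup>+x. ennreal (tent k (joint_B s \<omega> - x)) * ennreal (tent k (joint_B u \<omega> - x)) \<partial>lborel) * (indicator {0..t} s * indicator {0..t} u)"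
        by (rule nn_integral_multc) measurable
      also have "\<dots> \<le> ?W \<omega> s u"
        by (intro mult_right_mono nn_integral_tent_tent) auto
      finally show "(\<integral>\<^sup>+x. ?T \<omega> x s * ?T \<omega> x u \<partial>lborel) \<le>
          ?W \<omega> s u" .
    qed
    finally show "(\<integral>\<^sup>+x. (\<integral>\<^sup>+s. ?T \<omega> x s \<partial>lborel)\<^sup>2 \<partial>lborel) \<le>
      (\<integral>\<^sup>+s. (\<integral>\<^sup>+u. ?W \<omega> s u \<partial>lborel) \<partial>lborel)" .
  qed
  also have "\<dots> = (\<integral>\<^sup>+s. (\<integral>\<^sup>+\<omega>. (\<integral>\<^sup>+u. ?W \<omega> s u \<partial>lborel) \<partial>P) \<partial>lborel)"
    by (rule PL.Fubini'[symmetric]) measurable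
  also have "\<dots> = (\<integral>\<^sup>+s. (\<integral>\<^sup>+u. (\<integral>\<^sup>+\<omega>. ?W \<omega> s u \<partial>P) \<partial>lborel) \<partial>lborel)"
    by (intro nn_integral_cong PL.Fubini'[symmetric]) measurable
  also have "\<dots> \<le> (\<integral>\<^sup>+s. (\<integral>\<^sup>+u. ennreal (2 / sqrt unit_var) * (ennreal (\<bar>s - u\<bar> powr - H) * indicator {0..t} u) * indicator {0..t} s \<partial>lborel) \<partial>lborel)"
  proof (rule nn_integral_mono, rule nn_integral_mono_AE)
    fix s :: real
    show "AE u in lborel. (\<integral>\<^sup>+\<omega>. ?W \<omega> s u \<partial>P) \<le> ennreal (2 / sqrt unit_var) * (ennreal (\<bar>s - u\<bar> powr - H) * indicator {0..t} u) * indicator {0..t} s"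
      using AE_lborel_singleton[of s]
    proof eventually_elim
      case (elim u)
      show ?case
      proof (cases "s \<in> {0..t} \<and> u \<in> {0..t}")
        case True
        have [measurable]: "B s \<in> borel_measurable P" "B u \<in> borel_measurable P"
          using True by (auto intro: measurable_B)
        have "(\<integral>\<^sup>+\<omega>. ennreal ?K * indicator {y. \<bar>y\<bar> \<le> 2 / ?K} (joint_B s \<omega> - joint_B u \<omega>) \<partial>P) =
            (\<integral>\<^sup>+\<omega>. ennreal ?K * indicator {\<omega> \<in> space P. \<bar>B s \<omega> - B u \<omega>\<bar> \<le> 2 / ?K} \<omega> \<partial>P)"
          using AE_regular AE_space True
          by (intro nn_integral_cong_AE) (auto simp: joint_B_eq indicator_def elim!: eventually_elim2)
        also have "\<dots> = ennreal ?K * emeasure P {\<omega> \<in> space P. \<bar>B s \<omega> - B u \<omega>\<bar> \<le> 2 / ?K}"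
          by (rule nn_integral_cmult_indicator) measurable
        also have "\<dots> \<le> ennreal ?K * ennreal (2 / ?K / (sqrt unit_var * \<bar>s - u\<bar> powr H))"
          using True elim by (intro mult_left_mono B_increment_small_ball) auto
        also have "\<dots> = ennreal (2 / sqrt unit_var) * ennreal (\<bar>s - u\<bar> powr - H)"
          using unit_var_pos by (simp add: ennreal_mult[symmetric] powr_minus field_simps del: of_nat_Suc)
        finally show ?thesis using True by simp
      qed auto
    qed
  qed
  also have "\<dots> \<le> (\<integral>\<^sup>+s. ?C * indicator {0..t} s \<partial>lborel)"
  proof (rule nn_integral_mono)
    fix s :: real
    have "(\<integral>\<^sup>+u. ennreal (2 / sqrt unit_var) * (ennreal (\<bar>s - u\<bar> powr - H) * indicator {0..t} u) * indicator {0..t} s \<partial>lborel) =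
        ennreal (2 / sqrt unit_var) * (\<integral>\<^sup>+u. ennreal (\<bar>s - u\<bar> powr - H) * indicator {0..t} u \<partial>lborel) * indicator {0..t} s"
      by (subst nn_integral_multc, measurable, subst nn_integral_cmult, measurable)
    also have "\<dots> \<le> ?C * indicator {0..t} s"
    proof (cases "s \<in> {0..t}")
      case True
      have "ennreal (2 / sqrt unit_var) * (\<integral>\<^sup>+u. ennreal (\<bar>s - u\<bar> powr - H) * indicator {0..t} u \<partial>lborel) \<le>
          ennreal (2 / sqrt unit_var) * ennreal (2 * (t powr (1 - H) / (1 - H)))"
        by (intro mult_left_mono nn_integral_abs_powr_interval True H_less_1) auto
      also have "\<dots> = ?C"
        using unit_var_pos H_less_1 by (intro ennreal_mult[symmetric]) auto
      finally show ?thesis using True by simp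
    qed simp
    finally show "(\<integral>\<^sup>+u. ennreal (2 / sqrt unit_var) * (ennreal (\<bar>s - u\<bar> powr - H) * indicator {0..t} u) * indicator {0..t} s \<partial>lborel) \<le> \<dots>" .
  qed
  also have "\<dots> = ?C * ennreal t"
    using t by (subst nn_integral_cmult_indicator) (auto simp: emeasure_lborel_Icc_eq)
  finally show ?thesis .
qed

lemma nn_integral_local_time_square:
  assumes t: "0 \<le> t"
  shows "(\<integral>\<^sup>+\<omega>. (\<integral>\<^sup>+x. ennreal ((l x t \<omega>)\<^sup>2) \<partial>lborel) \<partial>P) < \<infinity>"
proof -
  let ?T = "\<lambda>k \<omega> x. \<integral>\<^sup>+s. ennreal (tent k (joint_B s \<omega> - x)) * indicator {0..t} s \<partial>lborel"
  let ?C = "ennreal (2 / sqrt unit_var * (2 * (t powr (1 - H) / (1 - H)))) * ennreal t"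
  have lim: "ennreal ((l x t \<omega>)\<^sup>2) = liminf (\<lambda>k. (?T k \<omega> x)\<^sup>2)" if "regular \<omega>" for \<omega> x
  proof -
    have eq: "?T k \<omega> x = (\<integral>\<^sup>+s\<in>{0..t}. ennreal (tent k (B s \<omega> - x)) \<partial>lborel)" for k
      using joint_B_eq[OF that] by (intro nn_integral_cong) (auto simp: indicator_def)
    have fin: "?T k \<omega> x < \<top>" for k
    proof -
      have "?T k \<omega> x \<le> (\<integral>\<^sup>+s. ennreal (real (Suc k)) * indicator {0..t} s \<partial>lborel)"
        by (intro nn_integral_mono mult_right_mono ennreal_leI tent_le) auto
      also have "\<dots> < \<top>"
        using t by (subst nn_integral_cmult_indicator) (auto simp: emeasure_lborel_Icc_eq ennreal_mult_less_top)
      finally show ?thesis .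
    qed
    have "(\<lambda>k. ennreal ((enn2real (?T k \<omega> x))\<^sup>2)) \<longlonglongrightarrow> ennreal ((l x t \<omega>)\<^sup>2)"
      unfolding eq by (intro tendsto_ennrealI tendsto_power local_time_as_limit that t)
    then have "(\<lambda>k. (?T k \<omega> x)\<^sup>2) \<longlonglongrightarrow> ennreal ((l x t \<omega>)\<^sup>2)"
      using fin by (simp add: ennreal_power[symmetric])
    then show ?thesis
      by (intro lim_imp_Liminf[symmetric]) auto
  qed
  have "(\<integral>\<^sup>+\<omega>. (\<integral>\<^sup>+x. ennreal ((l x t \<omega>)\<^sup>2) \<partial>lborel) \<partial>P) = (\<integral>\<^sup>+\<omega>. (\<integral>\<^sup>+x. liminf (\<lambda>k. (?T k \<omega> x)\<^sup>2) \<partial>lborel) \<partial>P)"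
    using AE_regular by (intro nn_integral_cong_AE) (auto elim!: eventually_mono intro!: nn_integral_cong simp: lim)
  also have "\<dots> \<le> (\<integral>\<^sup>+\<omega>. liminf (\<lambda>k. \<integral>\<^sup>+x. (?T k \<omega> x)\<^sup>2 \<partial>lborel) \<partial>P)"
    by (intro nn_integral_mono nn_integral_liminf) measurable
  also have "\<dots> \<le> liminf (\<lambda>k. \<integral>\<^sup>+\<omega>. (\<integral>\<^sup>+x. (?T k \<omega> x)\<^sup>2 \<partial>lborel) \<partial>P)"
    by (intro nn_integral_liminf) measurable
  also have "\<dots> \<le> liminf (\<lambda>k :: nat. ?C)"
    by (intro Liminf_mono always_eventually allI smoothed_local_time_second_moment t)
  also have "\<dots> = ?C" by (simp add: Liminf_const)
  also have "\<dots> < \<infinity>" by (simp add: ennreal_mult_less_top)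
  finally show ?thesis .
qed

lemma local_time_L_alpha:
  assumes \<alpha>: "0 < \<alpha>" "\<alpha> < 2" and t: "0 \<le> t"
  shows "(\<lambda>(\<omega>, x). l x t \<omega>) \<in> L_alpha \<alpha> (P \<Otimes>\<^sub>M lborel)"
proof -
  let ?e = "\<lambda>\<omega>. \<integral>\<^sup>+x. ennreal (exp \<bar>x\<bar>) * ennreal (l x t \<omega>) \<partial>lborel" and ?d = "\<integral>\<^sup>+x. ennreal (exp (- (\<alpha> * \<bar>x\<bar>))) \<partial>lborel"
    and ?q = "\<lambda>\<omega>. \<integral>\<^sup>+x. ennreal ((l x t \<omega>)\<^sup>2) \<partial>lborel"
  interpret PL: pair_sigma_finite P lborel ..
  have lm [measurable]: "(\<lambda>(\<omega>, x). l x t \<omega>) \<in> borel_measurable (P \<Otimes>\<^sub>M lborel)"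
    by (rule measurable_local_time[OF t])
  have lm' [measurable]: "(\<lambda>x. l (g x) t (f x)) \<in> borel_measurable M"
    if "f \<in> measurable M P" "g \<in> borel_measurable M" for f g and M :: "'c measure"
    using measurable_compose[OF measurable_Pair[OF that(1), of g lborel] lm] that by simp
  have "(\<integral>\<^sup>+z. ennreal (norm (\<bar>case z of (\<omega>, x) \<Rightarrow> l x t \<omega>\<bar> powr \<alpha>)) \<partial>(P \<Otimes>\<^sub>M lborel)) =
      (\<integral>\<^sup>+\<omega>. (\<integral>\<^sup>+x. ennreal (\<bar>l x t \<omega>\<bar> powr \<alpha>) \<partial>lborel) \<partial>P)"
    by (subst lborel.nn_integral_fst[symmetric]) auto
  also have "\<dots> \<le> (\<integral>\<^sup>+\<omega>. ?e \<omega> +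
      ?d + ?q \<omega> \<partial>P)"
  proof (rule nn_integral_mono_AE)
    show "AE \<omega> in P. (\<integral>\<^sup>+x. ennreal (\<bar>l x t \<omega>\<bar> powr \<alpha>) \<partial>lborel) \<le>
        ?e \<omega> +
        ?d + ?q \<omega>"
      using AE_regular AE_space
    proof eventually_elim
      case (elim \<omega>)
      have [measurable]: "\<omega> \<in> space P" by fact
      have nonneg: "0 \<le> l x t \<omega>" for x using elim t by (simp add: regular_def)
      have "(\<integral>\<^sup>+x. ennreal (\<bar>l x t \<omega>\<bar> powr \<alpha>) \<partial>lborel) \<le>
          (\<integral>\<^sup>+x. ennreal (exp \<bar>x\<bar>) * ennreal (l x t \<omega>) + ennreal (exp (- (\<alpha> * \<bar>x\<bar>))) + ennreal ((l x t \<omega>)\<^sup>2) \<partial>lborel)"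
      proof (rule nn_integral_mono)
        fix x
        have "ennreal (\<bar>l x t \<omega>\<bar> powr \<alpha>) \<le> ennreal (exp \<bar>x\<bar> * l x t \<omega> + exp (- (\<alpha> * \<bar>x\<bar>)) + (l x t \<omega>)\<^sup>2)"
          using powr_bound_by_weights[OF \<alpha> nonneg] nonneg by (intro ennreal_leI) simp
        then show "ennreal (\<bar>l x t \<omega>\<bar> powr \<alpha>) \<le> ennreal (exp \<bar>x\<bar>) * ennreal (l x t \<omega>) + ennreal (exp (- (\<alpha> * \<bar>x\<bar>))) + ennreal ((l x t \<omega>)\<^sup>2)"
          using nonneg by (simp add: ennreal_mult)
      qed
      also have "\<dots> = ?e \<omega> +
        ?d + ?q \<omega>"
        by (subst nn_integral_add, measurable, subst nn_integral_add, measurable)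
      finally show ?case .
    qed
  qed
  also have "\<dots> = (\<integral>\<^sup>+\<omega>. ?e \<omega> \<partial>P) +
      ?d + (\<integral>\<^sup>+\<omega>. ?q \<omega> \<partial>P)"
    by (subst nn_integral_add, measurable, subst nn_integral_add, measurable, simp add: emeasure_space_1)
  also have "\<dots> < \<infinity>"
    using nn_integral_exp_weighted_local_time[OF t] nn_integral_exp_neg_abs[OF \<alpha>(1)] nn_integral_local_time_square[OF t]
    by (simp add: ennreal_add_less_top)
  finally show ?thesis
    unfolding L_alpha_def by (auto intro!: integrableI_bounded)
qed

end

section \<open>The shift flow on path space\<close>

lemma normal_tail:
  assumes \<sigma>: "0 < \<sigma>" and D: "normal_with_sd P \<sigma> Y" and R: "0 < R"
  shows "emeasure P {\<omega> \<in> space P. R * \<sigma> < \<bar>Y \<omega>\<bar>} \<le> ennreal (1 / R\<^sup>2)"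
proof -
  let ?T = "{\<omega> \<in> space P. R * \<sigma> < \<bar>Y \<omega>\<bar>}"
    and ?A = "{\<omega> \<in> space P. 1 \<le> ennreal (1 / (R * \<sigma>)\<^sup>2) * ennreal ((Y \<omega>)\<^sup>2)}"
  have Y [measurable]: "Y \<in> borel_measurable P"
    using distributed_measurable[OF D] by simp
  have "(\<integral>\<^sup>+\<omega>. ennreal ((Y \<omega>)\<^sup>2) \<partial>P) = (\<integral>\<^sup>+x. ennreal (normal_density 0 \<sigma> x) * ennreal (x\<^sup>2) \<partial>lborel)"
    by (rule distributed_nn_integral[OF D, symmetric]) simp
  also have "\<dots> = (\<integral>\<^sup>+x. ennreal (normal_density 0 \<sigma> x * x\<^sup>2) \<partial>lborel)"
    by (simp add: ennreal_mult)
  also have "\<dots> = ennreal (\<sigma>\<^sup>2)"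
    using integral_normal_moment_even[OF \<sigma>, of 0 1] integrable_normal_moment[OF \<sigma>, of 0 2]
    by (subst nn_integral_eq_integral) auto
  finally have second: "(\<integral>\<^sup>+\<omega>. ennreal ((Y \<omega>)\<^sup>2) \<partial>P) = ennreal (\<sigma>\<^sup>2)" .
  have "emeasure P ?T \<le>
      emeasure P ?A"
  proof (rule emeasure_mono)
    show "?T \<subseteq> ?A"
    proof safe
      fix \<omega> assume "R * \<sigma> < \<bar>Y \<omega>\<bar>"
      then have "(R * \<sigma>)\<^sup>2 \<le> \<bar>Y \<omega>\<bar>\<^sup>2" using R \<sigma> by (intro power_mono) auto
      then have "1 \<le> 1 / (R * \<sigma>)\<^sup>2 * (Y \<omega>)\<^sup>2" using R \<sigma> by (simp add: field_simps)
      then have "ennreal 1 \<le> ennreal (1 / (R * \<sigma>)\<^sup>2 * (Y \<omega>)\<^sup>2)" by (rule ennreal_leI)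
      also have "\<dots> = ennreal (1 / (R * \<sigma>)\<^sup>2) * ennreal ((Y \<omega>)\<^sup>2)"
        by (rule ennreal_mult) auto
      finally show "1 \<le> ennreal (1 / (R * \<sigma>)\<^sup>2) * ennreal ((Y \<omega>)\<^sup>2)" by simp
    qed
  qed measurable
  also have "\<dots> = emeasure P (?A \<inter> space P)"
    by (simp add: Int_absorb2)
  also have "\<dots> \<le> ennreal (1 / (R * \<sigma>)\<^sup>2) * (\<integral>\<^sup>+\<omega>. ennreal ((Y \<omega>)\<^sup>2) * indicator (space P) \<omega> \<partial>P)"
  proof -
    have "emeasure P (?A) \<le>
        ennreal (1 / (R * \<sigma>)\<^sup>2) * (\<integral>\<^sup>+\<omega>. ennreal ((Y \<omega>)\<^sup>2) * indicator (space P) \<omega> \<partial>P)"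
      by (rule nn_integral_Markov_inequality) measurable
    then show ?thesis by (simp add: Int_absorb2)
  qed
  also have "(\<integral>\<^sup>+\<omega>. ennreal ((Y \<omega>)\<^sup>2) * indicator (space P) \<omega> \<partial>P) = ennreal (\<sigma>\<^sup>2)"
    by (subst second[symmetric]) (intro nn_integral_cong, simp)
  also have "ennreal (1 / (R * \<sigma>)\<^sup>2) * ennreal (\<sigma>\<^sup>2) = ennreal (1 / R\<^sup>2)"
    using \<sigma> by (simp add: ennreal_mult[symmetric] power_mult_distrib)
  finally show ?thesis .
qed

text \<open>Along a subsequence with summable masses, almost every point lies in only finitely many of the sets,
  for \<open>m\<close> and hence for \<open>\<nu>\<close>; now dominated convergence applies to \<open>\<nu>\<close>.\<close>

lemma absolutely_continuous_measure_small:
  assumes \<nu>: "finite_measure \<nu>" "sets \<nu> = sets m" "absolutely_continuous m \<nu>"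
    and A: "\<And>n. A n \<in> sets m" "\<And>n. emeasure m (A n) < \<infinity>" "(\<lambda>n. measure m (A n)) \<longlonglongrightarrow> 0"
    and e: "0 < e"
  shows "\<exists>n. measure \<nu> (A n) < e"
proof -
  interpret \<nu>: finite_measure \<nu> by fact
  have "\<exists>n. measure m (A n) < (1 / 2) ^ k" for k
    using order_tendstoD(2)[OF A(3), of "(1 / 2) ^ k"] by (auto simp: eventually_sequentially)
  then obtain r where r: "measure m (A (r k)) < (1 / 2) ^ k" for k by metis
  have "AE z in m. eventually (\<lambda>k. z \<in> space m - A (r k)) sequentially"
  proof (rule borel_cantelli_AE1)
    show "summable (\<lambda>k. measure m (A (r k)))"
    proof (rule summable_comparison_test')
      show "summable (\<lambda>k. (1 / 2 :: real) ^ k)" by (rule summable_geometric) simp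
      show "norm (measure m (A (r k))) \<le> (1 / 2) ^ k" for k
        using less_imp_le[OF r[of k]] by simp
    qed
  qed (use A in auto)
  then have AE: "AE z in \<nu>. eventually (\<lambda>k. z \<in> space m - A (r k)) sequentially"
    by (rule absolutely_continuous_AE[OF \<nu>(2,3)])
  have "(\<lambda>k. \<integral>z. indicat_real (A (r k)) z \<partial>\<nu>) \<longlonglongrightarrow> (\<integral>z. 0 \<partial>\<nu>)"
  proof (rule integral_dominated_convergence[where w = "\<lambda>_. 1"])
    show "AE z in \<nu>. (\<lambda>k. indicat_real (A (r k)) z) \<longlonglongrightarrow> 0"
      using AE
    proof eventually_elim
      case (elim z)
      then have "eventually (\<lambda>k. indicat_real (A (r k)) z = 0) sequentially"
        by (rule eventually_mono) auto
      then show ?case by (rule tendsto_eventually)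
    qed
  qed (use A \<nu> in \<open>auto simp: indicator_def\<close>)
  then have "(\<lambda>k. measure \<nu> (A (r k))) \<longlonglongrightarrow> 0"
    using A \<nu> by simp
  from order_tendstoD(2)[OF this e] show ?thesis
    by (auto simp: eventually_sequentially)
qed

text \<open>A two-sided path, paired with a number that is \<open>0\<close> almost everywhere for the measures on this space below.\<close>

type_synonym path = "(real \<Rightarrow> real) \<times> real"

abbreviation paths :: "path measure" where
  "paths \<equiv> PiM UNIV (\<lambda>_. borel) \<Otimes>\<^sub>M borel"

abbreviation strip :: "real \<Rightarrow> real \<Rightarrow> path set" where
  "strip t c \<equiv> {z. \<bar>fst z t\<bar> \<le> c}"

definition path_shift :: "real \<Rightarrow> path \<Rightarrow> path" where
  "path_shift a z = (\<lambda>t. fst z (t + a), snd z)"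

text \<open>The value \<open>0\<close> at irrational times makes the map commute with shifts by rational times.\<close>

definition translated_path :: "(real \<Rightarrow> real) \<Rightarrow> real \<Rightarrow> path" where
  "translated_path p x = (\<lambda>t. if t \<in> \<rat> then p t - x else 0, 0)"

lemma space_paths [simp]: "space paths = UNIV"
  by (simp add: space_pair_measure space_PiM)

lemma measurable_into_paths:
  assumes "\<And>t. (\<lambda>x. fst (f x) t) \<in> borel_measurable M" "(\<lambda>x. snd (f x)) \<in> borel_measurable M"
  shows "f \<in> measurable M paths"
proof -
  have "(\<lambda>x. fst (f x)) \<in> measurable M (PiM UNIV (\<lambda>_. borel))"
    using measurable_PiM_single'[of UNIV "\<lambda>t x. fst (f x) t" M "\<lambda>_. borel"] assms(1) by simp
  from measurable_Pair[OF this assms(2)] show ?thesis by simp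
qed

lemma measurable_path_value [measurable (raw)]:
  assumes "f \<in> measurable M paths"
  shows "(\<lambda>x. fst (f x) t) \<in> borel_measurable M"
proof -
  have "(\<lambda>x. fst (f x)) \<in> measurable M (PiM UNIV (\<lambda>_. borel))"
    using assms by measurable
  from measurable_compose[OF this measurable_component_singleton[of t]] show ?thesis by simp
qed

lemma measurable_path_shift [measurable]: "path_shift a \<in> measurable paths paths"
  unfolding path_shift_def by (rule measurable_into_paths) auto

lemma path_shift_add: "path_shift a (path_shift b z) = path_shift (a + b) z"
  by (simp add: path_shift_def add.assoc)

lemma path_shift_0 [simp]: "path_shift 0 z = z"
  by (simp add: path_shift_def)

lemma bij_path_shift: "bij (path_shift a)"
  by (rule o_bij[of "path_shift (- a)"]) (auto simp: fun_eq_iff path_shift_add)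

lemma inv_path_shift: "the_inv_into UNIV (path_shift a) = path_shift (- a)"
proof
  fix z
  have "the_inv_into UNIV (path_shift a) (path_shift a (path_shift (- a) z)) = path_shift (- a) z"
    using bij_path_shift by (intro the_inv_into_f_f) (auto simp: bij_def)
  then show "the_inv_into UNIV (path_shift a) z = path_shift (- a) z" by (simp add: path_shift_add)
qed

lemma path_shift_funpow: "path_shift a ^^ n = path_shift (real n * a)"
proof (induction n)
  case (Suc n)
  show ?case
    by (auto simp: Suc fun_eq_iff path_shift_add distrib_right)
qed (auto simp: fun_eq_iff)

lemma flow_iterate_path_shift:
  assumes "space m = UNIV"
  shows "flow_iterate m (path_shift 1) n = path_shift (real_of_int n)"
proof -
  have "path_shift (- real (nat (- n))) = path_shift (real_of_int n)" if "\<not> 0 \<le> n"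
    using that by (simp add: of_nat_nat)
  then show ?thesis
    by (auto simp: flow_iterate_def assms inv_path_shift path_shift_funpow of_nat_nat)
qed

lemma path_shift_image: "path_shift a ` A = path_shift (- a) -` A"
proof (intro set_eqI iffI)
  fix z assume "z \<in> path_shift (- a) -` A"
  then have "path_shift (- a) z \<in> A" by simp
  then show "z \<in> path_shift a ` A"
    by (rule rev_image_eqI) (simp add: path_shift_add)
qed (auto simp: path_shift_add)

locale rational_fbm = prob_space P for P :: "'a measure" +
  fixes v H :: real and X :: "real \<Rightarrow> 'a \<Rightarrow> real"
  assumes v_pos: "0 < v" and H_pos: "0 < H" and H_less_1: "H < 1"
    and measurable_X [measurable]: "X t \<in> borel_measurable P"
    and fbm_X: "fbm_on P v H \<rat> X"
begin

definition path_map :: "'a \<times> real \<Rightarrow> path" where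
  "path_map z = translated_path (\<lambda>t. X t (fst z)) (snd z)"

definition path_measure :: "path measure" where
  "path_measure = distr (P \<Otimes>\<^sub>M lborel) paths path_map"

lemma measurable_path_map [measurable]: "path_map \<in> measurable (P \<Otimes>\<^sub>M lborel) paths"
  unfolding path_map_def translated_path_def by (rule measurable_into_paths) auto

lemma sets_path_measure [simp, measurable_cong]: "sets path_measure = sets paths"
  by (simp add: path_measure_def)

lemma space_path_measure [simp]: "space path_measure = UNIV"
  by (simp add: path_measure_def)

lemma measurable_translated_path [measurable (raw)]:
  assumes "\<And>t. t \<in> \<rat> \<Longrightarrow> (\<lambda>x. f x t) \<in> borel_measurable M" "g \<in> borel_measurable M"
  shows "(\<lambda>x. translated_path (f x) (g x)) \<in> measurable M paths"
proof (rule measurable_into_paths)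
  show "(\<lambda>x. fst (translated_path (f x) (g x)) t) \<in> borel_measurable M" for t
    using assms by (cases "t \<in> \<rat>") (auto simp: translated_path_def)
qed (simp add: translated_path_def)

lemma nn_integral_path_measure:
  assumes [measurable]: "h \<in> borel_measurable paths"
  shows "(\<integral>\<^sup>+z. h z \<partial>path_measure) = (\<integral>\<^sup>+\<omega>. (\<integral>\<^sup>+x. h (translated_path (\<lambda>t. X t \<omega>) x) \<partial>lborel) \<partial>P)"
  unfolding path_measure_def
  by (subst nn_integral_distr, measurable, subst lborel.nn_integral_fst[symmetric], measurable, simp add: path_map_def)

text \<open>A shift by \<open>a\<close> turns \<open>X t - x\<close> into \<open>(X (t + a) - X a) - (x - X a)\<close>, and Lebesgue measure is invariant
  under the random translation by \<open>X a\<close>. For \<open>a = 0\<close> this replaces \<open>X\<close> by a process that vanishes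
  at time \<open>0\<close> everywhere.\<close>

lemma nn_integral_path_measure_shift:
  assumes [measurable]: "h \<in> borel_measurable paths" and a: "a \<in> \<rat>"
  shows "(\<integral>\<^sup>+z. h (path_shift a z) \<partial>path_measure) =
    (\<integral>\<^sup>+\<omega>. (\<integral>\<^sup>+x. h (translated_path (\<lambda>t. X (t + a) \<omega> - X a \<omega>) x) \<partial>lborel) \<partial>P)"
proof -
  have "(\<integral>\<^sup>+z. h (path_shift a z) \<partial>path_measure) =
      (\<integral>\<^sup>+\<omega>. (\<integral>\<^sup>+x. h (path_shift a (translated_path (\<lambda>t. X t \<omega>) x)) \<partial>lborel) \<partial>P)"
    by (rule nn_integral_path_measure) measurable
  also have "\<dots> = (\<integral>\<^sup>+\<omega>. (\<integral>\<^sup>+x. h (translated_path (\<lambda>t. X (t + a) \<omega> - X a \<omega>) x) \<partial>lborel) \<partial>P)"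
  proof (rule nn_integral_cong)
    fix \<omega>
    have rat: "t + a \<in> \<rat> \<longleftrightarrow> t \<in> \<rat>" for t
      using a Rats_diff[of "t + a" a] by (auto intro: Rats_add)
    have "path_shift a (translated_path (\<lambda>t. X t \<omega>) (X a \<omega> + 1 * x)) = translated_path (\<lambda>t. X (t + a) \<omega> - X a \<omega>) x" for x
      by (auto simp: path_shift_def translated_path_def rat fun_eq_iff)
    then show "(\<integral>\<^sup>+x. h (path_shift a (translated_path (\<lambda>t. X t \<omega>) x)) \<partial>lborel) =
        (\<integral>\<^sup>+x. h (translated_path (\<lambda>t. X (t + a) \<omega> - X a \<omega>) x) \<partial>lborel)"
      using nn_integral_real_affine[of "\<lambda>x. h (path_shift a (translated_path (\<lambda>t. X t \<omega>) x))" 1 "X a \<omega>"]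
      by simp
  qed
  finally show ?thesis .
qed

lemma path_measure_shift_invariant:
  assumes h [measurable]: "h \<in> borel_measurable paths" and a: "a \<in> \<rat>"
  shows "(\<integral>\<^sup>+z. h (path_shift a z) \<partial>path_measure) = (\<integral>\<^sup>+z. h z \<partial>path_measure)"
proof -
  interpret PL: pair_sigma_finite P lborel ..
  have swap: "(\<integral>\<^sup>+\<omega>. (\<integral>\<^sup>+x. h (translated_path (\<lambda>t. Y t \<omega>) x) \<partial>lborel) \<partial>P) =
      (\<integral>\<^sup>+x. (\<integral>\<^sup>+p. h (translated_path p x) \<partial>product_law \<rat> P Y) \<partial>lborel)"
    if Y [measurable]: "\<And>t. Y t \<in> borel_measurable P" for Y
  proof -
    have "(\<integral>\<^sup>+\<omega>. (\<integral>\<^sup>+x. h (translated_path (\<lambda>t. Y t \<omega>) x) \<partial>lborel) \<partial>P) =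
        (\<integral>\<^sup>+x. (\<integral>\<^sup>+\<omega>. h (translated_path (\<lambda>t. Y t \<omega>) x) \<partial>P) \<partial>lborel)"
      by (rule PL.Fubini'[symmetric]) measurable
    also have "\<dots> = (\<integral>\<^sup>+x. (\<integral>\<^sup>+p. h (translated_path p x) \<partial>product_law \<rat> P Y) \<partial>lborel)"
    proof (rule nn_integral_cong)
      fix x
      have [measurable]: "(\<lambda>p. h (translated_path p x)) \<in> borel_measurable (PiM \<rat> (\<lambda>_. borel))"
        by measurable
      have [measurable]: "(\<lambda>\<omega>. \<lambda>t\<in>\<rat>. Y t \<omega>) \<in> measurable P (PiM \<rat> (\<lambda>_. borel))"
        by (intro measurable_restrict Y)
      have "translated_path (\<lambda>t\<in>\<rat>. Y t \<omega>) x = translated_path (\<lambda>t. Y t \<omega>) x" for \<omega>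
        by (auto simp: translated_path_def)
      then show "(\<integral>\<^sup>+\<omega>. h (translated_path (\<lambda>t. Y t \<omega>) x) \<partial>P) =
          (\<integral>\<^sup>+p. h (translated_path p x) \<partial>product_law \<rat> P Y)"
        by (subst nn_integral_distr) auto
    qed
    finally show ?thesis .
  qed
  have "distr P (PiM \<rat> (\<lambda>_. borel)) (\<lambda>\<omega>. \<lambda>t\<in>\<rat>. X (t + a) \<omega> - X a \<omega>) = product_law \<rat> P X"
    using a by (intro fbm_on_distr_eq[OF prob_space_axioms prob_space_axioms _ fbm_X] fbm_on_increments[OF fbm_X]) auto
  then show ?thesis
    unfolding nn_integral_path_measure_shift[OF h a] nn_integral_path_measure[OF h]
    by (simp add: swap)
qed

lemma emeasure_path_shift_vimage:
  assumes "A \<in> sets paths" "a \<in> \<rat>"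
  shows "emeasure path_measure (path_shift a -` A) = emeasure path_measure A"
proof -
  have A [measurable]: "A \<in> sets paths" by fact
  have [measurable]: "path_shift a -` A \<in> sets paths"
    using measurable_sets[OF measurable_path_shift A, of a] by simp
  have "(indicator A (path_shift a z) :: ennreal) = indicator (path_shift a -` A) z" for z
    by (simp add: indicator_def)
  then have "emeasure path_measure (path_shift a -` A) = (\<integral>\<^sup>+z. indicator A (path_shift a z) \<partial>path_measure)"
    by simp
  also have "\<dots> = (\<integral>\<^sup>+z. indicator A z \<partial>path_measure)"
    by (rule path_measure_shift_invariant) (use assms in auto)
  finally show ?thesis by simp
qed

lemma increment_normal:
  assumes "0 < n"
  shows "normal_with_sd P (sqrt v * real n powr H) (\<lambda>\<omega>. X (real n) \<omega> - X 0 \<omega>)"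
proof -
  have "fbm_on P v H \<rat> (\<lambda>t \<omega>. X (t + 0) \<omega> - X 0 \<omega>)"
    by (rule fbm_on_increments[OF fbm_X]) auto
  from fbm_on_normal[OF prob_space_axioms this, of "real n"] show ?thesis
    using assms v_pos by simp
qed

text \<open>The value at time \<open>0\<close> is distributed by Lebesgue measure, independently of the increment
  \<open>X n - X 0\<close>, and the hypothesis forces this increment into \<open>T\<close>.\<close>

lemma emeasure_path_measure_two_times:
  assumes [measurable]: "S \<in> sets borel" and c: "0 \<le> c" and R: "\<And>x y. \<bar>x\<bar> \<le> c \<Longrightarrow> y \<in> S \<Longrightarrow> y - x \<in> T" and [measurable]: "T \<in> sets borel"
  shows "emeasure path_measure {z. \<bar>fst z 0\<bar> \<le> c \<and> fst z (real n) \<in> S} \<le>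
    ennreal (2 * c) * emeasure P {\<omega> \<in> space P. X (real n) \<omega> - X 0 \<omega> \<in> T}"
proof -
  let ?h = "\<lambda>z :: path. indicator {-c..c} (fst z 0) * indicator S (fst z (real n)) :: ennreal"
  have [measurable]: "{z :: path. \<bar>fst z 0\<bar> \<le> c \<and> fst z (real n) \<in> S} \<in> sets paths"
  proof -
    have "{z \<in> space paths. \<bar>fst z 0\<bar> \<le> c \<and> fst z (real n) \<in> S} \<in> sets paths" by measurable
    then show ?thesis by simp
  qed
  have "?h z = indicator {z. \<bar>fst z 0\<bar> \<le> c \<and> fst z (real n) \<in> S} z" for z
    by (auto simp: indicator_def)
  then have "emeasure path_measure {z. \<bar>fst z 0\<bar> \<le> c \<and> fst z (real n) \<in> S} = (\<integral>\<^sup>+z. ?h (path_shift 0 z) \<partial>path_measure)"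
    by simp
  also have "\<dots> = (\<integral>\<^sup>+\<omega>. (\<integral>\<^sup>+x. ?h (translated_path (\<lambda>t. X (t + 0) \<omega> - X 0 \<omega>) x) \<partial>lborel) \<partial>P)"
    by (rule nn_integral_path_measure_shift) auto
  also have "\<dots> \<le> (\<integral>\<^sup>+\<omega>. (\<integral>\<^sup>+x. indicator T (X (real n) \<omega> - X 0 \<omega>) * indicator {-c..c} x \<partial>lborel) \<partial>P)"
  proof (intro nn_integral_mono)
    fix \<omega> x
    show "?h (translated_path (\<lambda>t. X (t + 0) \<omega> - X 0 \<omega>) x) \<le> indicator T (X (real n) \<omega> - X 0 \<omega>) * indicator {-c..c} x"
      using R[of "- x" "X (real n) \<omega> - X 0 \<omega> - x"]
      by (auto simp: translated_path_def indicator_def)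
  qed
  also have "\<dots> = (\<integral>\<^sup>+\<omega>. ennreal (2 * c) * indicator {\<omega> \<in> space P. X (real n) \<omega> - X 0 \<omega> \<in> T} \<omega> \<partial>P)"
    using c by (intro nn_integral_cong) (subst nn_integral_cmult_indicator, auto simp: indicator_def emeasure_lborel_Icc_eq)
  also have "\<dots> = ennreal (2 * c) * emeasure P {\<omega> \<in> space P. X (real n) \<omega> - X 0 \<omega> \<in> T}"
    by (rule nn_integral_cmult_indicator) measurable
  finally show ?thesis .
qed

lemma emeasure_path_measure_bounded:
  assumes "0 \<le> c"
  shows "emeasure path_measure (strip 0 c) \<le> ennreal (2 * c)"
  using emeasure_path_measure_two_times[of UNIV c UNIV 0] assms emeasure_space_1 by simp

lemma measurable_path_event [measurable]: "(strip t c) \<in> sets paths"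
proof -
  have "{z \<in> space paths. \<bar>fst z t\<bar> \<le> c} \<in> sets paths" by measurable
  then show ?thesis by simp
qed

lemma sigma_finite_path_measure: "sigma_finite_measure path_measure"
proof (rule sigma_finite_measure.intro, intro exI conjI)
  let ?A = "range (\<lambda>k :: nat. (strip 0 (real k)))"
  show "countable ?A" "?A \<subseteq> sets path_measure" by auto
  show "\<Union> ?A = space path_measure"
    using real_arch_simple by auto
  have "emeasure path_measure (strip 0 (real k)) < \<infinity>" for k :: nat
    by (rule le_less_trans[OF emeasure_path_measure_bounded]) auto
  then show "\<forall>a\<in>?A. emeasure path_measure a \<noteq> \<infinity>"
    by (auto simp: less_top)
qed

text \<open>The growth argument: the images of a wandering set of mass \<open>\<delta>\<close> under the first \<open>N\<close> iterates keep
  total mass \<open>N * \<delta> / 2\<close> within \<open>\<bar>w 0\<bar> \<le> c N\<close>, where \<open>c N\<close> grows like \<open>N\<^sup>H\<close>.\<close>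

lemma conservative_path_shift: "conservative_flow path_measure (path_shift 1)"
  unfolding conservative_flow_def
proof
  assume "\<exists>W\<in>sets path_measure. 0 < emeasure path_measure W \<and>
    disjoint_family (\<lambda>n::int. flow_iterate path_measure (path_shift 1) n ` W)"
  then obtain W where W [measurable]: "W \<in> sets paths" and pos: "0 < emeasure path_measure W"
    and disj: "disjoint_family (\<lambda>n::int. path_shift (real_of_int n) ` W)"
    by (auto simp: flow_iterate_path_shift)
  define C where "C c = (strip 0 c)" for c
  have C [measurable]: "C c \<in> sets paths" for c by (simp add: C_def)
  have "\<exists>k::nat. 0 < emeasure path_measure (W \<inter> C (real k))"
  proof (rule ccontr)
    assume "\<not> ?thesis"
    then have "emeasure path_measure (\<Union>k::nat. W \<inter> C (real k)) = 0"
      by (intro emeasure_UN_eq_0) auto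
    moreover have "(\<Union>k::nat. W \<inter> C (real k)) = W"
      using real_arch_simple by (auto simp: C_def)
    ultimately show False using pos by simp
  qed
  then obtain k :: nat where k: "0 < emeasure path_measure (W \<inter> C (real k))" by blast
  define W' where "W' = W \<inter> C (real k)"
  have W' [measurable]: "W' \<in> sets paths" by (simp add: W'_def)
  have fin: "emeasure path_measure W' \<le> ennreal (2 * real k)"
  proof -
    have "emeasure path_measure W' \<le> emeasure path_measure (C (real k))"
      by (rule emeasure_mono) (auto simp: W'_def)
    also have "\<dots> \<le> ennreal (2 * real k)"
      unfolding C_def by (rule emeasure_path_measure_bounded) simp
    finally show ?thesis .
  qed
  define \<delta> where "\<delta> = measure path_measure W'"
  have \<delta>: "emeasure path_measure W' = ennreal \<delta>"
    unfolding \<delta>_def using fin by (intro emeasure_eq_ennreal_measure) (auto simp: top_unique)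
  have \<delta>_pos: "0 < \<delta>"
    using k unfolding W'_def[symmetric] \<delta> by simp
  \<comment> \<open>By Chebyshev's inequality an increment exceeds \<open>R\<close> standard deviations with probability at most
    \<open>1 / R\<^sup>2\<close>; this choice of \<open>R\<close> limits the mass of the paths that start in \<open>[-k, k]\<close> and move further than that to \<open>\<delta> / 2\<close>.\<close>
  define R where "R = sqrt (4 * (real k + 1) / \<delta>)"
  have R: "0 < R" "2 * real k * (1 / R\<^sup>2) \<le> \<delta> / 2"
    using \<delta>_pos by (auto simp: R_def field_simps)
  define c where "c N = real k + R * (sqrt v * real N powr H)" for N
  have c0: "0 \<le> c N" for N
    using R v_pos by (auto simp: c_def)
  have stay: "ennreal (\<delta> / 2) \<le> emeasure path_measure (W' \<inter> (strip (real n) (c N)))" if n: "n \<in> {1..N}" for n N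
  proof -
    let ?\<sigma> = "sqrt v * real n powr H"
    have \<sigma>: "0 < ?\<sigma>" using n v_pos by simp
    have "?\<sigma> \<le> sqrt v * real N powr H"
      using n v_pos H_pos by (intro mult_left_mono powr_mono2) auto
    then have cN: "real k + R * ?\<sigma> \<le> c N"
      using R by (simp add: c_def)
    have "emeasure path_measure (W' - (strip (real n) (c N))) \<le>
        emeasure path_measure {z. \<bar>fst z 0\<bar> \<le> real k \<and> fst z (real n) \<in> {y. real k + R * ?\<sigma> < \<bar>y\<bar>}}"
    proof (rule emeasure_mono)
      show "{z. \<bar>fst z 0\<bar> \<le> real k \<and> fst z (real n) \<in> {y. real k + R * ?\<sigma> < \<bar>y\<bar>}} \<in> sets path_measure"
      proof -
        have "{z \<in> space paths. \<bar>fst z 0\<bar> \<le> real k \<and> real k + R * ?\<sigma> < \<bar>fst z (real n)\<bar>} \<in> sets paths" by measurable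
        then show ?thesis by simp
      qed
    qed (use cN in \<open>auto simp: W'_def C_def\<close>)
    also have "\<dots> \<le> ennreal (2 * real k) * emeasure P {\<omega> \<in> space P. X (real n) \<omega> - X 0 \<omega> \<in> {y. R * ?\<sigma> < \<bar>y\<bar>}}"
      by (rule emeasure_path_measure_two_times) auto
    also have "\<dots> \<le> ennreal (2 * real k) * ennreal (1 / R\<^sup>2)"
      using normal_tail[OF \<sigma> increment_normal R(1)] n by (intro mult_left_mono) auto
    also have "\<dots> = ennreal (2 * real k * (1 / R\<^sup>2))"
      by (rule ennreal_mult[symmetric]) auto
    also have "\<dots> \<le> ennreal (\<delta> / 2)"
      by (rule ennreal_leI) (rule R)
    finally have out: "emeasure path_measure (W' - (strip (real n) (c N))) \<le> ennreal (\<delta> / 2)" .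
    have "ennreal \<delta> = emeasure path_measure (W' \<inter> (strip (real n) (c N))) + emeasure path_measure (W' - (strip (real n) (c N)))"
      unfolding \<delta>[symmetric] by (subst plus_emeasure) (auto intro!: arg_cong[where f = "emeasure path_measure"])
    also have "\<dots> \<le> emeasure path_measure (W' \<inter> (strip (real n) (c N))) + ennreal (\<delta> / 2)"
      by (intro add_left_mono out)
    finally have "ennreal \<delta> - ennreal (\<delta> / 2) \<le> emeasure path_measure (W' \<inter> (strip (real n) (c N)))"
      by (intro ennreal_minus_le_iff[THEN iffD2]) (auto simp: add.commute)
    then show ?thesis
      using \<delta>_pos by (simp add: ennreal_minus)
  qed
  have bound: "real N * (\<delta> / 2) \<le> 2 * c N" for N
  proof -
    let ?A = "\<lambda>n :: nat. path_shift (- real n) -` (W' \<inter> (strip (real n) (c N)))"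
    have A: "?A n \<in> sets paths" for n
      using measurable_sets[OF measurable_path_shift, of "W' \<inter> (strip (real n) (c N))" "- real n"] by simp
    have dj: "disjoint_family_on ?A {1..N}"
      unfolding disjoint_family_on_def
    proof (intro ballI impI)
      fix i j assume "i \<in> {1..N}" "j \<in> {1..N}" "i \<noteq> j"
      then have "path_shift (real_of_int (int i)) ` W \<inter> path_shift (real_of_int (int j)) ` W = {}"
        using disj by (intro disjoint_family_onD[OF disj]) auto
      then show "?A i \<inter> ?A j = {}"
        by (auto simp: path_shift_image W'_def)
    qed
    have "ennreal (real N * (\<delta> / 2)) = (\<Sum>n\<in>{1..N}. ennreal (\<delta> / 2))"
      using \<delta>_pos by (simp add: ennreal_mult'[symmetric] ennreal_of_nat_eq_real_of_nat)
    also have "\<dots> \<le> (\<Sum>n\<in>{1..N}. emeasure path_measure (?A n))"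
      by (intro sum_mono) (subst emeasure_path_shift_vimage, auto intro!: stay)
    also have "\<dots> = emeasure path_measure (\<Union>n\<in>{1..N}. ?A n)"
      using A dj by (intro sum_emeasure) auto
    also have "\<dots> \<le> emeasure path_measure (C (c N))"
      by (intro emeasure_mono) (auto simp: C_def path_shift_def)
    also have "\<dots> \<le> ennreal (2 * c N)"
      unfolding C_def by (rule emeasure_path_measure_bounded[OF c0])
    finally show ?thesis
      using c0[of N] by (simp add: ennreal_le_iff)
  qed
  have "((\<lambda>N. c N / real N) \<longlongrightarrow> 0) sequentially"
  proof -
    have "(\<lambda>N. real k * (1 / real N) + R * sqrt v * (real N powr (H - 1))) \<longlonglongrightarrow> real k * 0 + R * sqrt v * 0"
      using H_less_1
      by (intro tendsto_intros lim_1_over_n tendsto_neg_powr filterlim_real_sequentially) auto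
    moreover have "c N / real N = real k * (1 / real N) + R * sqrt v * (real N powr (H - 1))" for N
      by (cases "N = 0") (auto simp: c_def add_divide_distrib powr_diff)
    ultimately show ?thesis by simp
  qed
  then have "\<forall>\<^sub>F N in sequentially. 0 < N \<and> c N / real N < \<delta> / 4"
    using \<delta>_pos by (intro eventually_conj eventually_gt_at_top order_tendstoD(2)) auto
  then obtain N where N: "0 < N" "c N / real N < \<delta> / 4"
    using eventually_happens'[OF sequentially_bot] by blast
  then have "2 * c N < real N * (\<delta> / 2)" by (simp add: field_simps)
  with bound[of N] show False by simp
qed

lemma path_measure_two_times_tendsto_0:
  assumes "0 \<le> K" "0 \<le> J"
  shows "(\<lambda>n. measure path_measure {z. \<bar>fst z 0\<bar> \<le> J \<and> fst z (real n) \<in> {-K..K}}) \<longlonglongrightarrow> 0"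
proof (rule tendsto_sandwich[where f = "\<lambda>_. 0"])
  show "\<forall>\<^sub>F n in sequentially. measure path_measure {z. \<bar>fst z 0\<bar> \<le> J \<and> fst z (real n) \<in> {-K..K}} \<le>
      2 * J * ((K + J) / sqrt v) * real n powr (- H)"
  proof (rule eventually_mono[OF eventually_gt_at_top[of 0]])
    fix n :: nat assume n: "0 < n"
    have \<sigma>: "0 < sqrt v * real n powr H" using n v_pos by simp
    have "emeasure path_measure {z. \<bar>fst z 0\<bar> \<le> J \<and> fst z (real n) \<in> {-K..K}} \<le>
        ennreal (2 * J) * emeasure P {\<omega> \<in> space P. X (real n) \<omega> - X 0 \<omega> \<in> {y. \<bar>y\<bar> \<le> K + J}}"
      by (rule emeasure_path_measure_two_times) (use assms in auto)
    also have "\<dots> \<le> ennreal (2 * J) * ennreal ((K + J) / (sqrt v * real n powr H))"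
      using normal_small_ball[OF \<sigma> increment_normal[OF n], of "K + J"] assms by (intro mult_left_mono) auto
    also have "\<dots> = ennreal (2 * J * ((K + J) / sqrt v) * real n powr (- H))"
      using assms v_pos by (simp add: ennreal_mult[symmetric] powr_minus field_simps)
    finally show "measure path_measure {z. \<bar>fst z 0\<bar> \<le> J \<and> fst z (real n) \<in> {-K..K}} \<le>
        2 * J * ((K + J) / sqrt v) * real n powr (- H)"
      unfolding measure_def using assms v_pos by (intro enn2real_leI) auto
  qed
  have "(\<lambda>n. 2 * J * ((K + J) / sqrt v) * real n powr (- H)) \<longlonglongrightarrow> 2 * J * ((K + J) / sqrt v) * 0"
    using H_pos by (intro tendsto_intros tendsto_neg_powr filterlim_real_sequentially) auto
  then show "(\<lambda>n. 2 * J * ((K + J) / sqrt v) * real n powr (- H)) \<longlonglongrightarrow> 0" by simp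
qed (auto intro!: always_eventually)

text \<open>Splitting \<open>\<bar>w n\<bar> \<le> K\<close> according to whether \<open>\<bar>w 0\<bar> \<le> J\<close> shows that its mass under \<open>\<nu>\<close>, which does not
  depend on \<open>n\<close>, is arbitrarily small: first \<open>J\<close> and then \<open>n\<close> is chosen large.\<close>

lemma null_path_shift: "null_flow path_measure (path_shift 1)"
  unfolding null_flow_def
proof
  assume "\<exists>\<nu>. sets \<nu> = sets path_measure \<and> finite_measure \<nu> \<and> emeasure \<nu> (space \<nu>) \<noteq> 0 \<and>
           absolutely_continuous path_measure \<nu> \<and> distr \<nu> \<nu> (path_shift 1) = \<nu>"
  then obtain \<nu> where sets: "sets \<nu> = sets path_measure" and \<nu>: "finite_measure \<nu>" "emeasure \<nu> (space \<nu>) \<noteq> 0"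
      "absolutely_continuous path_measure \<nu>" and inv: "distr \<nu> \<nu> (path_shift 1) = \<nu>"
    by auto
  interpret \<nu>: finite_measure \<nu> by fact
  have sets' [measurable_cong]: "sets \<nu> = sets paths" using sets by simp
  have space [simp]: "space \<nu> = UNIV" using sets_eq_imp_space_eq[OF sets'] by simp
  have step: "measure \<nu> (path_shift 1 -` A) = measure \<nu> A" if "A \<in> sets paths" for A
  proof -
    have "measure \<nu> A = measure (distr \<nu> \<nu> (path_shift 1)) A" by (simp add: inv)
    also have "\<dots> = measure \<nu> (path_shift 1 -` A)"
      using that sets' by (subst measure_distr) (auto simp: measurable_cong_sets[OF sets' sets'])
    finally show ?thesis ..
  qed
  have shift: "measure \<nu> (strip (real n) K) = measure \<nu> (strip 0 K)" for n K
  proof (induction n)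
    case (Suc n)
    have "(strip (real (Suc n)) K) = path_shift 1 -` (strip (real n) K)"
      by (auto simp: path_shift_def add.commute)
    then have "measure \<nu> (strip (real (Suc n)) K) = measure \<nu> (strip (real n) K)"
      by (simp only: step[OF measurable_path_event])
    then show ?case by (simp only: Suc)
  qed simp
  have event [measurable]: "(strip t c) \<in> sets \<nu>" for t c
    unfolding sets' by measurable
  have small: "measure \<nu> (strip 0 (real K)) = 0" for K :: nat
  proof (rule ccontr)
    assume "measure \<nu> (strip 0 (real K)) \<noteq> 0"
    then have pos: "0 < measure \<nu> (strip 0 (real K))"
      by (simp add: zero_less_measure_iff)
    define e where "e = measure \<nu> (strip 0 (real K)) / 2"
    have e: "0 < e" using pos by (simp add: e_def)
    have "(\<lambda>J. measure \<nu> (UNIV - (strip 0 (real J)))) \<longlonglongrightarrow> measure \<nu> (\<Inter>J. UNIV - (strip 0 (real J)))"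
      using sets.compl_sets[OF event] by (intro \<nu>.finite_Lim_measure_decseq) (auto simp: decseq_def)
    moreover have "(\<Inter>J::nat. UNIV - (strip 0 (real J))) = {}"
      using real_arch_simple by fastforce
    ultimately have "(\<lambda>J. measure \<nu> (UNIV - (strip 0 (real J)))) \<longlonglongrightarrow> 0"
      by (simp only: measure_empty)
    from order_tendstoD(2)[OF this e] obtain J :: nat where J: "measure \<nu> (UNIV - (strip 0 (real J))) < e"
      by (auto simp: eventually_sequentially)
    let ?A = "\<lambda>n :: nat. {z :: path. \<bar>fst z 0\<bar> \<le> real J \<and> fst z (real n) \<in> {- real K..real K}}"
    have A: "?A n \<in> sets paths" for n
    proof -
      have "{z \<in> space paths. \<bar>fst z 0\<bar> \<le> real J \<and> fst z (real n) \<in> {- real K..real K}} \<in> sets paths" by measurable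
      then show ?thesis by simp
    qed
    have "\<exists>n. measure \<nu> (?A n) < e"
    proof (rule absolutely_continuous_measure_small[OF \<nu>(1) sets \<nu>(3)])
      show "emeasure path_measure (?A n) < \<infinity>" for n
      proof -
        have "emeasure path_measure (?A n) \<le> emeasure path_measure (strip 0 (real J))"
          by (rule emeasure_mono) auto
        also have "\<dots> \<le> ennreal (2 * real J)" by (rule emeasure_path_measure_bounded) simp
        finally show ?thesis by (rule le_less_trans) simp
      qed
    qed (use A e path_measure_two_times_tendsto_0[of "real K" "real J"] in auto)
    then obtain n where n: "measure \<nu> (?A n) < e" by blast
    have "2 * e = measure \<nu> (strip (real n) (real K))"
      by (simp add: e_def shift)
    also have "\<dots> \<le> measure \<nu> (?A n \<union> (UNIV - (strip 0 (real J))))"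
      using A sets.compl_sets[OF event] by (intro \<nu>.finite_measure_mono) (auto simp: sets' abs_le_iff)
    also have "\<dots> \<le> measure \<nu> (?A n) + measure \<nu> (UNIV - (strip 0 (real J)))"
      using A sets.compl_sets[OF event] by (intro measure_subadditive) (auto simp: sets' \<nu>.emeasure_eq_measure)
    also have "\<dots> < 2 * e" using n J by simp
    finally show False by simp
  qed
  have "emeasure \<nu> (\<Union>K::nat. (strip 0 (real K))) = 0"
    using small by (intro emeasure_UN_eq_0) (auto simp: \<nu>.emeasure_eq_measure)
  moreover have "(\<Union>K::nat. (strip 0 (real K))) = space \<nu>"
    using real_arch_simple by auto
  ultimately show False using \<nu>(2) by simp
qed

text \<open>The points of \<open>D\<close> that never return to \<open>D\<close> form a wandering set, hence a null set. An orbit that visits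
  \<open>D\<close>, but only at negative times, has a last visit and passes through this null set.\<close>

lemma recurrence:
  assumes D: "D \<in> sets paths"
  shows "AE z in path_measure. (\<exists>n :: int. path_shift (real_of_int n) z \<in> D) \<longrightarrow> (\<exists>n :: nat. path_shift (real n) z \<in> D)"
proof -
  define W where "W = {z \<in> D. \<forall>n :: nat. 0 < n \<longrightarrow> path_shift (real n) z \<notin> D}"
  have D' [measurable]: "D \<in> sets paths" by fact
  have W [measurable]: "W \<in> sets paths"
  proof -
    have "{z \<in> space paths. z \<in> D \<and> (\<forall>n :: nat. 0 < n \<longrightarrow> path_shift (real n) z \<notin> D)} \<in> sets paths" by measurable
    then show ?thesis by (simp add: W_def)
  qed
  have "path_shift (real_of_int i) ` W \<inter> path_shift (real_of_int j) ` W = {}" if "i < j" for i j :: int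
  proof (rule ccontr)
    assume "\<not> ?thesis"
    then obtain a b where a: "a \<in> W" and b: "b \<in> W" and eq: "path_shift (real_of_int i) a = path_shift (real_of_int j) b"
      by blast
    have "a = path_shift (real (nat (j - i))) b"
      using arg_cong[OF eq, of "path_shift (- real_of_int i)"] that by (simp add: path_shift_add of_nat_nat)
    moreover have "path_shift (real (nat (j - i))) b \<notin> D"
    proof -
      have "\<forall>n :: nat. 0 < n \<longrightarrow> path_shift (real n) b \<notin> D" using b by (simp add: W_def)
      from this[rule_format, of "nat (j - i)"] that show ?thesis by simp
    qed
    moreover have "a \<in> D" using a by (simp add: W_def)
    ultimately show False by blast
  qed
  then have "disjoint_family (\<lambda>n::int. flow_iterate path_measure (path_shift 1) n ` W)"
    unfolding disjoint_family_on_def flow_iterate_path_shift[OF space_path_measure]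
    by (metis inf_commute linorder_neqE_linordered_idom)
  then have W0: "emeasure path_measure W = 0"
    using conservative_path_shift W unfolding conservative_flow_def by (auto simp: not_less)
  have "AE z in path_measure. \<forall>n :: int. path_shift (real_of_int n) z \<notin> W"
  proof (subst AE_all_countable, rule allI)
    fix n :: int
    have "path_shift (real_of_int n) -` W \<in> sets paths"
      using measurable_sets[OF measurable_path_shift W, of "real_of_int n"] by simp
    then have "path_shift (real_of_int n) -` W \<in> null_sets path_measure"
      using W0 by (auto simp: null_sets_def emeasure_path_shift_vimage)
    from AE_not_in[OF this] show "AE z in path_measure. path_shift (real_of_int n) z \<notin> W" by simp
  qed
  then show ?thesis
  proof eventually_elim
    case (elim z)
    show ?case
    proof (rule impI, rule ccontr)
      assume "\<exists>n :: int. path_shift (real_of_int n) z \<in> D" and none: "\<not> (\<exists>n :: nat. path_shift (real n) z \<in> D)"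
      then obtain n0 :: int where n0: "path_shift (real_of_int n0) z \<in> D" by blast
      have neg: "n < 0" if "path_shift (real_of_int n) z \<in> D" for n :: int
        using none that by (metis not_less of_nat_nat of_int_of_nat_eq)
      define k where "k = (LEAST k :: nat. path_shift (real_of_int (- int k)) z \<in> D)"
      have "path_shift (real_of_int (- int (nat (- n0)))) z \<in> D"
        using n0 neg[OF n0] by simp
      then have k: "path_shift (real_of_int (- int k)) z \<in> D"
        unfolding k_def by (rule LeastI)
      have "path_shift (real_of_int (- int k)) z \<in> W"
        unfolding W_def mem_Collect_eq
      proof (intro conjI allI impI notI)
        fix n :: nat assume n: "0 < n" and "path_shift (real n) (path_shift (real_of_int (- int k)) z) \<in> D"
        then have D: "path_shift (real_of_int (int n - int k)) z \<in> D" by (simp add: path_shift_add)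
        from neg[OF this] have "n < k" by simp
        with D have "path_shift (real_of_int (- int (k - n))) z \<in> D" by (simp add: of_nat_diff)
        then have "k \<le> k - n" unfolding k_def by (rule Least_le)
        with n \<open>n < k\<close> show False by simp
      qed (rule k)
      with elim show False by blast
    qed
  qed
qed

end

section \<open>The noise and its flow\<close>

text \<open>For \<open>\<alpha> < 1\<close> there is no norm to appeal to; \<open>\<bar>s + t\<bar> \<le> 2 * max \<bar>s\<bar> \<bar>t\<bar>\<close> suffices.\<close>

lemma L_alpha_linear:
  assumes \<alpha>: "0 < \<alpha>" and f: "f \<in> L_alpha \<alpha> m" and g: "g \<in> L_alpha \<alpha> m"
  shows "(\<lambda>x. a * f x + b * g x) \<in> L_alpha \<alpha> m"
proof -
  have [measurable]: "f \<in> borel_measurable m" "g \<in> borel_measurable m"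
    and int: "integrable m (\<lambda>x. \<bar>f x\<bar> powr \<alpha>)" "integrable m (\<lambda>x. \<bar>g x\<bar> powr \<alpha>)"
    using f g by (auto simp: L_alpha_def)
  have bound: "\<bar>a * s + b * t\<bar> powr \<alpha> \<le> 2 powr \<alpha> * (\<bar>a\<bar> powr \<alpha> * \<bar>s\<bar> powr \<alpha> + \<bar>b\<bar> powr \<alpha> * \<bar>t\<bar> powr \<alpha>)" for s t
  proof -
    have "\<bar>a * s + b * t\<bar> \<le> 2 * max \<bar>a * s\<bar> \<bar>b * t\<bar>" by linarith
    then have "\<bar>a * s + b * t\<bar> powr \<alpha> \<le> (2 * max \<bar>a * s\<bar> \<bar>b * t\<bar>) powr \<alpha>"
      using \<alpha> by (intro powr_mono2) auto
    also have "\<dots> = 2 powr \<alpha> * (max \<bar>a * s\<bar> \<bar>b * t\<bar>) powr \<alpha>"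
      by (rule powr_mult)
    also have "\<dots> \<le> 2 powr \<alpha> * (\<bar>a * s\<bar> powr \<alpha> + \<bar>b * t\<bar> powr \<alpha>)"
      by (intro mult_left_mono) (auto simp: max_def)
    finally show ?thesis by (simp add: abs_mult powr_mult)
  qed
  have "integrable m (\<lambda>x. \<bar>a * f x + b * g x\<bar> powr \<alpha>)"
  proof (rule Bochner_Integration.integrable_bound)
    show "integrable m (\<lambda>x. 2 powr \<alpha> * (\<bar>a\<bar> powr \<alpha> * \<bar>f x\<bar> powr \<alpha> + \<bar>b\<bar> powr \<alpha> * \<bar>g x\<bar> powr \<alpha>))"
      using int by auto
    show "AE x in m. norm (\<bar>a * f x + b * g x\<bar> powr \<alpha>) \<le>
        norm (2 powr \<alpha> * (\<bar>a\<bar> powr \<alpha> * \<bar>f x\<bar> powr \<alpha> + \<bar>b\<bar> powr \<alpha> * \<bar>g x\<bar> powr \<alpha>))"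
      using bound by (intro AE_I2) simp
  qed measurable
  then show ?thesis by (simp add: L_alpha_def)
qed

lemma char_distr_cong_AE:
  assumes "X \<in> borel_measurable P" "Y \<in> borel_measurable P" "AE \<omega> in P. X \<omega> = Y \<omega>"
  shows "char (distr P borel X) t = char (distr P borel Y) t"
proof -
  have [measurable]: "X \<in> borel_measurable P" "Y \<in> borel_measurable P" by fact+
  show ?thesis
    unfolding char_distr[OF assms(1)] char_distr[OF assms(2)]
    using assms(3) by (intro integral_cong_AE) auto
qed

context sas_random_measure
begin

lemma integral_sum:
  assumes \<alpha>: "0 < \<alpha>" and J: "finite J" and f: "\<And>j. j \<in> J \<Longrightarrow> f j \<in> L_alpha \<alpha> m"
  shows "(\<lambda>x. \<Sum>j\<in>J. c j * f j x) \<in> L_alpha \<alpha> m \<and> (AE \<omega> in P. I (\<lambda>x. \<Sum>j\<in>J. c j * f j x) \<omega> = (\<Sum>j\<in>J. c j * I (f j) \<omega>))"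
  using J f
proof (induction J rule: finite_induct)
  case empty
  have zero: "(\<lambda>_. 0) \<in> L_alpha \<alpha> m" by (simp add: L_alpha_def)
  from integral_linear[OF zero zero, of 0 0] zero show ?case by simp
next
  case (insert j J)
  let ?S = "\<lambda>x. \<Sum>j\<in>J. c j * f j x"
  have S: "?S \<in> L_alpha \<alpha> m" and IS: "AE \<omega> in P. I ?S \<omega> = (\<Sum>j\<in>J. c j * I (f j) \<omega>)"
    using insert by auto
  have fj: "f j \<in> L_alpha \<alpha> m" using insert by simp
  have eq: "(\<lambda>x. \<Sum>j\<in>insert j J. c j * f j x) = (\<lambda>x. c j * f j x + 1 * ?S x)"
    using insert.hyps by (simp add: fun_eq_iff)
  show ?case
    unfolding eq
    using L_alpha_linear[OF \<alpha> fj S, of "c j" 1] integral_linear[OF fj S, of "c j" 1] IS insert.hyps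
    by (auto elim!: eventually_elim2)
qed

lemma char_integral_sum:
  assumes \<alpha>: "0 < \<alpha>" and J: "finite J" and f: "\<And>j. j \<in> J \<Longrightarrow> f j \<in> L_alpha \<alpha> m"
  shows "char (distr P borel (\<lambda>\<omega>. \<Sum>j\<in>J. c j * I (f j) \<omega>)) 1 =
    complex_of_real (exp (- (\<integral>x. \<bar>\<Sum>j\<in>J. c j * f j x\<bar> powr \<alpha> \<partial>m)))"
proof -
  have S: "(\<lambda>x. \<Sum>j\<in>J. c j * f j x) \<in> L_alpha \<alpha> m \<and> (AE \<omega> in P. I (\<lambda>x. \<Sum>j\<in>J. c j * f j x) \<omega> = (\<Sum>j\<in>J. c j * I (f j) \<omega>))"
    by (rule integral_sum[OF \<alpha> J f])
  have "char (distr P borel (I (\<lambda>x. \<Sum>j\<in>J. c j * f j x))) 1 = char (distr P borel (\<lambda>\<omega>. \<Sum>j\<in>J. c j * I (f j) \<omega>)) 1"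
    using S f
    by (intro char_distr_cong_AE borel_measurable_sum borel_measurable_times integral_measurable) auto
  then show ?thesis
    using S by (simp add: integral_char)
qed

text \<open>The preimage map preserves disjointness and countable unions, and \<open>\<mu>\<close> is the image of the
  restriction of \<open>m\<close> to the preimage of \<open>E\<close>. So all defining properties are inherited.\<close>

lemma pullback:
  fixes \<Psi> :: "'e \<Rightarrow> 'c" and N :: "'c measure"
  assumes \<Psi> [measurable]: "\<Psi> \<in> measurable m N" and E [measurable]: "E \<in> sets N"
    and \<mu>: "\<mu> = density (distr m N \<Psi>) (indicator E)" and sf: "sigma_finite_measure \<mu>"
  shows "sas_random_measure P \<alpha> \<mu> (\<lambda>A. M (\<Psi> -` (A \<inter> E) \<inter> space m))
    (\<lambda>f. I (\<lambda>z. indicator (\<Psi> -` E \<inter> space m) z * f (\<Psi> z)))"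
proof -
  let ?pre = "\<lambda>A. \<Psi> -` (A \<inter> E) \<inter> space m"
  let ?S = "\<Psi> -` E \<inter> space m"
  let ?pb = "\<lambda>f z. indicator ?S z * f (\<Psi> z) :: real"
  have sets: "sets \<mu> = sets N" by (simp add: \<mu>)
  have S [measurable]: "?S \<in> sets m" by measurable
  have pre: "?pre A \<in> sets m" if "A \<in> sets \<mu>" for A
    using that by (intro measurable_sets[OF \<Psi>]) (auto simp: sets)
  have em: "emeasure \<mu> A = emeasure m (?pre A)" if A: "A \<in> sets \<mu>" for A
  proof -
    have "emeasure \<mu> A = (\<integral>\<^sup>+x. indicator E x * indicator A x \<partial>distr m N \<Psi>)"
      using A unfolding \<mu> by (simp add: emeasure_density)
    also have "\<dots> = (\<integral>\<^sup>+x. indicator (A \<inter> E) x \<partial>distr m N \<Psi>)"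
      by (intro nn_integral_cong) (auto simp: indicator_def)
    also have "\<dots> = emeasure m (?pre A)"
      using A by (subst nn_integral_indicator) (auto simp: sets emeasure_distr)
    finally show ?thesis .
  qed
  have pb: "?pb f \<in> L_alpha \<alpha> m" and pb_int: "(\<integral>z. \<bar>?pb f z\<bar> powr \<alpha> \<partial>m) = (\<integral>x. \<bar>f x\<bar> powr \<alpha> \<partial>\<mu>)"
    if f: "f \<in> L_alpha \<alpha> \<mu>" for f
  proof -
    have [measurable]: "f \<in> borel_measurable N" and fi: "integrable \<mu> (\<lambda>x. \<bar>f x\<bar> powr \<alpha>)"
      using f by (auto simp: L_alpha_def \<mu>)
    have \<mu>': "\<mu> = density (distr m N \<Psi>) (\<lambda>x. ennreal (indicator E x))"
      unfolding \<mu> by (simp add: ennreal_indicator)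
    have pw: "\<bar>?pb f z\<bar> powr \<alpha> = indicator E (\<Psi> z) *\<^sub>R \<bar>f (\<Psi> z)\<bar> powr \<alpha>" if "z \<in> space m" for z
      using that by (auto simp: indicator_def)
    have "integrable (distr m N \<Psi>) (\<lambda>x. indicator E x *\<^sub>R \<bar>f x\<bar> powr \<alpha>)"
      using fi unfolding \<mu>' by (subst (asm) integrable_density) auto
    then have "integrable m (\<lambda>z. indicator E (\<Psi> z) *\<^sub>R \<bar>f (\<Psi> z)\<bar> powr \<alpha>)"
      by (subst (asm) integrable_distr_eq) auto
    then have "integrable m (\<lambda>z. \<bar>?pb f z\<bar> powr \<alpha>)"
      by (subst Bochner_Integration.integrable_cong[OF refl pw])
    then show "?pb f \<in> L_alpha \<alpha> m" by (simp add: L_alpha_def)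
    have "(\<integral>x. \<bar>f x\<bar> powr \<alpha> \<partial>\<mu>) = (\<integral>x. indicator E x *\<^sub>R \<bar>f x\<bar> powr \<alpha> \<partial>distr m N \<Psi>)"
      unfolding \<mu>' by (subst integral_density) auto
    also have "\<dots> = (\<integral>z. indicator E (\<Psi> z) *\<^sub>R \<bar>f (\<Psi> z)\<bar> powr \<alpha> \<partial>m)"
      by (subst integral_distr) auto
    also have "\<dots> = (\<integral>z. \<bar>?pb f z\<bar> powr \<alpha> \<partial>m)"
      by (rule Bochner_Integration.integral_cong[OF refl pw[symmetric]])
    finally show "(\<integral>z. \<bar>?pb f z\<bar> powr \<alpha> \<partial>m) = (\<integral>x. \<bar>f x\<bar> powr \<alpha> \<partial>\<mu>)" ..
  qed
  have disj: "disjoint_family (\<lambda>n. ?pre (A n))" if "disjoint_family A" for A :: "nat \<Rightarrow> 'c set"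
    using that by (auto simp: disjoint_family_on_def)
  have UN: "?pre (\<Union>n. A n) = (\<Union>n. ?pre (A n))" for A :: "nat \<Rightarrow> 'c set" by auto
  show ?thesis
  proof (intro sas_random_measure.intro sas_random_measure_axioms.intro prob_space_axioms sf)
    fix A :: "nat \<Rightarrow> 'c set"
    assume A: "disjoint_family A" "\<And>n. A n \<in> sets \<mu>"
    show "indep_vars (\<lambda>_. borel) (\<lambda>n. M (?pre (A n))) UNIV" if "\<And>n. emeasure \<mu> (A n) < \<infinity>"
      using A that em by (intro independently_scattered disj pre) auto
    show "AE \<omega> in P. (\<lambda>n. M (?pre (A n)) \<omega>) sums M (?pre (\<Union>n. A n)) \<omega>" if "emeasure \<mu> (\<Union>n. A n) < \<infinity>"
    proof -
      have "emeasure m (\<Union>n. ?pre (A n)) < \<infinity>"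
        using that em[of "\<Union>n. A n"] A unfolding UN by auto
      then show ?thesis
        unfolding UN using A by (intro countably_additive disj pre) auto
    qed
  next
    fix A assume A: "A \<in> sets \<mu>" "emeasure \<mu> A < \<infinity>"
    have "?pb (indicator A) = indicator (?pre A)"
      by (auto simp: indicator_def fun_eq_iff)
    then show "AE \<omega> in P. I (?pb (indicator A)) \<omega> = M (?pre A) \<omega>"
      using integral_indicator[OF pre[OF A(1)]] A em by simp
  next
    show "I (?pb f) \<in> borel_measurable P" if "f \<in> L_alpha \<alpha> \<mu>" for f
      by (intro integral_measurable pb that)
  next
    fix f g a b assume fg: "f \<in> L_alpha \<alpha> \<mu>" "g \<in> L_alpha \<alpha> \<mu>"
    have "?pb (\<lambda>x. a * f x + b * g x) = (\<lambda>z. a * ?pb f z + b * ?pb g z)"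
      by (simp add: fun_eq_iff algebra_simps)
    then show "AE \<omega> in P. I (?pb (\<lambda>x. a * f x + b * g x)) \<omega> = a * I (?pb f) \<omega> + b * I (?pb g) \<omega>"
      using integral_linear[OF pb[OF fg(1)] pb[OF fg(2)], of a b] by simp
  next
    show "char (distr P borel (I (?pb f))) \<theta> = complex_of_real (exp (- (\<bar>\<theta>\<bar> powr \<alpha> * (\<integral>x. \<bar>f x\<bar> powr \<alpha> \<partial>\<mu>))))"
      if "f \<in> L_alpha \<alpha> \<mu>" for f \<theta>
      using integral_char[OF pb[OF that], of \<theta>] by (simp add: pb_int[OF that])
  qed
qed

end

lemma conservative_flow_density:
  assumes E: "E \<in> sets m" and c: "conservative_flow m \<phi>"
  shows "conservative_flow (density m (indicator E)) \<phi>"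
  unfolding conservative_flow_def
proof
  assume "\<exists>W\<in>sets (density m (indicator E)). 0 < emeasure (density m (indicator E)) W \<and>
    disjoint_family (\<lambda>n. flow_iterate (density m (indicator E)) \<phi> n ` W)"
  then obtain W where W: "W \<in> sets m" and pos: "0 < emeasure (density m (indicator E)) W"
    and disj: "disjoint_family (\<lambda>n. flow_iterate (density m (indicator E)) \<phi> n ` W)" by auto
  have iter: "flow_iterate (density m (indicator E)) \<phi> n = flow_iterate m \<phi> n" for n
    by (simp add: flow_iterate_def)
  have "emeasure (density m (indicator E)) W = (\<integral>\<^sup>+x. indicator E x * indicator W x \<partial>m)"
    using E W by (simp add: emeasure_density)
  also have "\<dots> = (\<integral>\<^sup>+x. indicator (W \<inter> E) x \<partial>m)"
    by (intro nn_integral_cong) (auto simp: indicator_def)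
  also have "\<dots> = emeasure m (W \<inter> E)"
    using E W by simp
  finally have "0 < emeasure m (W \<inter> E)" using pos by simp
  moreover have "disjoint_family (\<lambda>n. flow_iterate m \<phi> n ` (W \<inter> E))"
    using disj unfolding iter disjoint_family_on_def by blast
  ultimately show False
    using c E W unfolding conservative_flow_def by blast
qed

lemma null_flow_density:
  assumes E: "E \<in> sets m" and n: "null_flow m \<phi>"
  shows "null_flow (density m (indicator E)) \<phi>"
proof -
  have "absolutely_continuous m \<nu>" if "absolutely_continuous (density m (indicator E)) \<nu>" for \<nu>
  proof -
    have "null_sets m \<subseteq> null_sets (density m (indicator E))"
      using E absolutely_continuousI_density[of "indicator E" m] by (auto simp: absolutely_continuous_def)
    with that show ?thesis by (auto simp: absolutely_continuous_def)
  qed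
  then show ?thesis
    using n unfolding null_flow_def by auto
qed

context fbm_local_time
begin

abbreviation increment_kernel :: "nat \<Rightarrow> 'a \<times> real \<Rightarrow> real" where
  "increment_kernel n z \<equiv> 1 * (case z of (\<omega>, x) \<Rightarrow> l x (real n + 1) \<omega>) + (- 1) * (case z of (\<omega>, x) \<Rightarrow> l x (real n) \<omega>)"

lemma increment_kernel_L_alpha:
  assumes "0 < \<alpha>" "\<alpha> < 2"
  shows "increment_kernel n \<in> L_alpha \<alpha> (P \<Otimes>\<^sub>M lborel)"
  using assms by (intro L_alpha_linear local_time_L_alpha) auto

text \<open>For a fixed \<open>x\<close> the integrand is a functional of the path at nonnegative rational times only, where
  \<open>X\<close> and \<open>B\<close> have the same law. For \<open>B\<close> the functional gives the local time increments.\<close>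

lemma combination_law_transfer:
  fixes c :: "nat \<Rightarrow> real"
  assumes X: "rational_fbm P unit_var H X"
  shows "(\<integral>\<^sup>+z. ennreal (\<bar>\<Sum>n\<in>J. c n * path_local_time (\<lambda>t. fst z (t + real n))\<bar> powr \<alpha>) \<partial>rational_fbm.path_measure P X) =
    (\<integral>\<^sup>+z. ennreal (\<bar>\<Sum>n\<in>J. c n * increment_kernel n z\<bar> powr \<alpha>) \<partial>(P \<Otimes>\<^sub>M lborel))"
proof -
  interpret X: rational_fbm P unit_var H X by fact
  interpret PL: pair_sigma_finite P lborel ..
  let ?Q = "\<rat> \<inter> {0..} :: real set"
  define g where "g x p = ennreal (\<bar>\<Sum>n\<in>J. c n * path_local_time (\<lambda>t. p (t + real n) - x)\<bar> powr \<alpha>)" for x and p :: "real \<Rightarrow> real"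
  have g_cong: "g x p = g x q" if "\<And>t. t \<in> ?Q \<Longrightarrow> p t = q t" for x p q
  proof -
    have "path_local_time (\<lambda>t. p (t + real n) - x) = path_local_time (\<lambda>t. q (t + real n) - x)" for n
      using that by (intro path_local_time_cong) auto
    then show ?thesis by (simp add: g_def)
  qed
  have g_meas: "(\<lambda>y. g (f y) (\<lambda>t. Y t y)) \<in> borel_measurable N"
    if "\<And>t. t \<in> ?Q \<Longrightarrow> Y t \<in> borel_measurable N" "f \<in> borel_measurable N" for Y f and N :: "'c measure"
  proof -
    have [measurable]: "(\<lambda>y. path_local_time (\<lambda>t. Y (t + real n) y - f y)) \<in> borel_measurable N" for n
      using that by (intro measurable_path_local_time borel_measurable_diff) auto
    show ?thesis unfolding g_def by measurable
  qed
  have law: "product_law ?Q P X = product_law ?Q P B"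
    by (rule fbm_on_distr_eq[OF prob_space_axioms prob_space_axioms fbm_on_subset[OF X.fbm_X] fbm_on_subset[OF fbm_on_nonneg_times]]) auto
  have via_law: "(\<integral>\<^sup>+\<omega>. g x (\<lambda>t. Y t \<omega>) \<partial>P) = (\<integral>\<^sup>+p. g x p \<partial>product_law ?Q P Y)"
    if Y: "\<And>t. t \<in> ?Q \<Longrightarrow> Y t \<in> borel_measurable P" for Y x
  proof -
    have "(\<lambda>p. g x (\<lambda>t. p t)) \<in> borel_measurable (PiM ?Q (\<lambda>_. borel))"
      by (rule g_meas) auto
    moreover have "(\<lambda>\<omega>. \<lambda>t\<in>?Q. Y t \<omega>) \<in> measurable P (PiM ?Q (\<lambda>_. borel))"
      using Y by (rule measurable_restrict)
    moreover have "g x (\<lambda>t\<in>?Q. Y t \<omega>) = g x (\<lambda>t. Y t \<omega>)" for \<omega>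
      by (rule g_cong) auto
    ultimately show ?thesis by (subst nn_integral_distr) auto
  qed
  have pair_meas: "(\<lambda>(\<omega>, x). g x (\<lambda>t. Y t \<omega>)) \<in> borel_measurable (P \<Otimes>\<^sub>M lborel)"
    if Y: "\<And>t. t \<in> ?Q \<Longrightarrow> Y t \<in> borel_measurable P" for Y
  proof -
    have "(\<lambda>z. g (snd z) (\<lambda>t. Y t (fst z))) \<in> borel_measurable (P \<Otimes>\<^sub>M lborel)"
    proof (rule g_meas)
      show "(\<lambda>z. Y t (fst z)) \<in> borel_measurable (P \<Otimes>\<^sub>M lborel)" if "t \<in> ?Q" for t
        by (rule measurable_compose[OF measurable_fst Y[OF that]])
    qed simp
    then show ?thesis by (simp add: case_prod_beta')
  qed
  have XQ: "X t \<in> borel_measurable P" for t by simp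
  have BQ: "B t \<in> borel_measurable P" if "t \<in> ?Q" for t using that by (intro measurable_B) auto
  have [measurable]: "(\<lambda>z :: path. path_local_time (\<lambda>t. fst z (t + real n))) \<in> borel_measurable paths" for n
    by (rule measurable_path_local_time) measurable
  have "(\<integral>\<^sup>+z. ennreal (\<bar>\<Sum>n\<in>J. c n * path_local_time (\<lambda>t. fst z (t + real n))\<bar> powr \<alpha>) \<partial>X.path_measure) =
      (\<integral>\<^sup>+\<omega>. (\<integral>\<^sup>+x. ennreal (\<bar>\<Sum>n\<in>J. c n * path_local_time (\<lambda>t. fst (translated_path (\<lambda>t. X t \<omega>) x) (t + real n))\<bar> powr \<alpha>) \<partial>lborel) \<partial>P)"
    by (rule X.nn_integral_path_measure) measurable
  also have "\<dots> = (\<integral>\<^sup>+\<omega>. (\<integral>\<^sup>+x. g x (\<lambda>t. X t \<omega>) \<partial>lborel) \<partial>P)"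
  proof -
    have "path_local_time (\<lambda>t. fst (translated_path (\<lambda>t. X t \<omega>) x) (t + real n)) =
        path_local_time (\<lambda>t. X (t + real n) \<omega> - x)" for \<omega> x n
      by (rule path_local_time_cong) (auto simp: translated_path_def)
    then show ?thesis by (simp add: g_def)
  qed
  also have "\<dots> = (\<integral>\<^sup>+x. (\<integral>\<^sup>+\<omega>. g x (\<lambda>t. X t \<omega>) \<partial>P) \<partial>lborel)"
    by (rule PL.Fubini'[symmetric]) (rule pair_meas[OF XQ])
  also have "\<dots> = (\<integral>\<^sup>+x. (\<integral>\<^sup>+\<omega>. g x (\<lambda>t. B t \<omega>) \<partial>P) \<partial>lborel)"
    by (simp only: via_law[OF XQ] via_law[OF BQ] law)
  also have "\<dots> = (\<integral>\<^sup>+\<omega>. (\<integral>\<^sup>+x. g x (\<lambda>t. B t \<omega>) \<partial>lborel) \<partial>P)"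
    by (rule PL.Fubini') (rule pair_meas[OF BQ])
  also have "\<dots> = (\<integral>\<^sup>+\<omega>. (\<integral>\<^sup>+x. ennreal (\<bar>\<Sum>n\<in>J. c n * increment_kernel n (\<omega>, x)\<bar> powr \<alpha>) \<partial>lborel) \<partial>P)"
    using AE_regular
    by (intro nn_integral_cong_AE) (auto elim!: eventually_mono simp: g_def path_local_time_increment)
  also have "\<dots> = (\<integral>\<^sup>+z. ennreal (\<bar>\<Sum>n\<in>J. c n * increment_kernel n z\<bar> powr \<alpha>) \<partial>(P \<Otimes>\<^sub>M lborel))"
  proof (rule lborel.nn_integral_fst)
    have [measurable]: "(\<lambda>(\<omega>, x). l x (real n + 1) \<omega>) \<in> borel_measurable (P \<Otimes>\<^sub>M lborel)"
      "(\<lambda>(\<omega>, x). l x (real n) \<omega>) \<in> borel_measurable (P \<Otimes>\<^sub>M lborel)" for n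
      by (rule measurable_local_time, simp)+
    show "(\<lambda>z. ennreal (\<bar>\<Sum>n\<in>J. c n * increment_kernel n z\<bar> powr \<alpha>)) \<in> borel_measurable (P \<Otimes>\<^sub>M lborel)"
      by measurable
  qed
  finally show ?thesis .
qed

text \<open>The flow is the unit shift on the invariant set \<open>E\<close> of paths with some nonzero kernel. It preserves the
  measure, so that the Radon-Nikodym factors in the kernels are \<open>1\<close> almost everywhere, and the
  signs \<open>u\<close> are constantly \<open>1\<close>.\<close>

theorem local_time_noise_generated_by_conservative_null_flow:
  fixes P\<^sub>M :: "'w measure"
  assumes \<alpha>: "0 < \<alpha>" "\<alpha> < 2" and sas: "sas_random_measure P\<^sub>M \<alpha> (P \<Otimes>\<^sub>M lborel) M I"
  shows "\<exists>(m :: path measure) \<phi>.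
    generated_by_flow P\<^sub>M (local_time_stable_noise I l) \<alpha> m \<phi> \<and> conservative_flow m \<phi> \<and> null_flow m \<phi>"
proof -
  obtain X where X: "\<And>t. X t \<in> borel_measurable P" "fbm_on P unit_var H \<rat> X"
    using two_sided_copy by blast
  interpret X: rational_fbm P unit_var H X
    by unfold_locales (use X unit_var_pos H_pos H_less_1 in auto)
  interpret M: sas_random_measure P\<^sub>M \<alpha> "P \<Otimes>\<^sub>M lborel" M I by fact
  define k where "k n z = path_local_time (\<lambda>t. fst z (t + real n))" for n and z :: "path"
  have k_meas [measurable]: "k n \<in> borel_measurable paths" for n
    unfolding k_def[abs_def] by (rule measurable_path_local_time) measurable
  have k_shift: "k 0 (path_shift (real n) z) = k n z" for n z
    by (simp add: k_def path_shift_def)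
  define D where "D = {z. k 0 z \<noteq> 0}"
  have D [measurable]: "D \<in> sets paths"
  proof -
    have "{z \<in> space paths. k 0 z \<noteq> 0} \<in> sets paths" by measurable
    then show ?thesis by (simp add: D_def)
  qed
  define E where "E = {z. \<exists>n :: int. path_shift (real_of_int n) z \<in> D}"
  have E [measurable]: "E \<in> sets paths"
  proof -
    have "{z \<in> space paths. \<exists>n :: int. path_shift (real_of_int n) z \<in> D} \<in> sets paths" by measurable
    then show ?thesis by (simp add: E_def)
  qed
  have E_inv: "path_shift (real_of_int a) z \<in> E \<longleftrightarrow> z \<in> E" for a z
  proof
    assume "path_shift (real_of_int a) z \<in> E"
    then obtain n :: int where "path_shift (real_of_int n) (path_shift (real_of_int a) z) \<in> D" by (auto simp: E_def)
    then have "path_shift (real_of_int (n + a)) z \<in> D" by (simp add: path_shift_add)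
    then show "z \<in> E" unfolding E_def by blast
  next
    assume "z \<in> E"
    then obtain n :: int where "path_shift (real_of_int n) z \<in> D" by (auto simp: E_def)
    then have "path_shift (real_of_int (n - a)) (path_shift (real_of_int a) z) \<in> D" by (simp add: path_shift_add)
    then show "path_shift (real_of_int a) z \<in> E" unfolding E_def by blast
  qed
  have k_E: "k n z = 0" if "z \<notin> E" for n z
  proof (rule ccontr)
    assume "k n z \<noteq> 0"
    then have "path_shift (real_of_int (int n)) z \<in> D" by (simp add: D_def k_shift)
    with that show False unfolding E_def by blast
  qed
  define m where "m = density X.path_measure (indicator E)"
  have sets_m [simp, measurable_cong]: "sets m = sets paths" by (simp add: m_def)
  have space_m [simp]: "space m = UNIV" by (simp add: m_def)
  interpret m0: sigma_finite_measure X.path_measure by (rule X.sigma_finite_path_measure)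
  have sf_m: "sigma_finite_measure m"
    unfolding m_def by (subst m0.sigma_finite_iff_density_finite) (auto simp: indicator_def)
  interpret m: sigma_finite_measure m by (rule sf_m)
  have nn_m: "(\<integral>\<^sup>+z. h z \<partial>m) = (\<integral>\<^sup>+z. h z \<partial>X.path_measure)"
    if [measurable]: "h \<in> borel_measurable paths" and "\<And>z. z \<notin> E \<Longrightarrow> h z = 0" for h
    unfolding m_def using that(2)
    by (subst nn_integral_density) (auto intro!: nn_integral_cong simp: indicator_def)
  have shift_m: "distr m m (path_shift (real_of_int a)) = m" for a
  proof (rule measure_eqI)
    fix A assume "A \<in> sets (distr m m (path_shift (real_of_int a)))"
    then have A [measurable]: "A \<in> sets paths" by simp
    have "emeasure (distr m m (path_shift (real_of_int a))) A = emeasure m (path_shift (real_of_int a) -` A)"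
      by (subst emeasure_distr) (auto simp: measurable_cong_sets[OF sets_m sets_m])
    also have "\<dots> = (\<integral>\<^sup>+z. indicator E z * indicator (path_shift (real_of_int a) -` A) z \<partial>X.path_measure)"
      using measurable_sets[OF measurable_path_shift A, of "real_of_int a"]
      unfolding m_def by (subst emeasure_density) auto
    also have "\<dots> = (\<integral>\<^sup>+z. (\<lambda>z. indicator E z * indicator A z) (path_shift (real_of_int a) z) \<partial>X.path_measure)"
      by (intro nn_integral_cong) (auto simp: indicator_def E_inv)
    also have "\<dots> = (\<integral>\<^sup>+z. indicator E z * indicator A z \<partial>X.path_measure)"
      by (rule X.path_measure_shift_invariant) auto
    also have "\<dots> = emeasure m A"
      unfolding m_def by (subst emeasure_density) auto
    finally show "emeasure (distr m m (path_shift (real_of_int a))) A = emeasure m A" .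
  qed simp
  have flow_m: "flow_measure m (path_shift 1) n = m" for n
    unfolding flow_measure_def flow_iterate_path_shift[OF space_m] by (rule shift_m)
  let ?F = "\<lambda>h J c z. \<bar>\<Sum>n\<in>J. c n * h n z\<bar> powr \<alpha>"
  let ?K = "flow_kernel \<alpha> m (path_shift 1) (\<lambda>_. 1) (k 0)"
  have K_meas [measurable]: "?K n \<in> borel_measurable m" for n
    unfolding flow_kernel_def path_shift_funpow by measurable
  have "AE z in m. 1 = RN_deriv m m z"
    by (rule m.RN_deriv_unique) (auto simp: density_1)
  then have K_eq: "AE z in m. \<forall>n. ?K n z = k n z"
  proof eventually_elim
    case (elim z)
    then show ?case
      by (auto simp: flow_kernel_def flow_m path_shift_funpow k_shift elim[symmetric])
  qed
  \<comment> \<open>Off \<open>E\<close> all kernels vanish, so that restricting the measure to \<open>E\<close> does not change the integrals.\<close>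
  have int_transfer: "(\<integral>z. ?F ?K J c z \<partial>m) = (\<integral>z. ?F increment_kernel J c z \<partial>(P \<Otimes>\<^sub>M lborel))"
    and nn_transfer: "(\<integral>\<^sup>+z. ennreal (?F ?K J c z) \<partial>m) = (\<integral>\<^sup>+z. ennreal (?F increment_kernel J c z) \<partial>(P \<Otimes>\<^sub>M lborel))"
    for J c
  proof -
    have "(\<integral>\<^sup>+z. ennreal (?F ?K J c z) \<partial>m) = (\<integral>\<^sup>+z. ennreal (?F k J c z) \<partial>m)"
      using K_eq by (intro nn_integral_cong_AE) (auto elim!: eventually_mono)
    also have "\<dots> = (\<integral>\<^sup>+z. ennreal (?F k J c z) \<partial>X.path_measure)"
      by (rule nn_m) (auto simp: k_E)
    also have "\<dots> = (\<integral>\<^sup>+z. ennreal (?F increment_kernel J c z) \<partial>(P \<Otimes>\<^sub>M lborel))"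
      unfolding k_def by (rule combination_law_transfer) unfold_locales
    finally show nn: "(\<integral>\<^sup>+z. ennreal (?F ?K J c z) \<partial>m) = (\<integral>\<^sup>+z. ennreal (?F increment_kernel J c z) \<partial>(P \<Otimes>\<^sub>M lborel))" .
    have im [measurable]: "increment_kernel n \<in> borel_measurable (P \<Otimes>\<^sub>M lborel)" for n
      using increment_kernel_L_alpha[OF \<alpha>, of n] by (simp add: L_alpha_def)
    have "(\<lambda>z. \<Sum>n\<in>J. c n * increment_kernel n z) \<in> borel_measurable (P \<Otimes>\<^sub>M lborel)"
      by (intro borel_measurable_sum borel_measurable_times[OF borel_measurable_const] im)
    then have "(\<lambda>z. ?F increment_kernel J c z) \<in> borel_measurable (P \<Otimes>\<^sub>M lborel)"
      by measurable
    then show "(\<integral>z. ?F ?K J c z \<partial>m) = (\<integral>z. ?F increment_kernel J c z \<partial>(P \<Otimes>\<^sub>M lborel))"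
      by (subst (1 2) integral_eq_nn_integral) (simp_all only: nn powr_ge_zero AE_I2, measurable)
  qed
  have K_L: "?K n \<in> L_alpha \<alpha> m" for n
  proof -
    have "integrable (P \<Otimes>\<^sub>M lborel) (\<lambda>z. \<bar>increment_kernel n z\<bar> powr \<alpha>)"
      using increment_kernel_L_alpha[OF \<alpha>, of n] by (simp add: L_alpha_def)
    then have "(\<integral>\<^sup>+z. ennreal (\<bar>increment_kernel n z\<bar> powr \<alpha>) \<partial>(P \<Otimes>\<^sub>M lborel)) < \<infinity>"
      unfolding integrable_iff_bounded by simp
    then have "(\<integral>\<^sup>+z. ennreal (\<bar>?K n z\<bar> powr \<alpha>) \<partial>m) < \<infinity>"
      using nn_transfer[of "\<lambda>_. 1" "{n}"] by simp
    then show ?thesis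
      unfolding L_alpha_def by (auto intro!: integrableI_bounded)
  qed
  have k_L: "k 0 \<in> L_alpha \<alpha> m"
  proof -
    have AE: "AE z in m. \<bar>?K 0 z\<bar> powr \<alpha> = \<bar>k 0 z\<bar> powr \<alpha>"
      using K_eq by eventually_elim simp
    have "integrable m (\<lambda>z. \<bar>k 0 z\<bar> powr \<alpha>) \<longleftrightarrow> integrable m (\<lambda>z. \<bar>?K 0 z\<bar> powr \<alpha>)"
      using AE by (intro integrable_cong_AE) auto
    then show ?thesis using K_L[of 0] by (simp add: L_alpha_def)
  qed
  define I1 where "I1 f = I (\<lambda>z. indicator (X.path_map -` E \<inter> space (P \<Otimes>\<^sub>M lborel)) z * f (X.path_map z))" for f
  define M1 where "M1 A = M (X.path_map -` (A \<inter> E) \<inter> space (P \<Otimes>\<^sub>M lborel))" for A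
  have sas1: "sas_random_measure P\<^sub>M \<alpha> m M1 I1"
    unfolding M1_def[abs_def] I1_def[abs_def]
    by (rule M.pullback[where N = paths]) (auto simp: m_def X.path_measure_def sf_m[unfolded m_def X.path_measure_def])
  interpret M1: sas_random_measure P\<^sub>M \<alpha> m M1 I1 by (rule sas1)
  let ?Z = "local_time_stable_noise I l"
  let ?l = "\<lambda>t (\<omega>, x). l x t \<omega>"
  have Z_def: "?Z n \<omega> = I (?l (real n + 1)) \<omega> - I (?l (real n)) \<omega>" for n \<omega>
    by (simp add: local_time_stable_noise_def local_time_stable_motion_def)
  have lL: "?l (real n + 1) \<in> L_alpha \<alpha> (P \<Otimes>\<^sub>M lborel)" "?l (real n) \<in> L_alpha \<alpha> (P \<Otimes>\<^sub>M lborel)" for n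
    by (intro local_time_L_alpha \<alpha>, simp)+
  have Z_meas: "?Z n \<in> borel_measurable P\<^sub>M" for n
    unfolding Z_def[abs_def] by (intro borel_measurable_diff M.integral_measurable lL)
  have Z_AE: "AE \<omega> in P\<^sub>M. ?Z n \<omega> = I (increment_kernel n) \<omega>" for n
    using M.integral_linear[OF lL(1)[of n] lL(2)[of n], of 1 "- 1"] unfolding Z_def
    by eventually_elim linarith
  have law: "distr P\<^sub>M (PiM UNIV (\<lambda>_. borel)) (\<lambda>\<omega> n. ?Z n \<omega>) = distr P\<^sub>M (PiM UNIV (\<lambda>_. borel)) (\<lambda>\<omega> n. I1 (?K n) \<omega>)"
  proof -
    have "distr P\<^sub>M (PiM UNIV (\<lambda>_. borel)) (\<lambda>\<omega>. \<lambda>n\<in>UNIV. ?Z n \<omega>) = distr P\<^sub>M (PiM UNIV (\<lambda>_. borel)) (\<lambda>\<omega>. \<lambda>n\<in>UNIV. I1 (?K n) \<omega>)"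
    proof (rule distr_PiM_eqI_char)
      show "prob_space P\<^sub>M" "prob_space P\<^sub>M" by (rule M.prob_space_axioms)+
      show "?Z n \<in> borel_measurable P\<^sub>M" for n by (rule Z_meas)
      show "I1 (?K n) \<in> borel_measurable P\<^sub>M" for n by (rule M1.integral_measurable[OF K_L])
      fix J :: "nat set" and c assume J: "finite J"
      have "AE \<omega> in P\<^sub>M. \<forall>n. ?Z n \<omega> = I (increment_kernel n) \<omega>"
        using Z_AE by (subst AE_all_countable) simp
      then have "char (distr P\<^sub>M borel (\<lambda>\<omega>. \<Sum>n\<in>J. c n * ?Z n \<omega>)) 1 =
          char (distr P\<^sub>M borel (\<lambda>\<omega>. \<Sum>n\<in>J. c n * I (increment_kernel n) \<omega>)) 1"
        by (intro char_distr_cong_AE borel_measurable_sum borel_measurable_times borel_measurable_const Z_meas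
            M.integral_measurable increment_kernel_L_alpha \<alpha>) (auto elim!: eventually_mono)
      also have "\<dots> = complex_of_real (exp (- (\<integral>z. ?F increment_kernel J c z \<partial>(P \<Otimes>\<^sub>M lborel))))"
        by (intro M.char_integral_sum \<alpha> J increment_kernel_L_alpha)
      also have "\<dots> = complex_of_real (exp (- (\<integral>z. ?F ?K J c z \<partial>m)))"
        by (simp only: int_transfer)
      also have "\<dots> = char (distr P\<^sub>M borel (\<lambda>\<omega>. \<Sum>n\<in>J. c n * I1 (?K n) \<omega>)) 1"
        by (rule M1.char_integral_sum[OF \<alpha>(1) J K_L, symmetric])
      finally show "char (distr P\<^sub>M borel (\<lambda>\<omega>. \<Sum>n\<in>J. c n * ?Z n \<omega>)) 1 =
          char (distr P\<^sub>M borel (\<lambda>\<omega>. \<Sum>n\<in>J. c n * I1 (?K n) \<omega>)) 1" .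
    qed
    then show ?thesis by (simp only: restrict_UNIV)
  qed
  have support: "AE z in m. \<exists>n. ?K n z \<noteq> 0"
  proof -
    have "AE z in m. \<exists>n :: nat. path_shift (real n) z \<in> D"
      using X.recurrence[OF D] unfolding m_def
      by (subst AE_density) (auto simp: E_def indicator_def elim!: eventually_mono split: if_splits)
    then show ?thesis
      using K_eq by eventually_elim (auto simp: D_def k_shift)
  qed
  have nonsing: "nonsingular_map m (path_shift 1)"
  proof -
    have "distr m m (path_shift 1) = m" using shift_m[of 1] by simp
    moreover have "path_shift a \<in> measurable m m" for a
      by (simp add: measurable_cong_sets[OF sets_m sets_m])
    ultimately show ?thesis
      using bij_path_shift[of 1] by (simp add: nonsingular_map_def inv_path_shift absolutely_continuous_def)
  qed
  have "generated_by_flow P\<^sub>M ?Z \<alpha> m (path_shift 1)"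
    unfolding generated_by_flow_def
  proof (intro conjI nonsing exI)
    show "(\<lambda>_. 1) \<in> borel_measurable m" by simp
    show "\<forall>x\<in>space m. (1 :: real) \<in> {- 1, 1}" by simp
    show "k 0 \<in> L_alpha \<alpha> m" by (rule k_L)
    show "AE z in m. \<exists>n. ?K n z \<noteq> 0" by (rule support)
    show "sas_random_measure P\<^sub>M \<alpha> m M1 I1" by (rule sas1)
  qed (rule law)
  moreover have "conservative_flow m (path_shift 1)"
    unfolding m_def by (rule conservative_flow_density[OF _ X.conservative_path_shift]) simp
  moreover have "null_flow m (path_shift 1)"
    unfolding m_def by (rule null_flow_density[OF _ X.null_path_shift]) simp
  ultimately show ?thesis by blast
qed

end

theorem theorem4p1:
  fixes \<alpha> H :: real
    and P' :: "'a measure" and B :: "real \<Rightarrow> 'a \<Rightarrow> real" and l :: "real \<Rightarrow> real \<Rightarrow> 'a \<Rightarrow> real"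
    and P :: "'w measure" and M :: "('a \<times> real) set \<Rightarrow> 'w \<Rightarrow> real"
    and I :: "('a \<times> real \<Rightarrow> real) \<Rightarrow> 'w \<Rightarrow> real"
  assumes "0 < \<alpha>" and "\<alpha> < 2" and "0 < H" and "H < 1"
    and "fractional_brownian_motion P' H B"
    and "local_time P' B l"
    and "sas_random_measure P \<alpha> (P' \<Otimes>\<^sub>M lborel) M I"
  shows "\<exists>(m :: ((real \<Rightarrow> real) \<times> real) measure) \<phi>.
           generated_by_flow P (local_time_stable_noise I l) \<alpha> m \<phi> \<and>
           conservative_flow m \<phi> \<and> null_flow m \<phi>"
proof -
  interpret fbm_local_time P' H B l
    using assms by (intro fbm_local_time.intro fbm_local_time_axioms.intro)
  show ?thesis
    using assms by (intro local_time_noise_generated_by_conservative_null_flow)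
qed

end
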